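(* There is an algorithm running in time $O(|V|+|E|)$ which, given a nice graph $G=(V,E)$ with $n=|V|$ and a proper $k$-vertex coloring of $G$ with $k\leq n$, computes: (i) if $k\equiv 2\pmod 4$ and there is at least one connected component of $G$ containing an odd number of vertices of each color, an improper twin $(k+1)$-edge coloring of $G$; (ii) otherwise, an improper twin $k$-edge coloring of $G$.
   Context: A graph is nice if it has no connected component isomorphic to $K_2$. For an integer $k\geq 2$, an improper twin $k$-edge coloring of $G$ is a map $s:E\to\mathbb{Z}_k$ (adjacent edges may receive equal colors) such that $c_s(v)=\sum_{e\in E_v}s(e)$ computed in $\mathbb{Z}_k$ (with $E_v$ the set of edges incident to $v$; the empty sum is $0$) is a proper vertex coloring of $G$. *)

theory Defs
  imports Main "HOL-Library.FuncSet"
begin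

section \<open>Graphs and colorings\<close>

definition simple_graph :: "'v set \<Rightarrow> 'v set set \<Rightarrow> bool" where
  "simple_graph V E \<longleftrightarrow> finite V \<and> (\<forall>e\<in>E. e \<subseteq> V \<and> card e = 2)"

definition adjacency :: "'v set set \<Rightarrow> ('v \<times> 'v) set" where
  "adjacency E = {(u, v). {u, v} \<in> E}"

definition components :: "'v set \<Rightarrow> 'v set set \<Rightarrow> 'v set set" where
  "components V E = {(adjacency E)\<^sup>* `` {v} |v. v \<in> V}"

definition induced_edges :: "'v set set \<Rightarrow> 'v set \<Rightarrow> 'v set set" where
  "induced_edges E C = {e \<in> E. e \<subseteq> C}"

definition graph_isomorphic ::
  "'v set \<Rightarrow> 'v set set \<Rightarrow> 'w set \<Rightarrow> 'w set set \<Rightarrow> bool" where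
  "graph_isomorphic V E V' E' \<longleftrightarrow>
     (\<exists>f. bij_betw f V V' \<and> (\<forall>u\<in>V. \<forall>v\<in>V. {u, v} \<in> E \<longleftrightarrow> {f u, f v} \<in> E'))"

definition complete_edges :: "'v set \<Rightarrow> 'v set set" where
  "complete_edges V = {{u, v} |u v. u \<in> V \<and> v \<in> V \<and> u \<noteq> v}"

definition nice :: "'v set \<Rightarrow> 'v set set \<Rightarrow> bool" where
  "nice V E \<longleftrightarrow>
     (\<forall>C\<in>components V E.
        \<not> graph_isomorphic C (induced_edges E C) {0, 1::nat} (complete_edges {0, 1}))"

definition proper_vertex_coloring ::
  "nat \<Rightarrow> 'v set \<Rightarrow> 'v set set \<Rightarrow> ('v \<Rightarrow> nat) \<Rightarrow> bool" where
  "proper_vertex_coloring k V E c \<longleftrightarrow>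
     c \<in> V \<rightarrow> {0..<k} \<and> (\<forall>u v. {u, v} \<in> E \<longrightarrow> c u \<noteq> c v)"

text \<open>Elements of \<open>\<int>\<^sub>k\<close> are represented by their residues in \<open>{0..<k}\<close>.\<close>

definition induced_color :: "nat \<Rightarrow> 'v set set \<Rightarrow> ('v set \<Rightarrow> nat) \<Rightarrow> 'v \<Rightarrow> nat" where
  "induced_color k E s v = (\<Sum>e | e \<in> E \<and> v \<in> e. s e) mod k"

definition improper_twin_edge_coloring ::
  "nat \<Rightarrow> 'v set \<Rightarrow> 'v set set \<Rightarrow> ('v set \<Rightarrow> nat) \<Rightarrow> bool" where
  "improper_twin_edge_coloring k V E s \<longleftrightarrow>
     s \<in> E \<rightarrow> {0..<k} \<and> proper_vertex_coloring k V E (induced_color k E s)"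


section \<open>A random access machine with bounded words\<close>

text \<open>
  Algorithms are programs of a while language over scalar registers and
  arrays holding natural numbers. The primitive operations are addition,
  truncated subtraction, comparison and indirect addressing; each node of an
  expression costs one step, and so does each command. Every number that occurs,
  intermediate results and array indices included, must be at most the bound
  \<open>w\<close>, which is a parameter of the semantics: an execution exceeding it gets stuck.
  Hence unit cost cannot be exploited by computing with very large numbers.
\<close>

type_synonym name = string

record store =
  reg :: "name \<Rightarrow> nat"
  arr :: "name \<Rightarrow> nat \<Rightarrow> nat"

datatype aexp =
    Const nat
  | Reg name
  | Arr name aexp
  | Add aexp aexp
  | Sub aexp aexp

datatype bexp =
    Less aexp aexp
  | Eq aexp aexp
  | Neg bexp
  | Conj bexp bexp

datatype com =
    Skip
  | Assign name aexp
  | Store name aexp aexp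
  | Seq com com
  | If bexp com com
  | While bexp com

fun aval :: "aexp \<Rightarrow> store \<Rightarrow> nat" where
  "aval (Const n) s = n"
| "aval (Reg x) s = reg s x"
| "aval (Arr a e) s = arr s a (aval e s)"
| "aval (Add e f) s = aval e s + aval f s"
| "aval (Sub e f) s = aval e s - aval f s"

fun acost :: "aexp \<Rightarrow> nat" where
  "acost (Const n) = 1"
| "acost (Reg x) = 1"
| "acost (Arr a e) = acost e + 1"
| "acost (Add e f) = acost e + acost f + 1"
| "acost (Sub e f) = acost e + acost f + 1"

fun afits :: "nat \<Rightarrow> aexp \<Rightarrow> store \<Rightarrow> bool" where
  "afits w (Const n) s \<longleftrightarrow> n \<le> w"
| "afits w (Reg x) s \<longleftrightarrow> reg s x \<le> w"
| "afits w (Arr a e) s \<longleftrightarrow> afits w e s \<and> aval (Arr a e) s \<le> w"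
| "afits w (Add e f) s \<longleftrightarrow> afits w e s \<and> afits w f s \<and> aval (Add e f) s \<le> w"
| "afits w (Sub e f) s \<longleftrightarrow> afits w e s \<and> afits w f s"

fun bval :: "bexp \<Rightarrow> store \<Rightarrow> bool" where
  "bval (Less e f) s \<longleftrightarrow> aval e s < aval f s"
| "bval (Eq e f) s \<longleftrightarrow> aval e s = aval f s"
| "bval (Neg b) s \<longleftrightarrow> \<not> bval b s"
| "bval (Conj b d) s \<longleftrightarrow> bval b s \<and> bval d s"

fun bcost :: "bexp \<Rightarrow> nat" where
  "bcost (Less e f) = acost e + acost f + 1"
| "bcost (Eq e f) = acost e + acost f + 1"
| "bcost (Neg b) = bcost b + 1"
| "bcost (Conj b d) = bcost b + bcost d + 1"

fun bfits :: "nat \<Rightarrow> bexp \<Rightarrow> store \<Rightarrow> bool" where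
  "bfits w (Less e f) s \<longleftrightarrow> afits w e s \<and> afits w f s"
| "bfits w (Eq e f) s \<longleftrightarrow> afits w e s \<and> afits w f s"
| "bfits w (Neg b) s \<longleftrightarrow> bfits w b s"
| "bfits w (Conj b d) s \<longleftrightarrow> bfits w b s \<and> bfits w d s"

text \<open>
  \<open>exec w p s t s'\<close>: with word bound \<open>w\<close>, the program \<open>p\<close> started in \<open>s\<close> terminates
  in \<open>s'\<close> after exactly \<open>t\<close> steps.
\<close>

inductive exec :: "nat \<Rightarrow> com \<Rightarrow> store \<Rightarrow> nat \<Rightarrow> store \<Rightarrow> bool" for w where
  Skip: "exec w Skip s 1 s"
| Assign: "afits w e s \<Longrightarrow>
    exec w (Assign x e) s (acost e + 1) (s\<lparr>reg := (reg s)(x := aval e s)\<rparr>)"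
| Store: "afits w i s \<Longrightarrow> afits w e s \<Longrightarrow>
    exec w (Store a i e) s (acost i + acost e + 1)
      (s\<lparr>arr := (arr s)(a := (arr s a)(aval i s := aval e s))\<rparr>)"
| Seq: "exec w p s t s' \<Longrightarrow> exec w q s' t' s'' \<Longrightarrow> exec w (Seq p q) s (t + t' + 1) s''"
| IfTrue: "bfits w b s \<Longrightarrow> bval b s \<Longrightarrow> exec w p s t s' \<Longrightarrow>
    exec w (If b p q) s (bcost b + t + 1) s'"
| IfFalse: "bfits w b s \<Longrightarrow> \<not> bval b s \<Longrightarrow> exec w q s t s' \<Longrightarrow>
    exec w (If b p q) s (bcost b + t + 1) s'"
| WhileFalse: "bfits w b s \<Longrightarrow> \<not> bval b s \<Longrightarrow> exec w (While b p) s (bcost b + 1) s"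
| WhileTrue: "bfits w b s \<Longrightarrow> bval b s \<Longrightarrow> exec w p s t s' \<Longrightarrow>
    exec w (While b p) s' t' s'' \<Longrightarrow> exec w (While b p) s (bcost b + t + t' + 1) s''"

inductive_cases SkipE: "exec w Skip s t s'"
inductive_cases AssignE: "exec w (Assign x e) s t s'"
inductive_cases StoreE: "exec w (Store a i e) s t s'"
inductive_cases SeqE: "exec w (Seq p q) s t s'"
inductive_cases IfE: "exec w (If b p q) s t s'"
inductive_cases WhileE: "exec w (While b p) s t s'"

lemma exec_deterministic:
  "exec w p s t s' \<Longrightarrow> exec w p s u s'' \<Longrightarrow> t = u \<and> s' = s''"
proof (induction arbitrary: u s'' rule: exec.induct)
  case (Skip s)
  then show ?case by (rule SkipE) simp
next
  case (Assign e s x)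
  from Assign.prems show ?case by (rule AssignE) simp
next
  case (Store i s e a)
  from Store.prems show ?case by (rule StoreE) simp
next
  case (Seq p s t s' q t' s1)
  from Seq.prems show ?case by (rule SeqE) (auto dest!: Seq.IH)
next
  case (IfTrue b s p t s' q)
  from IfTrue.prems show ?case by (rule IfE) (auto dest!: IfTrue.IH simp: IfTrue.hyps)
next
  case (IfFalse b s q t s' p)
  from IfFalse.prems show ?case by (rule IfE) (auto dest!: IfFalse.IH simp: IfFalse.hyps)
next
  case (WhileFalse b s p)
  from WhileFalse.prems show ?case by (rule WhileE) (auto simp: WhileFalse.hyps)
next
  case (WhileTrue b s p t s' t' s1)
  from WhileTrue.prems show ?case by (rule WhileE) (auto dest!: WhileTrue.IH simp: WhileTrue.hyps)
qed


section \<open>Input and output conventions\<close>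

text \<open>
  A graph with vertex set \<open>{0..<n}\<close> is given by a list containing each edge exactly
  once, with its end vertices in either order.
\<close>

definition edge_list :: "'v set set \<Rightarrow> ('v \<times> 'v) list \<Rightarrow> bool" where
  "edge_list E es \<longleftrightarrow>
     distinct (map (\<lambda>(u, v). {u, v}) es) \<and> set (map (\<lambda>(u, v). {u, v}) es) = E"

definition input_store ::
  "nat \<Rightarrow> (nat \<times> nat) list \<Rightarrow> nat \<Rightarrow> (nat \<Rightarrow> nat) \<Rightarrow> store" where
  "input_store n es k c =
     \<lparr>reg = (\<lambda>_. 0)(''n'' := n, ''m'' := length es, ''k'' := k),
      arr = (\<lambda>_ _. 0)
        (''fst'' := \<lambda>i. if i < length es then fst (es ! i) else 0,
         ''snd'' := \<lambda>i. if i < length es then snd (es ! i) else 0,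
         ''col'' := \<lambda>v. if v < n then c v else 0)\<rparr>"

text \<open>
  The output is the number \<open>r\<close> of colors, in register \<open>''r''\<close>, together with the color of
  the \<open>i\<close>-th listed edge at index \<open>i\<close> of array \<open>''s''\<close>.
\<close>

definition outputs_improper_twin ::
  "nat \<Rightarrow> nat set \<Rightarrow> nat set set \<Rightarrow> (nat \<times> nat) list \<Rightarrow> store \<Rightarrow> bool" where
  "outputs_improper_twin r V E es st \<longleftrightarrow>
     reg st ''r'' = r \<and>
     (\<exists>s. (\<forall>i<length es. s {fst (es ! i), snd (es ! i)} = arr st ''s'' i) \<and>
          improper_twin_edge_coloring r V E s)"

end

(* A spanning tree of a component lets one prescribe the sums c_s(v) at all non-root vertices, working from
   the leaves up; the sum at the root r is then forced. Since tree edges join different levels, summing the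
   c_s(v) with sign (-1)^level shows that the root also gets its prescribed value t(r) as soon as the alternating
   sum d of all targets t(v) vanishes modulo the number of colors, and an edge inside a level, labelled x,
   replaces this condition by 2 x = d or 2 x = - d. It remains to choose a proper coloring t of the component.
   If it has an edge inside a level, then t is the given coloring: 2 x = d is solvable for an odd number of
   colors, and for an even one provided that the colors have an even sum. An odd sum is repaired by swapping two
   colors of different parity, of which exactly one is used an odd number of times; such colors exist unless all
   colors occur an odd number of times, and then the sum is odd only if k = 2 (mod 4). If all edges join
   different levels and there are at least three colors, then t vanishes on the odd or on the even levels, and on
   the others, which can be taken to contain at least two vertices because the component is not K_2, it is
   nonzero with sum zero. With two colors, t is the given coloring: its even sum makes d vanish. *)

theory Submission
  imports Defs
begin

section \<open>Running programs within time and word bounds\<close>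

text \<open>Why 2 x = d or 2 x = - d: summing c_s over a component with signs counts every edge e =
  uv with weight (sign u + sign v) s(e), so an edge between levels cancels and an edge inside a
  level counts twice. All remaining non-tree edges get 0. Only the parities of levels are stored.
  Modulo 2 the signs disappear, so for an even number of colors halving d is a matter of the parity
  of the color sum, which one swap can mend. Without an edge inside a level d itself must vanish,
  which a swap does not provide; hence the new coloring there. If k = 2 (mod 4), the modulus k + 1
  is odd and every d can be halved; as the modulus is common to all components, one bad component
  changes it for the whole graph.

  Linear time shapes the program: work on a component must be proportional to its size rather than
  to k, and the machine neither multiplies nor divides nor tests parities. Hence tables of parities
  and halves, with at most k + 1 <= n + 1 entries, and sums reduced by one conditional subtraction
  after each addition.\<close>

definition set_reg :: "name \<Rightarrow> nat \<Rightarrow> store \<Rightarrow> store" where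
  "set_reg x v s = s\<lparr>reg := (reg s)(x := v)\<rparr>"

definition set_arr :: "name \<Rightarrow> nat \<Rightarrow> nat \<Rightarrow> store \<Rightarrow> store" where
  "set_arr a i v s = s\<lparr>arr := (arr s)(a := (arr s a)(i := v))\<rparr>"

lemma set_reg_simps [simp]:
  "reg (set_reg x v s) = (reg s)(x := v)"
  "arr (set_reg x v s) = arr s"
  by (simp_all add: set_reg_def)

lemma set_arr_simps [simp]:
  "reg (set_arr a i v s) = reg s"
  "arr (set_arr a i v s) = (arr s)(a := (arr s a)(i := v))"
  by (simp_all add: set_arr_def)

fun mod_regs :: "com \<Rightarrow> name set" where
  "mod_regs Skip = {}"
| "mod_regs (Assign x e) = {x}"
| "mod_regs (Store a i e) = {}"
| "mod_regs (Seq p q) = mod_regs p \<union> mod_regs q"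
| "mod_regs (If b p q) = mod_regs p \<union> mod_regs q"
| "mod_regs (While b p) = mod_regs p"

fun mod_arrs :: "com \<Rightarrow> name set" where
  "mod_arrs Skip = {}"
| "mod_arrs (Assign x e) = {}"
| "mod_arrs (Store a i e) = {a}"
| "mod_arrs (Seq p q) = mod_arrs p \<union> mod_arrs q"
| "mod_arrs (If b p q) = mod_arrs p \<union> mod_arrs q"
| "mod_arrs (While b p) = mod_arrs p"

definition frame :: "com \<Rightarrow> store \<Rightarrow> store \<Rightarrow> bool" where
  "frame p s s' \<longleftrightarrow> (\<forall>x. x \<notin> mod_regs p \<longrightarrow> reg s' x = reg s x) \<and>
     (\<forall>a. a \<notin> mod_arrs p \<longrightarrow> arr s' a = arr s a)"

lemma exec_frame: "exec w p s t s' \<Longrightarrow> frame p s s'"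
  by (induction rule: exec.induct) (auto simp: frame_def)

lemma frame_reg: "frame p s s' \<Longrightarrow> x \<notin> mod_regs p \<Longrightarrow> reg s' x = reg s x"
  by (simp add: frame_def)

lemma frame_arr: "frame p s s' \<Longrightarrow> a \<notin> mod_arrs p \<Longrightarrow> arr s' a = arr s a"
  by (simp add: frame_def)

text \<open>\<open>exec\<close> has no rule for an overflow, so the existence of a final state
  certifies at once termination and that no number exceeded \<open>w\<close>.\<close>

definition run :: "nat \<Rightarrow> com \<Rightarrow> store \<Rightarrow> nat \<Rightarrow> (store \<Rightarrow> bool) \<Rightarrow> bool" where
  "run w p s T Q \<longleftrightarrow> (\<exists>t s'. exec w p s t s' \<and> t \<le> T \<and> Q s')"

text \<open>The frame condition comes for free with every run. Specifications therefore mention only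
  what a program changes; the rest is recovered here and in \<open>run_Seq\<close>.\<close>

lemma run_mono: "run w p s T Q \<Longrightarrow> T \<le> T' \<Longrightarrow> (\<And>s'. frame p s s' \<Longrightarrow> Q s' \<Longrightarrow> Q' s') \<Longrightarrow> run w p s T' Q'"
  unfolding run_def by (meson exec_frame le_trans)

lemma run_Seq:
  assumes "run w p s Tp P" and "\<And>s'. frame p s s' \<Longrightarrow> P s' \<Longrightarrow> run w q s' Tq Q" and "Tp + Tq + 1 \<le> T"
  shows "run w (Seq p q) s T Q"
proof -
  obtain t s' where 1: "exec w p s t s'" "t \<le> Tp" "P s'" using assms(1) by (auto simp: run_def)
  obtain t' s'' where 2: "exec w q s' t' s''" "t' \<le> Tq" "Q s''"
    using assms(2)[OF exec_frame[OF 1(1)] 1(3)] by (auto simp: run_def)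
  have "exec w (Seq p q) s (t + t' + 1) s''" by (rule exec.Seq[OF 1(1) 2(1)])
  moreover have "t + t' + 1 \<le> T" using 1 2 assms(3) by simp
  ultimately show ?thesis using 2 by (auto simp: run_def)
qed

lemma run_If:
  assumes "bfits w b s" and "bval b s \<Longrightarrow> run w p s Tp Q" and "\<not> bval b s \<Longrightarrow> run w q s Tp Q"
    and "bcost b + Tp + 1 \<le> T"
  shows "run w (If b p q) s T Q"
proof (cases "bval b s")
  case True
  then obtain t s' where 1: "exec w p s t s'" "t \<le> Tp" "Q s'" using assms(2) by (auto simp: run_def)
  have "exec w (If b p q) s (bcost b + t + 1) s'" by (rule exec.IfTrue[OF assms(1) True 1(1)])
  moreover have "bcost b + t + 1 \<le> T" using 1 assms(4) by simp
  ultimately show ?thesis using 1 by (auto simp: run_def)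
next
  case False
  then obtain t s' where 1: "exec w q s t s'" "t \<le> Tp" "Q s'" using assms(3) by (auto simp: run_def)
  have "exec w (If b p q) s (bcost b + t + 1) s'" by (rule exec.IfFalse[OF assms(1) False 1(1)])
  moreover have "bcost b + t + 1 \<le> T" using 1 assms(4) by simp
  ultimately show ?thesis using 1 by (auto simp: run_def)
qed

section \<open>Symbolic execution of loop-free code\<close>

fun loop_free :: "com \<Rightarrow> bool" where
  "loop_free (Seq p q) \<longleftrightarrow> loop_free p \<and> loop_free q"
| "loop_free (If b p q) \<longleftrightarrow> loop_free p \<and> loop_free q"
| "loop_free (While b p) \<longleftrightarrow> False"
| "loop_free _ \<longleftrightarrow> True"

text \<open>Together with \<open>fits\<close> and \<open>cost\<close>, this turns a claim about
  loop-free code into one that the simplifier evaluates. The \<open>While\<close> clauses of the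
  three functions are placeholders, excluded by \<open>loop_free\<close>.\<close>

fun result :: "com \<Rightarrow> store \<Rightarrow> store" where
  "result Skip s = s"
| "result (Assign x e) s = set_reg x (aval e s) s"
| "result (Store a i e) s = set_arr a (aval i s) (aval e s) s"
| "result (Seq p q) s = result q (result p s)"
| "result (If b p q) s = (if bval b s then result p s else result q s)"
| "result (While b p) s = s"

fun fits :: "nat \<Rightarrow> com \<Rightarrow> store \<Rightarrow> bool" where
  "fits w Skip s \<longleftrightarrow> True"
| "fits w (Assign x e) s \<longleftrightarrow> afits w e s"
| "fits w (Store a i e) s \<longleftrightarrow> afits w i s \<and> afits w e s"
| "fits w (Seq p q) s \<longleftrightarrow> fits w p s \<and> fits w q (result p s)"
| "fits w (If b p q) s \<longleftrightarrow> bfits w b s \<and> (if bval b s then fits w p s else fits w q s)"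
| "fits w (While b p) s \<longleftrightarrow> False"

text \<open>Adding both branches of \<open>If\<close> instead of taking their maximum only enlarges
  the bound.\<close>

fun cost :: "com \<Rightarrow> nat" where
  "cost Skip = 1"
| "cost (Assign x e) = acost e + 1"
| "cost (Store a i e) = acost i + acost e + 1"
| "cost (Seq p q) = cost p + cost q + 1"
| "cost (If b p q) = bcost b + cost p + cost q + 1"
| "cost (While b p) = 0"

lemma run_loop_free_aux: "loop_free p \<Longrightarrow> fits w p s \<Longrightarrow> run w p s (cost p) (\<lambda>s'. s' = result p s)"
proof (induction p arbitrary: s)
  case Skip
  then show ?case using exec.Skip by (fastforce simp: run_def)
next
  case (Assign x e)
  then show ?case using exec.Assign[of w e s x] by (force simp: run_def set_reg_def)
next
  case (Store a i e)
  then show ?case using exec.Store[of w i s e a] by (force simp: run_def set_arr_def)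
next
  case (Seq p q)
  show ?case by (rule run_Seq[where P = "\<lambda>s'. s' = result p s"]) (use Seq in auto)
next
  case (If b p q)
  have "run w p s (cost p + cost q) (\<lambda>s'. s' = result p s)" if "bval b s"
    using If that by (intro run_mono[OF If.IH(1)]) auto
  moreover have "run w q s (cost p + cost q) (\<lambda>s'. s' = result q s)" if "\<not> bval b s"
    using If that by (intro run_mono[OF If.IH(2)]) auto
  ultimately show ?case
    by (intro run_If[where Tp = "cost p + cost q"]) (use If.prems in auto)
qed auto

lemma run_loop_free:
  "loop_free p \<Longrightarrow> cost p \<le> T \<Longrightarrow> fits w p s \<Longrightarrow> Q (result p s) \<Longrightarrow> run w p s T Q"
  using run_loop_free_aux by (rule run_mono) auto

text \<open>\<open>\<Phi>\<close> is a potential in units of time: a round may take any time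
  \<open>T\<close> that the drop of the potential pays for, together with the test. This gives
  amortized bounds, and the same drop proves termination.\<close>

lemma run_While:
  fixes \<Phi> :: "store \<Rightarrow> nat"
  assumes "I s"
    and "\<And>s'. frame p s s' \<Longrightarrow> I s' \<Longrightarrow> bfits w b s'"
    and "\<And>s'. frame p s s' \<Longrightarrow> I s' \<Longrightarrow> bval b s' \<Longrightarrow>
           \<exists>T. run w p s' T (\<lambda>s''. I s'' \<and> \<Phi> s'' + T + bcost b + 1 \<le> \<Phi> s')"
    and "\<And>s'. frame p s s' \<Longrightarrow> I s' \<Longrightarrow> \<not> bval b s' \<Longrightarrow> Q s'"
    and "\<Phi> s + bcost b + 1 \<le> T"
  shows "run w (While b p) s T Q"
proof -
  have "run w (While b p) s' (\<Phi> s' + bcost b + 1) Q" if "frame p s s'" "I s'" for s'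
    using that
  proof (induction "\<Phi> s'" arbitrary: s' rule: less_induct)
    case less
    have bf: "bfits w b s'" using assms(2) less by blast
    show ?case
    proof (cases "bval b s'")
      case True
      obtain T1 t s'' where 1: "exec w p s' t s''" "t \<le> T1" "I s''" "\<Phi> s'' + T1 + bcost b + 1 \<le> \<Phi> s'"
        using assms(3)[OF less(2,3) True] by (auto simp: run_def)
      have "frame p s s''" using less(2) exec_frame[OF 1(1)] by (simp add: frame_def)
      then have "run w (While b p) s'' (\<Phi> s'' + bcost b + 1) Q" using 1 by (intro less(1)) auto
      then obtain t' s3 where 2: "exec w (While b p) s'' t' s3" "t' \<le> \<Phi> s'' + bcost b + 1" "Q s3"
        by (auto simp: run_def)
      have "exec w (While b p) s' (bcost b + t + t' + 1) s3"
        by (rule exec.WhileTrue[OF bf True 1(1) 2(1)])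
      moreover have "bcost b + t + t' + 1 \<le> \<Phi> s' + bcost b + 1" using 1 2 by simp
      ultimately show ?thesis using 2 unfolding run_def by blast
    next
      case False
      have "exec w (While b p) s' (bcost b + 1) s'" by (rule exec.WhileFalse[OF bf False])
      then show ?thesis using assms(4)[OF less(2,3) False] unfolding run_def
        by (intro exI[of _ "bcost b + 1"] exI[of _ s']) simp
    qed
  qed
  moreover have "frame p s s" by (simp add: frame_def)
  ultimately show ?thesis using run_mono assms(1,5) by blast
qed

definition For :: "name \<Rightarrow> name \<Rightarrow> com \<Rightarrow> com" where
  "For x y p = Seq (Assign x (Const 0))
     (While (Less (Reg x) (Reg y)) (Seq p (Assign x (Add (Reg x) (Const 1)))))"

lemma mods_For [simp]:
  "mod_regs (For x y p) = insert x (mod_regs p)" "mod_arrs (For x y p) = mod_arrs p"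
  by (auto simp: For_def)

text \<open>\<open>I i\<close> describes a state whose counter is already \<open>i\<close>, hence
  the \<open>set_reg x (Suc i)\<close> after the body. The 10 added to \<open>T\<close> in each
  round covers the test, the increment and the composition.\<close>

lemma run_For:
  assumes nomod: "x \<notin> mod_regs p" "y \<notin> mod_regs p" "x \<noteq> y"
    and N: "reg s y = N" "N < w"
    and init: "I 0 (set_reg x 0 s)"
    and step: "\<And>i s'. \<lbrakk>frame (For x y p) s s'; i < N; reg s' x = i; I i s'\<rbrakk> \<Longrightarrow>
           run w p s' T (\<lambda>s''. I (Suc i) (set_reg x (Suc i) s''))"
    and post: "\<And>s'. \<lbrakk>frame (For x y p) s s'; I N s'\<rbrakk> \<Longrightarrow> Q s'"
    and T: "N * (T + 10) + 10 \<le> T'"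
  shows "run w (For x y p) s T' Q"
  unfolding For_def
proof (rule run_Seq[where Tp = 2 and P = "\<lambda>s'. s' = set_reg x 0 s" and Tq = "N * (T + 10) + 7"])
  show "run w (Assign x (Const 0)) s 2 (\<lambda>s'. s' = set_reg x 0 s)"
    by (rule run_loop_free) auto
  fix s0 assume "frame (Assign x (Const 0)) s s0" and s0: "s0 = set_reg x 0 s"
  let ?p = "Seq p (Assign x (Add (Reg x) (Const 1)))"
  show "run w (While (Less (Reg x) (Reg y)) ?p) s0 (N * (T + 10) + 7) Q"
  proof (rule run_While[where I = "\<lambda>s'. reg s' x \<le> N \<and> I (reg s' x) s'"
        and \<Phi> = "\<lambda>s'. (N - reg s' x) * (T + 10)"])
    show "reg s0 x \<le> N \<and> I (reg s0 x) s0" using s0 init by simp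
  next
    fix s' assume f: "frame ?p s0 s'" and I: "reg s' x \<le> N \<and> I (reg s' x) s'"
    have y: "reg s' y = N" using f s0 nomod N by (auto simp: frame_def)
    have fr: "frame (For x y p) s s'" using f s0 by (auto simp: frame_def)
    show "bfits w (Less (Reg x) (Reg y)) s'" using y I N by auto
    { assume b: "bval (Less (Reg x) (Reg y)) s'"
      then have lt: "reg s' x < N" using y by simp
      have "run w ?p s' (T + 5) (\<lambda>s''. (reg s'' x \<le> N \<and> I (reg s'' x) s'') \<and> reg s'' x = Suc (reg s' x))"
      proof (rule run_Seq[where Tq = 4 and Tp = T])
        show "run w p s' T (\<lambda>s''. I (Suc (reg s' x)) (set_reg x (Suc (reg s' x)) s''))"
          by (rule step) (use fr lt I in auto)
        fix s'' assume f2: "frame p s' s''" and I2: "I (Suc (reg s' x)) (set_reg x (Suc (reg s' x)) s'')"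
        have "reg s'' x = reg s' x" using f2 nomod by (auto simp: frame_def)
        then show "run w (Assign x (Add (Reg x) (Const 1))) s'' 4
          (\<lambda>s''. (reg s'' x \<le> N \<and> I (reg s'' x) s'') \<and> reg s'' x = Suc (reg s' x))"
          using I2 lt N by (intro run_loop_free) auto
      qed simp
      then have "run w ?p s' (T + 5) (\<lambda>s''. (reg s'' x \<le> N \<and> I (reg s'' x) s'') \<and>
         (N - reg s'' x) * (T + 10) + (T + 5) + bcost (Less (Reg x) (Reg y)) + 1 \<le> (N - reg s' x) * (T + 10))"
      proof (rule run_mono)
        fix s'' assume *: "(reg s'' x \<le> N \<and> I (reg s'' x) s'') \<and> reg s'' x = Suc (reg s' x)"
        have "N - reg s' x = Suc (N - reg s'' x)" using * lt by linarith
        then have "(N - reg s' x) * (T + 10) = (N - reg s'' x) * (T + 10) + (T + 10)" by simp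
        then show "(reg s'' x \<le> N \<and> I (reg s'' x) s'') \<and>
         (N - reg s'' x) * (T + 10) + (T + 5) + bcost (Less (Reg x) (Reg y)) + 1 \<le> (N - reg s' x) * (T + 10)"
          using conjunct1[OF *] by simp
      qed simp
      then show "\<exists>T'. run w ?p s' T' (\<lambda>s''. (reg s'' x \<le> N \<and> I (reg s'' x) s'') \<and>
         (N - reg s'' x) * (T + 10) + T' + bcost (Less (Reg x) (Reg y)) + 1 \<le> (N - reg s' x) * (T + 10))"
        by blast }
    { assume b: "\<not> bval (Less (Reg x) (Reg y)) s'"
      then have "reg s' x = N" using y I by simp
      then show "Q s'" using I fr post by auto }
  next
    show "(N - reg s0 x) * (T + 10) + bcost (Less (Reg x) (Reg y)) + 1 \<le> N * (T + 10) + 7"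
      using s0 by simp
  qed
qed (use T in simp)

text \<open>For loop-free bodies with exactly \<open>B - a\<close> rounds. The round number
  \<open>i\<close> is a logical index tied to the store only through \<open>J\<close>, so that the
  program may count upwards, downwards or in steps.\<close>

lemma run_iterate:
  assumes "loop_free p" "a \<le> B" "J a s"
    and "\<And>i s'. \<lbrakk>frame p s s'; a \<le> i; i < B; J i s'\<rbrakk> \<Longrightarrow>
           bfits w b s' \<and> bval b s' \<and> fits w p s' \<and> J (Suc i) (result p s')"
    and "\<And>s'. \<lbrakk>frame p s s'; J B s'\<rbrakk> \<Longrightarrow> bfits w b s' \<and> \<not> bval b s' \<and> Q s'"
    and "(B - a) * (cost p + bcost b + 1) + bcost b + 1 \<le> T"
  shows "run w (While b p) s T Q"
proof -
  have "run w (While b p) s' ((B - i) * (cost p + bcost b + 1) + bcost b + 1) Q"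
    if "frame p s s'" "a \<le> i" "i \<le> B" "J i s'" for i s'
    using that
  proof (induction "B - i" arbitrary: i s')
    case 0
    then have "i = B" by simp
    then have "bfits w b s'" "\<not> bval b s'" "Q s'" using assms(5) 0 by auto
    then have "exec w (While b p) s' (bcost b + 1) s'" by (intro exec.WhileFalse)
    then show ?case using \<open>Q s'\<close> unfolding run_def
      by (intro exI[of _ "bcost b + 1"] exI[of _ s'] conjI) simp_all
  next
    case (Suc d)
    then have i: "i < B" by simp
    note st = assms(4)[OF Suc.prems(1,2) i Suc.prems(4)]
    obtain t where t: "exec w p s' t (result p s')" "t \<le> cost p"
      using run_loop_free_aux[OF assms(1), of w s'] st by (auto simp: run_def)
    have f: "frame p s (result p s')"
      using exec_frame[OF t(1)] Suc.prems(1) by (simp add: frame_def)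
    have "run w (While b p) (result p s') ((B - Suc i) * (cost p + bcost b + 1) + bcost b + 1) Q"
      using Suc.hyps(1)[of "Suc i" "result p s'"] Suc.hyps(2) Suc.prems f st i by simp
    then obtain t' s'' where t': "exec w (While b p) (result p s') t' s''" "Q s''"
        "t' \<le> (B - Suc i) * (cost p + bcost b + 1) + bcost b + 1"
      by (auto simp: run_def)
    have "exec w (While b p) s' (bcost b + t + t' + 1) s''"
      using exec.WhileTrue[OF _ _ t(1) t'(1)] st by blast
    moreover have "B - i = Suc (B - Suc i)" using i by simp
    then have "bcost b + t + t' + 1 \<le> (B - i) * (cost p + bcost b + 1) + bcost b + 1"
      using t(2) t'(3) by simp
    ultimately show ?case using t'(2) unfolding run_def by blast
  qed
  from this[of s a] have "run w (While b p) s ((B - a) * (cost p + bcost b + 1) + bcost b + 1) Q"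
    using assms(2,3) by (simp add: frame_def)
  then show ?thesis by (rule run_mono) (use assms(6) in auto)
qed

section \<open>Adjacency lists and breadth-first search\<close>

notation Seq (infixr ";;" 60)
notation Assign (infix "::=" 61)
text \<open>
  Edge \<open>i\<close> consists of the half-edges \<open>2 i\<close> and \<open>2 i + 1\<close>. The half-edges leaving a vertex form a linked list
  in order of decreasing numbers; array \<open>hd\<close> holds its start and \<open>nx\<close> its links, where half-edge \<open>h\<close> is stored
  as \<open>h + 1\<close> and \<open>0\<close> ends the list.
\<close>

definition adj_body :: com where
  "adj_body =
     ''u'' ::= Arr ''fst'' (Reg ''i'') ;;
     ''v'' ::= Arr ''snd'' (Reg ''i'') ;;
     ''h'' ::= Add (Reg ''i'') (Reg ''i'') ;;
     Store ''nx'' (Reg ''h'') (Arr ''hd'' (Reg ''u'')) ;;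
     Store ''ds'' (Reg ''h'') (Reg ''v'') ;;
     Store ''ei'' (Reg ''h'') (Reg ''i'') ;;
     ''h'' ::= Add (Reg ''h'') (Const 1) ;;
     Store ''hd'' (Reg ''u'') (Reg ''h'') ;;
     Store ''nx'' (Reg ''h'') (Arr ''hd'' (Reg ''v'')) ;;
     Store ''ds'' (Reg ''h'') (Reg ''u'') ;;
     Store ''ei'' (Reg ''h'') (Reg ''i'') ;;
     ''h'' ::= Add (Reg ''h'') (Const 1) ;;
     Store ''hd'' (Reg ''v'') (Reg ''h'')"

definition adj_prog :: com where
  "adj_prog = For ''i'' ''m'' adj_body"

text \<open>The machine cannot test parities, so they are tabulated: each entry complements the
  previous one, starting from the 0 that the initial store holds at index 0.\<close>

definition odd_body :: com where
  "odd_body = Store ''od'' (Add (Reg ''i'') (Const 1)) (Sub (Const 1) (Arr ''od'' (Reg ''i'')))"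

definition odd_prog :: com where
  "odd_prog = For ''i'' ''k'' odd_body"

text \<open>\<open>U\<close> and \<open>W\<close> are the contents of the arrays \<open>fst\<close>
  and \<open>snd\<close>; their bounds hold at every index because the input is padded with 0. The
  factor 20 is generous: with \<open>n2\<close> it yields \<open>n + 2 * m + 10\<close> and
  \<open>4 * n + 2 * m + 10\<close>, which cover all numbers that occur.\<close>

locale input =
  fixes n m w :: nat and U W :: "nat \<Rightarrow> nat"
  assumes n2: "2 \<le> n" and w: "20 * (n + m) \<le> w"
    and U: "\<And>i. U i < n" and W: "\<And>i. W i < n"
    and UW: "\<And>i. i < m \<Longrightarrow> U i \<noteq> W i"
begin

lemma w': "n + 2 * m + 10 \<le> w"
  using n2 w by simp

definition hsrc :: "nat \<Rightarrow> nat" where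
  "hsrc h = (if even h then U (h div 2) else W (h div 2))"

definition hdst :: "nat \<Rightarrow> nat" where
  "hdst h = (if even h then W (h div 2) else U (h div 2))"

text \<open>\<open>p\<close> is the link to the largest half-edge below \<open>b\<close> that leaves
  \<open>v\<close>, with the shift by one and 0 for none. Since the lists run by decreasing numbers,
  this describes them without an inductive predicate on linked lists.\<close>

definition last_out :: "nat \<Rightarrow> nat \<Rightarrow> nat \<Rightarrow> bool" where
  "last_out v p b \<longleftrightarrow> p \<le> b \<and> (0 < p \<longrightarrow> hsrc (p - 1) = v) \<and> (\<forall>h. p \<le> h \<longrightarrow> h < b \<longrightarrow> hsrc h \<noteq> v)"

definition adj :: "nat \<Rightarrow> (nat \<Rightarrow> nat) \<Rightarrow> (nat \<Rightarrow> nat) \<Rightarrow> bool" where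
  "adj b H nx \<longleftrightarrow> (\<forall>v. last_out v (H v) b) \<and> (\<forall>h<b. last_out (hsrc h) (nx h) h)"

lemma adj_push:
  assumes "adj b H nx" "v = hsrc b"
  shows "adj (Suc b) (H(v := Suc b)) (nx(b := H v))"
  using assms by (auto simp: adj_def last_out_def less_Suc_eq intro: le_SucI)

lemma adj_prog:
  assumes s: "reg s ''m'' = m" "arr s ''fst'' = U" "arr s ''snd'' = W" "arr s ''hd'' = (\<lambda>_. 0)"
  shows "run w adj_prog s (m * (cost adj_body + 10) + 10)
    (\<lambda>s'. adj (2 * m) (arr s' ''hd'') (arr s' ''nx'') \<and>
       (\<forall>h<2 * m. arr s' ''ds'' h = hdst h \<and> arr s' ''ei'' h = h div 2))"
proof -
  let ?I = "\<lambda>i s'. adj (2 * i) (arr s' ''hd'') (arr s' ''nx'') \<and>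
       (\<forall>h<2 * i. arr s' ''ds'' h = hdst h \<and> arr s' ''ei'' h = h div 2)"
  show ?thesis unfolding adj_prog_def
  proof (rule run_For[where I = ?I and N = m])
    fix i s'
    assume fr: "frame (For ''i'' ''m'' adj_body) s s'" and i: "i < m" and ri: "reg s' ''i'' = i"
      and I: "?I i s'"
    have c: "arr s' ''fst'' = U" "arr s' ''snd'' = W"
      using fr s by (simp_all add: frame_def adj_body_def)
    have hd: "arr s' ''hd'' v \<le> 2 * i" for v using I by (auto simp: adj_def last_out_def)
    have U: "U i < n" "W i < n" "U i \<noteq> W i" using U W UW i by auto
    \<comment> \<open>One push for each half-edge; as \<open>U i\<close> and \<open>W i\<close>
      differ, the second push still reads the old head of the list of \<open>W i\<close>.\<close>
    have 1: "adj (Suc (Suc (2 * i))) ((arr s' ''hd'')(U i := Suc (2 * i), W i := Suc (Suc (2 * i))))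
       ((arr s' ''nx'')(2 * i := arr s' ''hd'' (U i), Suc (2 * i) := arr s' ''hd'' (W i)))"
      using adj_push[OF adj_push[OF conjunct1[OF I], of "U i"], of "W i"] U by (simp add: hsrc_def)
    show "run w adj_body s' (cost adj_body) (\<lambda>s''.
           ?I (Suc i) (set_reg ''i'' (Suc i) s''))"
    proof (rule run_loop_free)
      show "fits w adj_body s'"
        using w U i hd[of "U i"] hd[of "W i"] by (simp add: adj_body_def ri c)
      show "?I (Suc i) (set_reg ''i'' (Suc i) (result adj_body s'))"
        using I 1 U by (auto simp: adj_body_def ri c less_Suc_eq hdst_def simp flip: mult_2)
    qed (simp_all add: adj_body_def)
  qed (use s w n2 in \<open>auto simp: adj_def last_out_def adj_body_def\<close>)
qed

lemma odd_prog:
  assumes s: "reg s ''k'' = k" "k \<le> n" "arr s ''od'' = (\<lambda>_. 0)"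
  shows "run w odd_prog s (k * (cost odd_body + 10) + 10) (\<lambda>s'. \<forall>i\<le>k. arr s' ''od'' i = i mod 2)"
  unfolding odd_prog_def
proof (rule run_For[where I = "\<lambda>i s'. \<forall>j\<le>i. arr s' ''od'' j = j mod 2" and N = k])
  fix i and s' :: store
  assume i: "i < k" and ri: "reg s' ''i'' = i" and I: "\<forall>j\<le>i. arr s' ''od'' j = j mod 2"
  show "run w odd_body s' (cost odd_body) (\<lambda>s''. \<forall>j\<le>Suc i. arr (set_reg ''i'' (Suc i) s'') ''od'' j = j mod 2)"
    by (rule run_loop_free) (use I i w s n2 in \<open>auto simp: odd_body_def ri le_Suc_eq mod_Suc\<close>)
qed (use s w n2 in \<open>auto simp: odd_body_def\<close>)

end

text \<open>
  One loop replaces the nested loops of a breadth-first search: a step follows a link \<open>p\<close> of the list of the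
  current vertex \<open>u\<close>, takes \<open>u\<close> from the queue, or, if the queue is empty, tries the next root \<open>rt\<close>. The queue
  \<open>q\<close> is never overwritten, so that it finally lists the vertices component by component and parents before
  children. For each vertex, \<open>dp\<close> is the parity of its level, \<open>pr\<close> its parent and \<open>pe\<close> the edge to its parent.
\<close>

definition bfs_body :: com where
  "bfs_body =
     If (Less (Const 0) (Reg ''p''))
       (''h'' ::= Sub (Reg ''p'') (Const 1) ;;
        ''p'' ::= Arr ''nx'' (Reg ''h'') ;;
        ''v'' ::= Arr ''ds'' (Reg ''h'') ;;
        If (Eq (Arr ''di'' (Reg ''v'')) (Const 0))
          (Store ''di'' (Reg ''v'') (Const 1) ;;
           Store ''root'' (Reg ''v'') (Reg ''cr'') ;;
           Store ''dp'' (Reg ''v'') (Sub (Const 1) (Arr ''dp'' (Reg ''u''))) ;;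
           Store ''pr'' (Reg ''v'') (Reg ''u'') ;;
           Store ''pe'' (Reg ''v'') (Arr ''ei'' (Reg ''h'')) ;;
           Store ''q'' (Reg ''qt'') (Reg ''v'') ;;
           ''qt'' ::= Add (Reg ''qt'') (Const 1))
          Skip)
       (If (Less (Reg ''qh'') (Reg ''qt''))
          (''u'' ::= Arr ''q'' (Reg ''qh'') ;;
           ''qh'' ::= Add (Reg ''qh'') (Const 1) ;;
           ''p'' ::= Arr ''hd'' (Reg ''u''))
          (If (Eq (Arr ''di'' (Reg ''rt'')) (Const 0))
             (''cr'' ::= Reg ''rt'' ;;
              Store ''di'' (Reg ''rt'') (Const 1) ;;
              Store ''root'' (Reg ''rt'') (Reg ''rt'') ;;
              Store ''dp'' (Reg ''rt'') (Const 0) ;;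
              Store ''q'' (Reg ''qt'') (Reg ''rt'') ;;
              ''qt'' ::= Add (Reg ''qt'') (Const 1))
             Skip ;;
           ''rt'' ::= Add (Reg ''rt'') (Const 1)))"

definition bfs_cond :: bexp where
  "bfs_cond = Neg (Conj (Eq (Reg ''p'') (Const 0))
     (Conj (Neg (Less (Reg ''qh'') (Reg ''qt''))) (Neg (Less (Reg ''rt'') (Reg ''n'')))))"

definition bfs_prog :: com where
  "bfs_prog = While bfs_cond bfs_body"

section \<open>Invariants of the breadth-first search\<close>

context input
begin

text \<open>Parents are required to have smaller queue positions. This makes the forest
  well-founded, and induction on positions replaces reasoning about paths to the root.\<close>

definition tree_at :: "(nat \<Rightarrow> nat) \<Rightarrow> (nat \<Rightarrow> nat) \<Rightarrow> (nat \<Rightarrow> nat) \<Rightarrow> (nat \<Rightarrow> nat) \<Rightarrow> (nat \<Rightarrow> nat) \<Rightarrow> nat \<Rightarrow> bool" where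
  "tree_at q root dp pr pe i \<longleftrightarrow>
     (root (q i) = q i \<and> dp (q i) = 0) \<or>
     ((\<exists>j<i. pr (q i) = q j) \<and> root (q i) = root (pr (q i)) \<and> dp (q i) = 1 - dp (pr (q i)) \<and>
      pe (q i) < m \<and> {U (pe (q i)), W (pe (q i))} = {q i, pr (q i)})"

text \<open>Roots are tried in increasing order; the resulting monotonicity of \<open>root\<close>
  along the queue is what makes every component an interval of positions. Distances do not enter: an
  edge counts as inside a level when \<open>dp\<close> agrees at its ends.\<close>

definition forest :: "(nat \<Rightarrow> nat) \<Rightarrow> (nat \<Rightarrow> nat) \<Rightarrow> (nat \<Rightarrow> nat) \<Rightarrow> (nat \<Rightarrow> nat) \<Rightarrow> (nat \<Rightarrow> nat) \<Rightarrow> bool" where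
  "forest q root dp pr pe \<longleftrightarrow>
     (\<forall>i. q i < n) \<and> bij_betw q {..<n} {..<n} \<and> (\<forall>i<n. tree_at q root dp pr pe i) \<and> (\<forall>v. dp v \<le> 1) \<and>
     (\<forall>i j. i \<le> j \<longrightarrow> j < n \<longrightarrow> root (q i) \<le> root (q j)) \<and>
     (\<forall>e<m. root (U e) = root (W e))"

text \<open>The part of the search invariant that concerns vertices only. The bound
  \<open>cr\<close> on all roots so far, with \<open>cr \<le> rt\<close>, keeps the roots sorted
  when \<open>rt\<close> becomes the next root.\<close>

definition discovered where
  "discovered qt rt cr q di root dp pr pe \<longleftrightarrow>
     inj_on q {..<qt} \<and> (\<forall>i. q i < n) \<and> (\<forall>v. di v \<noteq> 0 \<longleftrightarrow> v \<in> q ` {..<qt}) \<and>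
     (\<forall>v. di v \<le> (1::nat)) \<and> (\<forall>v. dp v \<le> 1) \<and> (\<forall>i<qt. tree_at q root dp pr pe i) \<and>
     (\<forall>i j. i \<le> j \<longrightarrow> j < qt \<longrightarrow> root (q i) \<le> root (q j)) \<and> (\<forall>i<qt. root (q i) \<le> cr) \<and>
     cr \<le> rt \<and> rt \<le> n \<and> (\<forall>v<rt. di v \<noteq> 0)"

lemma discovered_neq:
  assumes "discovered qt rt cr q di root dp pr pe" "di v = 0" "i < qt"
  shows "q i \<noteq> v"
proof -
  have "q i \<in> q ` {..<qt}" using assms(3) by blast
  then have "di (q i) \<noteq> 0" using assms(1) unfolding discovered_def by blast
  then show ?thesis using assms(2) by auto
qed

text \<open>Covers both kinds of discovery: a child, with \<open>c = cr\<close> and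
  \<open>rt' = rt\<close>, and a new root, with \<open>c = v\<close> and
  \<open>rt' = Suc rt\<close>.\<close>

lemma discovered_push:
  assumes D: "discovered qt rt cr q di root dp pr pe" and v: "v < n" "di v = 0"
    and c: "cr \<le> c" "c \<le> rt'" "rt \<le> rt'" "rt' \<le> n" "\<And>v'. v' < rt' \<Longrightarrow> rt \<le> v' \<Longrightarrow> v' = v"
    and t: "c = v \<and> d = 0 \<or>
      ((\<exists>j<qt. x = q j) \<and> root x = c \<and> d = 1 - dp x \<and> y < m \<and> {U y, W y} = {v, x})"
  shows "discovered (Suc qt) rt' c (q(qt := v)) (di(v := 1)) (root(v := c)) (dp(v := d)) (pr(v := x)) (pe(v := y))"
proof -
  have nv: "q i \<noteq> v" if "i < qt" for i using discovered_neq[OF D v(2) that] .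
  have rl: "root (q i) \<le> c" if "i < qt" for i using D c(1) that by (auto simp: discovered_def intro: le_trans)
  have "tree_at (q(qt := v)) (root(v := c)) (dp(v := d)) (pr(v := x)) (pe(v := y)) i" if "i < Suc qt" for i
  proof (cases "i = qt")
    case True
    then show ?thesis using t nv by (fastforce simp: tree_at_def)
  next
    case False
    then have i: "i < qt" using that by simp
    then have ti: "tree_at q root dp pr pe i" using D by (auto simp: discovered_def)
    have j: "\<exists>j<i. pr (q i) = (q(qt := v)) j" if "\<exists>j<i. pr (q i) = q j" using that i by fastforce
    have p: "pr (q i) \<noteq> v" if "\<exists>j<i. pr (q i) = q j" using that i nv by (metis less_trans)
    show ?thesis
    proof (cases "root (q i) = q i \<and> dp (q i) = 0")
      case True
      then show ?thesis using i nv[OF i] by (simp add: tree_at_def)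
    next
      case False
      then have *: "\<exists>j<i. pr (q i) = q j" "root (q i) = root (pr (q i)) \<and> dp (q i) = 1 - dp (pr (q i)) \<and>
        pe (q i) < m \<and> {U (pe (q i)), W (pe (q i))} = {q i, pr (q i)}"
        using ti by (auto simp: tree_at_def)
      show ?thesis unfolding tree_at_def using *(2) p[OF *(1)] j[OF *(1)] i nv[OF i]
        by (intro disjI2) simp
    qed
  qed
  moreover have "inj_on (q(qt := v)) {..<Suc qt}"
  proof -
    have "inj_on q {..<qt}" using D by (simp add: discovered_def)
    then show ?thesis by (intro inj_onI) (metis fun_upd_apply lessThan_iff less_Suc_eq inj_onD nv)
  qed
  moreover have "\<forall>i j. i \<le> j \<longrightarrow> j < Suc qt \<longrightarrow> (root(v := c)) ((q(qt := v)) i) \<le> (root(v := c)) ((q(qt := v)) j)"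
    using rl D nv by (auto simp: discovered_def less_Suc_eq)
  moreover have "\<forall>u. (di(v := 1)) u \<noteq> 0 \<longleftrightarrow> u \<in> (q(qt := v)) ` {..<Suc qt}"
  proof -
    have "(q(qt := v)) ` {..<Suc qt} = insert v (q ` {..<qt})" by (auto simp: lessThan_Suc)
    then show ?thesis using D by (auto simp: discovered_def)
  qed
  moreover have "\<forall>i<Suc qt. (root(v := c)) ((q(qt := v)) i) \<le> c"
    using rl D nv by (auto simp: discovered_def less_Suc_eq)
  moreover have "\<forall>v'. (di(v := 1)) v' \<le> 1" "\<forall>v'. (dp(v := d)) v' \<le> 1"
    using D t by (auto simp: discovered_def)
  moreover have "\<forall>v'<rt'. (di(v := 1)) v' \<noteq> 0"
    using D c(5) by (auto simp: discovered_def) (meson not_less)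
  ultimately show ?thesis using D v c by (auto simp: discovered_def less_Suc_eq)
qed

text \<open>
  The half-edges already examined; a list is traversed downwards, hence \<open>p \<le> h\<close> for the current vertex.
\<close>

definition scanned :: "(nat \<Rightarrow> nat) \<Rightarrow> nat \<Rightarrow> nat \<Rightarrow> nat set" where
  "scanned q qh p = {h. h < 2 * m \<and> (\<exists>i<qh. hsrc h = q i \<and> (Suc i = qh \<longrightarrow> p \<le> h))}"

text \<open>All pending vertices have the current root: those still in the queue and, as long as
  \<open>0 < p\<close>, also the vertex at \<open>qh - 1\<close> whose list is being traversed. With
  \<open>p = 0\<close> and an empty queue this is vacuous, and \<open>cr\<close> may change.\<close>

definition scanning where
  "scanning qh qt p u cr q di root \<longleftrightarrow>
     qh \<le> qt \<and> (\<forall>j<qt. (if 0 < p then qh \<le> Suc j else qh \<le> j) \<longrightarrow> root (q j) = (cr::nat)) \<and>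
     (0 < p \<longrightarrow> 0 < qh \<and> u = q (qh - 1) \<and> p \<le> 2 * m \<and> hsrc (p - 1) = u) \<and>
     (\<forall>h\<in>scanned q qh p. di (hdst h) \<noteq> (0::nat) \<and> root (hdst h) = root (hsrc h))"

lemma hdst_less: "hdst h < n"
  using U W by (simp add: hdst_def)

lemma reverse_half_edge:
  assumes "h < 2 * m"
  obtains h' where "h' < 2 * m" "hsrc h' = hdst h" "hdst h' = hsrc h"
proof (cases "even h")
  case True
  then have "Suc h < 2 * m" using assms by (auto elim!: evenE)
  then show ?thesis using True that[of "Suc h"] by (simp add: hsrc_def hdst_def)
next
  case False
  then have "Suc (h - 1) = h" "even (h - 1)" by (auto elim!: oddE)
  then have "(h - 1) div 2 = h div 2" using even_Suc_div_two by metis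
  then show ?thesis using False that[of "h - 1"] assms \<open>even (h - 1)\<close> by (simp add: hsrc_def hdst_def)
qed

text \<open>By \<open>last_out\<close>, no half-edge in the gap from \<open>p'\<close> up to but
  excluding \<open>p - 1\<close> leaves \<open>u\<close>, so following the link adds
  \<open>p - 1\<close> alone. Injectivity of the queue excludes that \<open>u\<close> was already
  processed at an earlier position; hence \<open>p - 1\<close> is new, which makes the potential
  drop.\<close>

lemma scanned_scan:
  assumes "0 < p" "p \<le> 2 * m" "hsrc (p - 1) = u" "u = q (qh - 1)" "0 < qh" "last_out u p' (p - 1)"
    "inj_on q {..<qh}"
  shows "scanned q qh p' = insert (p - 1) (scanned q qh p)" "p - 1 \<notin> scanned q qh p"
proof -
  have "p - 1 < 2 * m" using assms by simp
  have i: "Suc i = qh" if "i < qh" "hsrc h = q i" "hsrc h = u" for i h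
    using that assms inj_onD[OF assms(7), of i "qh - 1"] by auto
  show "p - 1 \<notin> scanned q qh p" using assms i by (fastforce simp: scanned_def)
  show "scanned q qh p' = insert (p - 1) (scanned q qh p)"
  proof (intro set_eqI iffI)
    fix h assume h: "h \<in> scanned q qh p'"
    then obtain k where k: "k < qh" "hsrc h = q k" "Suc k = qh \<longrightarrow> p' \<le> h" "h < 2 * m"
      by (auto simp: scanned_def)
    show "h \<in> insert (p - 1) (scanned q qh p)"
    proof (cases "Suc k = qh")
      case True
      then have "k = qh - 1" by simp
      then have "hsrc h = u" using k assms by simp
      then have "\<not> h < p - 1" using True k assms(6) by (auto simp: last_out_def)
      then show ?thesis using k True by (auto simp: scanned_def)
    qed (use k in \<open>auto simp: scanned_def\<close>)
  next
    fix h assume "h \<in> insert (p - 1) (scanned q qh p)"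
    moreover have "p' \<le> p - 1" using assms by (auto simp: last_out_def)
    moreover have "p - 1 \<in> scanned q qh p'"
      using assms \<open>p' \<le> p - 1\<close> by (auto simp: scanned_def intro!: exI[of _ "qh - 1"])
    ultimately show "h \<in> scanned q qh p'" using i by (fastforce simp: scanned_def)
  qed
qed

text \<open>The first link \<open>p\<close> lies above every half-edge of the new vertex, so taking
  a vertex from the queue scans nothing yet.\<close>

lemma scanned_dequeue:
  assumes "last_out (q qh) p (2 * m)"
  shows "scanned q (Suc qh) p = scanned q qh 0"
  using assms by (auto simp: scanned_def last_out_def less_Suc_eq not_le)

lemma scanned_cong: "(\<And>i. i < qh \<Longrightarrow> q i = q' i) \<Longrightarrow> scanned q qh p = scanned q' qh p"
  by (auto simp: scanned_def)

text \<open>The vertex reached is either pending, and then its root is \<open>cr\<close>, or it has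
  been fully processed; in that case the reverse half-edge was scanned earlier and the invariant
  already equates the two roots.\<close>

lemma scan_old:
  assumes D: "discovered qt rt cr q di root dp pr pe" and S: "scanning qh qt p u cr q di root"
    and p: "0 < p" "last_out u p' (p - 1)" and v: "di (hdst (p - 1)) \<noteq> 0"
  shows "scanning qh qt p' u cr q di root"
proof -
  have inj: "inj_on q {..<qh}" using D S by (auto simp: discovered_def scanning_def intro: inj_on_subset)
  have p1: "p - 1 < 2 * m" "hsrc (p - 1) = u" "u = q (qh - 1)" "0 < qh" "p \<le> 2 * m"
    using S p by (auto simp: scanning_def)
  have ru: "root u = cr" using S p p1 by (auto simp: scanning_def)
  have "root (hdst (p - 1)) = cr"
  proof -
    obtain i where i: "i < qt" "hdst (p - 1) = q i" using v D by (auto simp: discovered_def)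
    show ?thesis
    proof (cases "qh \<le> Suc i")
      case True
      then show ?thesis using i S p by (auto simp: scanning_def)
    next
      case False
      obtain h' where h': "h' < 2 * m" "hsrc h' = hdst (p - 1)" "hdst h' = hsrc (p - 1)"
        using reverse_half_edge[OF p1(1)] .
      then have "h' \<in> scanned q qh p" using i False by (auto simp: scanned_def intro!: exI[of _ i])
      then show ?thesis using S h' p1 ru by (auto simp: scanning_def)
    qed
  qed
  moreover have "scanned q qh p' = insert (p - 1) (scanned q qh p)"
    using scanned_scan[OF p(1) p1(5) p1(2) p1(3) p1(4) p(2) inj] by simp
  moreover have "0 < p' \<longrightarrow> p' \<le> 2 * m \<and> hsrc (p' - 1) = u" using p(2) p1 by (auto simp: last_out_def)
  ultimately show ?thesis using S p v p1 ru by (auto simp: scanning_def)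
qed

text \<open>The hypothesis on \<open>c\<close> says that a different root may start only when
  nothing is pending.\<close>

lemma scanning_push:
  assumes D: "discovered qt rt cr q di root dp pr pe" and S: "scanning qh qt p u cr q di root"
    and v: "v < n" "di v = 0" and c: "c = cr \<or> p = 0 \<and> qh = qt"
  shows "scanning qh (Suc qt) p u c (q(qt := v)) (di(v := 1)) (root(v := c))"
proof -
  have nv: "q i \<noteq> v" if "i < qt" for i using discovered_neq[OF D v(2) that] .
  have "qh \<le> qt" using S by (simp add: scanning_def)
  have sc: "scanned (q(qt := v)) qh p = scanned q qh p"
    by (rule scanned_cong) (use \<open>qh \<le> qt\<close> in auto)
  have "hsrc h \<noteq> v \<and> hdst h \<noteq> v" if h: "h \<in> scanned q qh p" for h
  proof -
    have "di (hdst h) \<noteq> 0" using S h by (auto simp: scanning_def)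
    moreover obtain i where "i < qh" "hsrc h = q i" using h by (auto simp: scanned_def)
    ultimately show ?thesis using v nv[of i] \<open>qh \<le> qt\<close> by auto
  qed
  moreover have "0 < p \<longrightarrow> (q(qt := v)) (qh - 1) = q (qh - 1)" using S by (auto simp: scanning_def)
  ultimately show ?thesis using S c nv sc by (auto simp: scanning_def less_Suc_eq)
qed

lemma scanning_dequeue:
  assumes S: "scanning qh qt 0 u cr q di root" and "qh < qt" and p: "last_out (q qh) p (2 * m)"
  shows "scanning (Suc qh) qt p (q qh) cr q di root"
  using S \<open>qh < qt\<close> scanned_dequeue[of q qh p, OF p] p by (auto simp: scanning_def last_out_def)

text \<open>With \<open>rt = n\<close> every vertex is in the queue; with an empty queue and
  \<open>p = 0\<close> every half-edge has been scanned, and the invariant on half-edges becomes the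
  condition of \<open>forest\<close> on edges.\<close>

lemma scanning_finished:
  assumes D: "discovered qt n cr q di root dp pr pe" and S: "scanning qh qt 0 u cr q di root" and "\<not> qh < qt"
  shows "forest q root dp pr pe"
proof -
  have im: "q ` {..<qt} = {..<n}" using D by (auto simp: discovered_def)
  moreover have inj: "inj_on q {..<qt}" using D by (auto simp: discovered_def)
  ultimately have qt: "qt = n" using card_image[OF inj] by simp
  have "root (U e) = root (W e)" if "e < m" for e
  proof -
    have "2 * e < 2 * m" "hsrc (2 * e) = U e" "hdst (2 * e) = W e" using that by (auto simp: hsrc_def hdst_def)
    moreover have "U e \<in> q ` {..<qt}" using im U by auto
    ultimately have "2 * e \<in> scanned q qh 0" using S \<open>\<not> qh < qt\<close> by (auto simp: scanned_def scanning_def)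
    then have "root (hdst (2 * e)) = root (hsrc (2 * e))" using S by (auto simp: scanning_def)
    then show ?thesis using \<open>hsrc (2 * e) = U e\<close> \<open>hdst (2 * e) = W e\<close> by simp
  qed
  then show ?thesis using D im inj qt by (auto simp: forest_def discovered_def bij_betw_def)
qed

text \<open>Each step of the single loop tries a root, takes a vertex from the queue or scans a
  half-edge, and so lowers one of the three terms. The initial value is
  \<open>2 * n + 2 * m\<close>.\<close>

definition bfs_pot where
  "bfs_pot rt qh q p = (n - rt) + (n - qh) + card ({..<2 * m} - scanned q qh p)"

lemma bfs_pot_scan:
  assumes D: "discovered qt rt cr q di root dp pr pe" and S: "scanning qh qt p u cr q di root"
    and p: "0 < p" "last_out u p' (p - 1)"
  shows "bfs_pot rt qh q p' < bfs_pot rt qh q p"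
proof -
  have inj: "inj_on q {..<qh}" using D S by (auto simp: discovered_def scanning_def intro: inj_on_subset)
  have p1: "p - 1 < 2 * m" "hsrc (p - 1) = u" "u = q (qh - 1)" "0 < qh" "p \<le> 2 * m"
    using S p by (auto simp: scanning_def)
  have "{..<2 * m} - scanned q qh p' \<subset> {..<2 * m} - scanned q qh p"
    using scanned_scan[OF p(1) p1(5) p1(2) p1(3) p1(4) p(2) inj] p1 by blast
  then have "card ({..<2 * m} - scanned q qh p') < card ({..<2 * m} - scanned q qh p)"
    by (intro psubset_card_mono) auto
  then show ?thesis by (simp add: bfs_pot_def)
qed

lemma discovered_qt_le: "discovered qt rt cr q di root dp pr pe \<Longrightarrow> qt \<le> n"
  using card_inj_on_le[of q "{..<qt}" "{..<n}"] by (auto simp: discovered_def)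

definition bfs_inv :: "store \<Rightarrow> bool" where
  "bfs_inv s \<longleftrightarrow>
          discovered (reg s ''qt'') (reg s ''rt'') (reg s ''cr'') (arr s ''q'') (arr s ''di'') (arr s ''root'')
             (arr s ''dp'') (arr s ''pr'') (arr s ''pe'') \<and>
          scanning (reg s ''qh'') (reg s ''qt'') (reg s ''p'') (reg s ''u'') (reg s ''cr'') (arr s ''q'')
             (arr s ''di'') (arr s ''root'')"

lemma bfs_prog:
  notes bfs_inv_def [simp]
  assumes s: "reg s ''n'' = n" "reg s ''p'' = 0" "reg s ''qh'' = 0" "reg s ''qt'' = 0" "reg s ''rt'' = 0"
      "reg s ''cr'' = 0" "arr s ''q'' = (\<lambda>_. 0)" "arr s ''di'' = (\<lambda>_. 0)" "arr s ''dp'' = (\<lambda>_. 0)"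
    and a: "adj (2 * m) (arr s ''hd'') (arr s ''nx'')"
    and d: "\<And>h. h < 2 * m \<Longrightarrow> arr s ''ds'' h = hdst h \<and> arr s ''ei'' h = h div 2"
  shows "run w bfs_prog s ((2 * n + 2 * m) * (cost bfs_body + bcost bfs_cond + 1) + bcost bfs_cond + 1)
    (\<lambda>s'. forest (arr s' ''q'') (arr s' ''root'') (arr s' ''dp'') (arr s' ''pr'') (arr s' ''pe''))"
  unfolding bfs_prog_def
proof (rule run_While[where
      I = bfs_inv
      and \<Phi> = "\<lambda>s. bfs_pot (reg s ''rt'') (reg s ''qh'') (arr s ''q'') (reg s ''p'') *
          (cost bfs_body + bcost bfs_cond + 1)"], goal_cases)
  case 1
  then show ?case using s n2 by (auto simp: discovered_def scanning_def scanned_def)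
next
  case (2 s')
  then have n: "reg s' ''n'' = n" using s by (simp add: frame_def bfs_body_def)
  have "reg s' ''p'' \<le> 2 * m" using 2 by (cases "reg s' ''p''") (auto simp: scanning_def)
  moreover have "reg s' ''qt'' \<le> n" using 2 discovered_qt_le unfolding bfs_inv_def by blast
  ultimately show ?case using 2 n w by (simp add: bfs_cond_def discovered_def scanning_def)
next
  case (3 s')
  define qt where "qt = reg s' ''qt''"
  define rt where "rt = reg s' ''rt''"
  define cr where "cr = reg s' ''cr''"
  define qh where "qh = reg s' ''qh''"
  define p where "p = reg s' ''p''"
  define u where "u = reg s' ''u''"
  define q where "q = arr s' ''q''"
  define di where "di = arr s' ''di''"
  define root where "root = arr s' ''root''"
  define dp where "dp = arr s' ''dp''"
  define pr where "pr = arr s' ''pr''"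
  define pe where "pe = arr s' ''pe''"
  define H where "H = arr s ''hd''"
  define N where "N = arr s ''nx''"
  note defs = qt_def[symmetric] rt_def[symmetric] cr_def[symmetric] qh_def[symmetric] p_def[symmetric]
     u_def[symmetric] q_def[symmetric] di_def[symmetric] root_def[symmetric] dp_def[symmetric]
     pr_def[symmetric] pe_def[symmetric]
  have c: "reg s' ''n'' = n" "arr s' ''hd'' = H" "arr s' ''nx'' = N"
     "arr s' ''ds'' = arr s ''ds''" "arr s' ''ei'' = arr s ''ei''"
    using 3(1) s by (simp_all add: frame_def bfs_body_def H_def N_def)
  have D: "discovered qt rt cr q di root dp pr pe" and S: "scanning qh qt p u cr q di root"
    using 3(2) by (simp_all add: defs)
  have A: "adj (2 * m) H N" using a by (simp add: H_def N_def)
  have bounds: "qt \<le> n" "qh \<le> qt" "p \<le> 2 * m" "rt \<le> n" "cr \<le> n" "di v \<le> 1" "dp v \<le> 1" for v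
    using discovered_qt_le[OF D] S D by (cases p; auto simp: discovered_def scanning_def)+
  let ?Q = "\<lambda>s. bfs_inv s \<and>
     bfs_pot (reg s ''rt'') (reg s ''qh'') (arr s ''q'') (reg s ''p'') < bfs_pot rt qh q p"
  have "run w bfs_body s' (cost bfs_body) ?Q"
  proof (rule run_loop_free)
    show "loop_free bfs_body" by (simp add: bfs_body_def)
    consider (scan) "0 < p" | (deq) "p = 0" "qh < qt" | (root) "p = 0" "\<not> qh < qt" by blast
    then have "fits w bfs_body s' \<and> ?Q (result bfs_body s')"
    proof cases
      case scan
      then obtain h where h: "p = Suc h" by (cases p) auto
      have ph: "h < 2 * m" "hsrc h = u" "u = q (qh - 1)" "0 < qh"
        using S h by (auto simp: scanning_def)
      have u: "u < n" using ph D bounds by (auto simp: discovered_def)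
      have lo: "last_out u (N h) h" using A ph by (auto simp: adj_def)
      then have Nb: "N h \<le> 2 * m" using ph by (simp add: last_out_def)
      have ds: "arr s ''ds'' h = hdst h" "arr s ''ei'' h = h div 2"
        using d ph(1) by auto
      have pot: "bfs_pot rt qh q (N h) < bfs_pot rt qh q (Suc h)" using bfs_pot_scan[OF D S scan] lo h by simp
      have e: "h div 2 < m" using ph by auto
      have wb: "u \<le> w" "hdst h \<le> w" "h \<le> w" "Suc h \<le> w" "N h \<le> w" "cr \<le> w"
        "qt \<le> w" "Suc qt \<le> w" "di (hdst h) \<le> w" "dp u \<le> w" "1 \<le> w"
        using u hdst_less[of h] ph(1) Nb bounds(1,5) bounds(6)[of "hdst h"] bounds(7)[of u] w'
        by simp_all
      have wb2: "h div 2 \<le> w" using wb(3) by simp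
      have rp: "reg s' ''p'' = Suc h" using h p_def by simp
      show ?thesis
      proof (cases "di (hdst h) = 0")
        case True
        let ?v = "hdst h"
        have x: "\<exists>j<qt. u = q j" using ph bounds by (intro exI[of _ "qh - 1"]) auto
        have e2: "{U (h div 2), W (h div 2)} = {?v, u}"
          using ph by (auto simp: hdst_def hsrc_def)
        have ru: "root u = cr" using S scan ph by (auto simp: scanning_def)
        have cr: "cr \<le> rt" "rt \<le> n" using D by (auto simp: discovered_def)
        have D': "discovered (Suc qt) rt cr (q(qt := ?v)) (di(?v := 1)) (root(?v := cr)) (dp(?v := 1 - dp u))
            (pr(?v := u)) (pe(?v := h div 2))"
          by (rule discovered_push[OF D hdst_less True]) (use x e e2 ru cr in auto)
        \<comment> \<open>The new vertex is pushed first; the half-edge then leads to a discovered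
          vertex, and \<open>scan_old\<close> applies to it.\<close>
        have S0: "scanning qh (Suc qt) p u cr (q(qt := ?v)) (di(?v := 1)) (root(?v := cr))"
          by (rule scanning_push[OF D S hdst_less True]) simp
        have S': "scanning qh (Suc qt) (N h) u cr (q(qt := ?v)) (di(?v := 1)) (root(?v := cr))"
          using scan_old[OF D' S0 scan, of "N h"] lo h by simp
        have pot': "bfs_pot rt qh (q(qt := ?v)) (N h) = bfs_pot rt qh q (N h)"
          unfolding bfs_pot_def using scanned_cong[of qh "q(qt := ?v)" q] bounds by simp
        show ?thesis using True D' S' pot pot' wb wb2 ds
          by (simp add: bfs_body_def defs c rp h)
      next
        case False
        have S': "scanning qh qt (N h) u cr q di root" using scan_old[OF D S scan, of "N h"] lo h False by simp
        show ?thesis using False D S' pot wb wb2 ds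
          by (simp add: bfs_body_def defs c rp h)
      qed
    next
      case deq
      have lo: "last_out (q qh) (H (q qh)) (2 * m)" using A by (auto simp: adj_def)
      then have Hb: "H (q qh) \<le> 2 * m" by (simp add: last_out_def)
      have qn: "q qh < n" using D deq by (auto simp: discovered_def)
      have S': "scanning (Suc qh) qt (H (q qh)) (q qh) cr q di root"
        using scanning_dequeue[of qh qt u cr q di root "H (q qh)"] S deq lo by simp
      have pot: "bfs_pot rt (Suc qh) q (H (q qh)) < bfs_pot rt qh q 0"
        unfolding bfs_pot_def using scanned_dequeue[of q qh, OF lo] deq bounds by auto
      show ?thesis using deq D S' pot bounds(1-5) qn Hb w n2 by (simp add: bfs_body_def defs c)
    next
      case root
      have rt: "rt < n" using 3(3) root c by (simp add: bfs_cond_def defs)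
      have qq: "qh = qt" using root bounds by simp
      show ?thesis
      proof (cases "di rt = 0")
        case True
        have D': "discovered (Suc qt) (Suc rt) rt (q(qt := rt)) (di(rt := 1)) (root(rt := rt)) (dp(rt := 0))
            (pr(rt := pr rt)) (pe(rt := pe rt))"
          by (rule discovered_push[OF D rt True]) (use D rt in \<open>auto simp: discovered_def\<close>)
        have S': "scanning qh (Suc qt) p u rt (q(qt := rt)) (di(rt := 1)) (root(rt := rt))"
          by (rule scanning_push[OF D S rt True]) (use root qq in simp)
        have pot: "bfs_pot (Suc rt) qh (q(qt := rt)) 0 < bfs_pot rt qh q 0"
          unfolding bfs_pot_def using scanned_cong[of qh "q(qt := rt)" q] bounds rt by simp
        show ?thesis using root True D' S' pot bounds(1-5) bounds(6)[of rt] rt w n2 by (simp add: bfs_body_def defs c)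
      next
        case False
        have D': "discovered qt (Suc rt) cr q di root dp pr pe"
          using D rt False by (auto simp: discovered_def less_Suc_eq)
        have pot: "bfs_pot (Suc rt) qh q 0 < bfs_pot rt qh q 0" using rt by (simp add: bfs_pot_def)
        show ?thesis using root False D' S pot bounds(1-5) bounds(6)[of rt] rt w n2 by (simp add: bfs_body_def defs c)
      qed
    qed
    then show "fits w bfs_body s'" "?Q (result bfs_body s')" by auto
  qed simp
  then show ?case
  proof (intro exI[of _ "cost bfs_body"], elim run_mono)
    fix s'' assume Q: "?Q s''"
    let ?c = "cost bfs_body + bcost bfs_cond + 1"
    have "(bfs_pot (reg s'' ''rt'') (reg s'' ''qh'') (arr s'' ''q'') (reg s'' ''p'') + 1) * ?c
      \<le> bfs_pot rt qh q p * ?c"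
      using Q by (intro mult_right_mono) auto
    then show "bfs_inv s'' \<and>
      bfs_pot (reg s'' ''rt'') (reg s'' ''qh'') (arr s'' ''q'') (reg s'' ''p'') * ?c + cost bfs_body +
        bcost bfs_cond + 1
      \<le> bfs_pot (reg s' ''rt'') (reg s' ''qh'') (arr s' ''q'') (reg s' ''p'') * ?c"
      using Q by (simp add: defs algebra_simps)
  qed simp
next
  case (4 s')
  have "reg s' ''n'' = n" using 4(1) s by (simp add: frame_def bfs_body_def)
  then have b: "reg s' ''p'' = 0" "\<not> reg s' ''qh'' < reg s' ''qt''" "reg s' ''rt'' = n"
    using 4 by (auto simp: bfs_cond_def discovered_def)
  show ?case
    using scanning_finished[of "reg s' ''qt''" "reg s' ''cr''" "arr s' ''q''" "arr s' ''di''" "arr s' ''root''"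
      "arr s' ''dp''" "arr s' ''pr''" "arr s' ''pe''" "reg s' ''qh''" "reg s' ''u''"] 4(2) b by simp
next
  case 5
  have "scanned (arr s ''q'') 0 0 = {}" by (simp add: scanned_def)
  then show ?case using s by (simp add: bfs_pot_def)
qed

end

section \<open>Swapping colors within components\<close>

definition swap :: "nat \<Rightarrow> nat \<Rightarrow> nat \<Rightarrow> nat" where
  "swap x y c = (if c = x then y else if c = y then x else c)"

section \<open>Parities of color sums\<close>

lemma add_mod_2: "(x + y) mod 2 = (if y mod 2 = 1 then 1 - x mod 2 else x mod 2)" for x y :: nat
  by presburger

lemma mod_2_le: "x mod 2 \<le> 1" and mod_2_cases: "x mod 2 = 0 \<or> x mod 2 = Suc 0" for x :: nat
  by presburger+

lemma swap_less: "x < k \<Longrightarrow> y < k \<Longrightarrow> c < k \<Longrightarrow> swap x y c < k"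
  by (simp add: swap_def)

lemma swap_eq_iff: "swap x y c = swap x y d \<longleftrightarrow> c = d"
  by (auto simp: swap_def)

text \<open>The swap changes the sum by \<open>y - x\<close> times the difference between the
  numbers of occurrences of \<open>x\<close> and of \<open>y\<close>, a product of two odd integers.
  The computation is done in the integers because of these differences.\<close>

lemma even_sum_swap:
  assumes "finite I" and "odd (\<Sum>i\<in>I. f i)" and "even (card {i\<in>I. f i = x})" "odd (card {i\<in>I. f i = y})"
    and "x mod 2 \<noteq> y mod 2"
  shows "even (\<Sum>i\<in>I. swap x y (f i))"
proof -
  have xy: "x \<noteq> y" using assms by auto
  have "int (swap x y (f i)) = int (f i) + (if f i = x then int y - int x else 0) + (if f i = y then int x - int y else 0)" for i
    using xy by (simp add: swap_def)
  then have "(\<Sum>i\<in>I. int (swap x y (f i))) = (\<Sum>i\<in>I. int (f i)) + (\<Sum>i\<in>I. if f i = x then int y - int x else 0)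
     + (\<Sum>i\<in>I. if f i = y then int x - int y else 0)"
    by (simp add: sum.distrib)
  also have "(\<Sum>i\<in>I. if f i = x then int y - int x else 0) = int (card {i\<in>I. f i = x}) * (int y - int x)"
    using assms(1) by (simp flip: sum.inter_filter)
  also have "(\<Sum>i\<in>I. if f i = y then int x - int y else 0) = int (card {i\<in>I. f i = y}) * (int x - int y)"
    using assms(1) by (simp flip: sum.inter_filter)
  finally have e: "int (\<Sum>i\<in>I. swap x y (f i)) = int (\<Sum>i\<in>I. f i) + int (card {i\<in>I. f i = x}) * (int y - int x) +
    int (card {i\<in>I. f i = y}) * (int x - int y)" by simp
  have "odd (int x - int y)" using assms(5) by presburger
  then have "even (int (\<Sum>i\<in>I. swap x y (f i)))"
    unfolding e using assms(2,3,4) by (simp del: of_nat_sum)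
  then show ?thesis by (simp del: of_nat_sum)
qed

lemma sum_by_colors:
  assumes "finite I" "\<And>i. i \<in> I \<Longrightarrow> f i < (k::nat)"
  shows "(\<Sum>i\<in>I. f i) = (\<Sum>c<k. card {i\<in>I. f i = c} * c)"
proof -
  have "(\<Sum>i\<in>I. f i) = (\<Sum>c<k. \<Sum>i\<in>{i\<in>I. f i = c}. f i)"
    using assms by (intro sum.group[symmetric]) auto
  also have "\<dots> = (\<Sum>c<k. card {i\<in>I. f i = c} * c)"
    by (intro sum.cong refl) simp
  finally show ?thesis .
qed

text \<open>If \<open>x\<close> is even, some summand (count of \<open>c\<close>) * \<open>c\<close>
  of the odd sum is odd, which makes both factors odd. If \<open>x\<close> is odd, color 0 precedes
  it and so has odd count. An odd count is not 0, so a scan of the vertices meets the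
  partner.\<close>

lemma swap_partner:
  assumes "finite I" "\<And>i. i \<in> I \<Longrightarrow> f i < (k::nat)" and "odd (\<Sum>i\<in>I. f i)"
    and x: "x < k" "even (card {i\<in>I. f i = x})" "\<And>c. c < x \<Longrightarrow> odd (card {i\<in>I. f i = c})"
  obtains i where "i \<in> I" "odd (card {j\<in>I. f j = f i})" "f i mod 2 \<noteq> x mod 2"
proof -
  have "\<exists>c<k. odd (card {i\<in>I. f i = c}) \<and> c mod 2 \<noteq> x mod 2"
  proof (cases "even x")
    case True
    have "\<exists>c<k. odd (card {i\<in>I. f i = c} * c)"
    proof (rule ccontr)
      assume "\<not> ?thesis"
      then have "even (\<Sum>c<k. card {i\<in>I. f i = c} * c)" by (intro dvd_sum) auto
      then show False using assms(3) sum_by_colors[OF assms(1,2)] by simp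
    qed
    then obtain c where c: "c < k" "odd (card {i\<in>I. f i = c})" "odd c" by auto
    moreover have "c mod 2 \<noteq> x mod 2" using c(3) True by presburger
    ultimately show ?thesis by blast
  next
    case False
    then have "0 < x" by (cases x) auto
    moreover have "0 mod 2 \<noteq> x mod 2" using False by presburger
    ultimately show ?thesis using x by (intro exI[of _ 0]) auto
  qed
  then obtain c where c: "odd (card {i\<in>I. f i = c})" "c mod 2 \<noteq> x mod 2" by blast
  then have "{i\<in>I. f i = c} \<noteq> {}" by (metis card.empty even_zero)
  then show ?thesis using c that by auto
qed

text \<open>With all counts odd the sum has the parity of 0 + 1 + ... + (k - 1) = h (2 h - 1) where
  k = 2 h, hence the parity of h.\<close>

lemma sum_all_odd:
  assumes "finite I" "\<And>i. i \<in> I \<Longrightarrow> f i < (k::nat)" and "\<And>c. c < k \<Longrightarrow> odd (card {i\<in>I. f i = c})" and "even k"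
  shows "odd (\<Sum>i\<in>I. f i) \<longleftrightarrow> k mod 4 = 2"
proof -
  have "even (\<Sum>c<j. card {i\<in>I. f i = c} * c) \<longleftrightarrow> even (\<Sum>c<j. c)" if "j \<le> k" for j
    using that by (induction j) (use assms(3) in auto)
  then have "odd (\<Sum>i\<in>I. f i) \<longleftrightarrow> odd (\<Sum>c<k. c)" by (simp add: sum_by_colors[OF assms(1,2)])
  also have "(\<Sum>c<k. c) = k * (k - 1) div 2" by (metis Sum_Ico_nat atLeast0LessThan diff_zero mult_0 minus_nat.diff_0)
  also obtain h where h: "k = 2 * h" using \<open>even k\<close> by blast
  have "k * (k - 1) div 2 = h * (k - 1)" using h by simp
  also have "odd (h * (k - 1)) \<longleftrightarrow> odd h" using h by (cases h) auto
  also have "odd h \<longleftrightarrow> k mod 4 = 2" unfolding h by presburger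
  finally show ?thesis .
qed

section \<open>Roots, parents and components in the finished forest\<close>

locale forested = input +
  fixes q root dp pr pe :: "nat \<Rightarrow> nat"
  assumes forest: "forest q root dp pr pe"
begin

lemma q_less [simp]: "q i < n"
  using forest by (simp add: forest_def)

lemma q_le_w [simp]: "q i \<le> w"
  using w' q_less[of i] by linarith

lemma q_bij: "bij_betw q {..<n} {..<n}"
  using forest by (simp add: forest_def)

lemma q_eq_iff: "i < n \<Longrightarrow> j < n \<Longrightarrow> q i = q j \<longleftrightarrow> i = j"
  using q_bij by (auto simp: bij_betw_def inj_on_def)

lemma q_surj:
  assumes "v < n" obtains i where "i < n" "v = q i"
  using q_bij assms by (auto simp: bij_betw_def)

lemma root_sorted: "i \<le> j \<Longrightarrow> j < n \<Longrightarrow> root (q i) \<le> root (q j)"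
  using forest by (simp add: forest_def)

lemma root_edge: "e < m \<Longrightarrow> root (U e) = root (W e)"
  using forest by (simp add: forest_def)

lemma dp_le [simp]: "dp v \<le> 1"
  using forest by (simp add: forest_def)

lemma tree_at: "i < n \<Longrightarrow> tree_at q root dp pr pe i"
  using forest by (simp add: forest_def)

text \<open>Induction on positions: a vertex with a parent inherits a root at a strictly earlier
  position and so is not its own root. Hence a vertex that is its own root falls under the first
  alternative of \<open>tree_at\<close> and has level 0.\<close>

lemma root_pos:
  "i < n \<Longrightarrow> \<exists>j\<le>i. root (q i) = q j \<and> root (q j) = q j \<and> (root (q i) \<noteq> q i \<or> dp (q i) = 0)"
proof (induction i rule: less_induct)
  case (less i)
  show ?case
  proof (cases "root (q i) = q i \<and> dp (q i) = 0")
    case False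
    then obtain j where j: "j < i" "pr (q i) = q j" "root (q i) = root (q j)"
      using tree_at[OF less.prems] by (auto simp: tree_at_def)
    then obtain j' where j': "j' \<le> j" "root (q j) = q j'" "root (q j') = q j'"
      using less.IH[of j] less.prems by auto
    moreover have "q j' \<noteq> q i" using j j' less.prems by (simp add: q_eq_iff)
    ultimately show ?thesis using j by (intro exI[of _ j']) auto
  qed auto
qed

lemma root_less [simp]: "v < n \<Longrightarrow> root v < n"
  and root_root [simp]: "v < n \<Longrightarrow> root (root v) = root v"
  and dp_root: "v < n \<Longrightarrow> root v = v \<Longrightarrow> dp v = 0"
  using root_pos by (metis q_surj q_less)+

lemma root_le_w [simp]: "v < n \<Longrightarrow> root v \<le> w"
  using w' root_less[of v] by linarith

lemma parent:
  assumes "i < n" "root (q i) \<noteq> q i"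
  shows "\<exists>j<i. pr (q i) = q j" "root (pr (q i)) = root (q i)" "dp (q i) = 1 - dp (pr (q i))" "pe (q i) < m"
    "{U (pe (q i)), W (pe (q i))} = {q i, pr (q i)}"
  using tree_at[OF assms(1)] assms(2) by (auto simp: tree_at_def)

text \<open>\<open>B\<close> is the first position after \<open>a\<close> where the root changes. By
  sortedness the root is larger from there on, so the component cannot reappear.\<close>

lemma component_interval:
  assumes a: "a < n" "\<And>i. i < a \<Longrightarrow> root (q i) \<noteq> root (q a)"
  obtains B where "a < B" "B \<le> n" "\<And>i. i < n \<Longrightarrow> root (q i) = root (q a) \<longleftrightarrow> a \<le> i \<and> i < B"
proof -
  define B where "B = (LEAST b. a < b \<and> (b = n \<or> root (q b) \<noteq> root (q a)))"
  have ex: "a < n \<and> (n = n \<or> root (q n) \<noteq> root (q a))" using a by simp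
  have B: "a < B" "B = n \<or> root (q B) \<noteq> root (q a)"
    unfolding B_def using LeastI[where P = "\<lambda>b. a < b \<and> (b = n \<or> root (q b) \<noteq> root (q a))", OF ex] by auto
  have Bn: "B \<le> n" unfolding B_def by (rule Least_le) (use a in auto)
  have lt: "root (q i) = root (q a)" if "a \<le> i" "i < B" for i
    using not_less_Least[of i "\<lambda>b. a < b \<and> (b = n \<or> root (q b) \<noteq> root (q a))"] that
    by (cases "i = a") (auto simp: B_def[symmetric])
  have gt: "root (q i) \<noteq> root (q a)" if "B \<le> i" "i < n" for i
  proof -
    have "root (q B) \<noteq> root (q a)" using B that by auto
    moreover have "root (q a) \<le> root (q B)" using B that by (intro root_sorted) auto
    moreover have "root (q B) \<le> root (q i)" using that by (intro root_sorted) auto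
    ultimately show ?thesis by simp
  qed
  show ?thesis
  proof (rule that[OF B(1) Bn])
    fix i assume "i < n"
    then show "root (q i) = root (q a) \<longleftrightarrow> a \<le> i \<and> i < B" using a lt gt by (metis not_less)
  qed
qed

end

text \<open>
  \<open>pc\<close> holds the parities of the color counts of the current component; it is reset vertex by vertex since
  clearing all \<open>k\<close> entries for each component would take too long.
\<close>

definition count_body :: com where
  "count_body =
     ''z'' ::= Arr ''col'' (Arr ''q'' (Reg ''b'')) ;;
     If (Eq (Arr ''pc'' (Reg ''z'')) (Const 0))
       (Store ''pc'' (Reg ''z'') (Const 1) ;; ''no'' ::= Add (Reg ''no'') (Const 1))
       (Store ''pc'' (Reg ''z'') (Const 0) ;; ''no'' ::= Sub (Reg ''no'') (Const 1)) ;;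
     If (Eq (Arr ''od'' (Reg ''z'')) (Const 1)) (''sm'' ::= Sub (Const 1) (Reg ''sm'')) Skip ;;
     ''b'' ::= Add (Reg ''b'') (Const 1)"

definition count_cond :: bexp where
  "count_cond = Conj (Less (Reg ''b'') (Reg ''n'')) (Eq (Arr ''root'' (Arr ''q'' (Reg ''b''))) (Reg ''cr''))"

text \<open>
  The search for a color \<open>x\<close> of even count takes no more steps than the component has vertices because all colors
  below \<open>x\<close> occur. Taking the first such color also ensures that it has a partner: if \<open>x\<close> is odd, then color
  \<open>0\<close> has odd count.
\<close>

definition first_even_cond :: bexp where
  "first_even_cond = Eq (Arr ''pc'' (Reg ''x'')) (Const 1)"

definition first_even_body :: com where
  "first_even_body = (''x'' ::= Add (Reg ''x'') (Const 1))"

definition scan_cond :: bexp where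
  "scan_cond = Less (Reg ''p'') (Reg ''b'')"

definition partner_body :: com where
  "partner_body =
     ''z'' ::= Arr ''col'' (Arr ''q'' (Reg ''p'')) ;;
     If (Conj (Eq (Arr ''pc'' (Reg ''z'')) (Const 1)) (Neg (Eq (Arr ''od'' (Reg ''z'')) (Arr ''od'' (Reg ''x'')))))
       (''y'' ::= Reg ''z'') Skip ;;
     ''p'' ::= Add (Reg ''p'') (Const 1)"

definition recolor_body :: com where
  "recolor_body =
     ''v'' ::= Arr ''q'' (Reg ''p'') ;;
     ''z'' ::= Arr ''col'' (Reg ''v'') ;;
     Store ''pc'' (Reg ''z'') (Const 0) ;;
     If (Eq (Reg ''z'') (Reg ''x'')) (Store ''t'' (Reg ''v'') (Reg ''y''))
       (If (Eq (Reg ''z'') (Reg ''y'')) (Store ''t'' (Reg ''v'') (Reg ''x'')) (Store ''t'' (Reg ''v'') (Reg ''z''))) ;;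
     ''p'' ::= Add (Reg ''p'') (Const 1)"

definition count_prog :: com where
  "count_prog =
     (''cr'' ::= Arr ''root'' (Arr ''q'' (Reg ''a'')) ;;
      ''b'' ::= Reg ''a'' ;; ''no'' ::= Const 0 ;; ''sm'' ::= Const 0) ;;
     While count_cond count_body"

definition find_prog :: com where
  "find_prog =
     ''x'' ::= Const 0 ;;
     While first_even_cond first_even_body ;;
     (''p'' ::= Reg ''a'' ;; ''y'' ::= Reg ''x'') ;;
     While scan_cond partner_body"

definition choose_prog :: com where
  "choose_prog =
     If (Conj (Eq (Reg ''sm'') (Const 1)) (Less (Reg ''no'') (Reg ''k''))) find_prog (''x'' ::= Const 0 ;; ''y'' ::= Const 0)"

definition recolor_prog :: com where
  "recolor_prog = ''p'' ::= Reg ''a'' ;; While scan_cond recolor_body"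

definition comp_body :: com where
  "comp_body =
     count_prog ;;
     If (Eq (Reg ''no'') (Reg ''k'')) (''bd'' ::= Const 1) Skip ;;
     choose_prog ;;
     recolor_prog ;;
     ''a'' ::= Reg ''b''"

definition comp_cond :: bexp where
  "comp_cond = Less (Reg ''a'') (Reg ''n'')"

definition comp_prog :: com where
  "comp_prog = While comp_cond comp_body"

section \<open>Making the color sum of each component even\<close>

locale colored = forested +
  fixes k :: nat and col :: "nat \<Rightarrow> nat"
  assumes k2: "2 \<le> k" and kn: "k \<le> n" and col: "\<And>v. v < n \<Longrightarrow> col v < k"
begin

definition full :: "nat \<Rightarrow> bool" where
  "full \<rho> \<longleftrightarrow> (\<forall>c<k. odd (card {v. v < n \<and> root v = \<rho> \<and> col v = c}))"

text \<open>\<open>x = y\<close> is allowed and leaves the coloring unchanged. The second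
  alternative records the only failure of swapping; it is harmless for odd \<open>k\<close>, and for
  even \<open>k\<close> it forces \<open>k mod 4 = 2\<close>, where \<open>k + 1\<close> colors are
  used.\<close>

definition settled :: "(nat \<Rightarrow> nat) \<Rightarrow> nat \<Rightarrow> bool" where
  "settled t \<rho> \<longleftrightarrow>
     (\<exists>x<k. \<exists>y<k. \<forall>v<n. root v = \<rho> \<longrightarrow> t v = swap x y (col v)) \<and>
     (even (\<Sum>v | v < n \<and> root v = \<rho>. t v) \<or> full \<rho> \<and> odd (\<Sum>v | v < n \<and> root v = \<rho>. col v))"

definition pcount :: "nat \<Rightarrow> nat \<Rightarrow> nat \<Rightarrow> nat" where
  "pcount a b c = card {i\<in>{a..<b}. col (q i) = c}"

lemma pcount_Suc: "a \<le> b \<Longrightarrow> pcount a (Suc b) c = pcount a b c + (if col (q b) = c then 1 else 0)"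
proof -
  assume "a \<le> b"
  then have "{i\<in>{a..<Suc b}. col (q i) = c} =
    (if col (q b) = c then insert b {i\<in>{a..<b}. col (q i) = c} else {i\<in>{a..<b}. col (q i) = c})"
    by (auto simp: less_Suc_eq)
  then show ?thesis by (simp add: pcount_def)
qed

lemma pcount_empty [simp]: "pcount a a c = 0"
  by (simp add: pcount_def)

text \<open>Its cardinality is maintained in register \<open>no\<close>, so that
  \<open>no = k\<close> recognizes a full component in one test instead of a pass over all
  \<open>k\<close> colors.\<close>

definition oddcols :: "nat \<Rightarrow> nat \<Rightarrow> nat set" where
  "oddcols a b = {c. c < k \<and> odd (pcount a b c)}"

lemma oddcols_Suc:
  assumes "a \<le> b"
  shows "card (oddcols a (Suc b)) =
    (if even (pcount a b (col (q b))) then card (oddcols a b) + 1 else card (oddcols a b) - 1)"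
proof -
  have "oddcols a (Suc b) = (if even (pcount a b (col (q b))) then insert (col (q b)) (oddcols a b)
      else oddcols a b - {col (q b)})"
    using pcount_Suc[OF assms] col by (auto simp: oddcols_def split: if_splits)
  moreover have "col (q b) \<in> oddcols a b \<longleftrightarrow> odd (pcount a b (col (q b)))" using col by (auto simp: oddcols_def)
  moreover have "finite (oddcols a b)" by (simp add: oddcols_def)
  ultimately show ?thesis by (simp add: card_Diff_singleton)
qed

lemma card_oddcols: "card (oddcols a b) \<le> k"
  using card_mono[of "{..<k}" "oddcols a b"] by (auto simp: oddcols_def)

definition static :: "store \<Rightarrow> bool" where
  "static s \<longleftrightarrow> reg s ''n'' = n \<and> reg s ''k'' = k \<and> arr s ''q'' = q \<and> arr s ''root'' = root \<and>
     (\<forall>v<n. arr s ''col'' v = col v) \<and> (\<forall>c\<le>k. arr s ''od'' c = c mod 2)"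

lemma static_frame:
  "static s \<Longrightarrow> frame p s s' \<Longrightarrow> ''n'' \<notin> mod_regs p \<Longrightarrow> ''k'' \<notin> mod_regs p \<Longrightarrow> ''q'' \<notin> mod_arrs p \<Longrightarrow>
   ''root'' \<notin> mod_arrs p \<Longrightarrow> ''col'' \<notin> mod_arrs p \<Longrightarrow> ''od'' \<notin> mod_arrs p \<Longrightarrow> static s'"
  by (simp add: static_def frame_def)

lemma count_prog:
  assumes s: "static s" "reg s ''a'' = a" "arr s ''pc'' = (\<lambda>_. 0)"
    and B: "a < B" "B \<le> n" "\<And>i. i < n \<Longrightarrow> root (q i) = root (q a) \<longleftrightarrow> a \<le> i \<and> i < B"
  shows "run w count_prog s ((B - a) * (cost count_body + bcost count_cond + 1) + bcost count_cond + 30)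
    (\<lambda>s'. reg s' ''b'' = B \<and> reg s' ''no'' = card (oddcols a B) \<and> reg s' ''sm'' = (\<Sum>i\<in>{a..<B}. col (q i)) mod 2 \<and>
       (\<forall>c. arr s' ''pc'' c = pcount a B c mod 2))"
  unfolding count_prog_def
proof (rule run_Seq[where Tp = 20 and P = "\<lambda>s'. reg s' ''b'' = a \<and> reg s' ''no'' = 0 \<and> reg s' ''sm'' = 0 \<and>
     reg s' ''cr'' = root (q a) \<and> arr s' ''pc'' = (\<lambda>_. 0)"])
  show "run w (''cr'' ::= Arr ''root'' (Arr ''q'' (Reg ''a'')) ;; ''b'' ::= Reg ''a'' ;; ''no'' ::= Const 0 ;; ''sm'' ::= Const 0) s 20
     (\<lambda>s'. reg s' ''b'' = a \<and> reg s' ''no'' = 0 \<and> reg s' ''sm'' = 0 \<and>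
     reg s' ''cr'' = root (q a) \<and> arr s' ''pc'' = (\<lambda>_. 0))"
    using s B(1,2) w' by (intro run_loop_free) (simp_all add: static_def)
next
  fix s0
  assume f0: "frame (''cr'' ::= Arr ''root'' (Arr ''q'' (Reg ''a'')) ;; ''b'' ::= Reg ''a'' ;; ''no'' ::= Const 0 ;; ''sm'' ::= Const 0) s s0"
    and s0: "reg s0 ''b'' = a \<and> reg s0 ''no'' = 0 \<and> reg s0 ''sm'' = 0 \<and>
     reg s0 ''cr'' = root (q a) \<and> arr s0 ''pc'' = (\<lambda>_. 0)"
  have c0: "static s0" by (rule static_frame[OF s(1) f0]) simp_all
  let ?I = "\<lambda>b s'. reg s' ''b'' = b \<and> reg s' ''no'' = card (oddcols a b) \<and>
      reg s' ''sm'' = (\<Sum>i\<in>{a..<b}. col (q i)) mod 2 \<and> (\<forall>c. arr s' ''pc'' c = pcount a b c mod 2)"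
  show "run w (While count_cond count_body) s0 ((B - a) * (cost count_body + bcost count_cond + 1) + bcost count_cond + 1)
    (\<lambda>s'. reg s' ''b'' = B \<and> reg s' ''no'' = card (oddcols a B) \<and> reg s' ''sm'' = (\<Sum>i\<in>{a..<B}. col (q i)) mod 2 \<and>
       (\<forall>c. arr s' ''pc'' c = pcount a B c mod 2))"
  proof (rule run_iterate[where a = a and B = B and J = ?I])
    show "loop_free count_body" by (simp add: count_body_def)
    show "?I a s0"
      using s0 by (simp add: oddcols_def)
  next
    fix b and s' :: store
    assume f: "frame count_body s0 s'" and b: "a \<le> b" "b < B" and I: "?I b s'"
    have c: "static s'" by (rule static_frame[OF c0 f]) (simp_all add: count_body_def)
    have cr: "reg s' ''cr'' = root (q a)" using f s0 by (simp add: frame_def count_body_def)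
    have bn: "b < n" and rb: "root (q b) = root (q a)" using b B by auto
    have bounds: "q b \<le> w" "root (q a) \<le> w" "n \<le> w" "b \<le> w" "Suc b \<le> w" "col (q b) \<le> w" "col (q b) \<le> k" "1 \<le> w"
        "card (oddcols a b) + 1 \<le> w"
      using w' q_less[of b] root_less[OF q_less[of a]] bn col[OF q_less[of b]] kn card_oddcols[of a b] by simp_all
    have sum: "(\<Sum>i\<in>{a..<Suc b}. col (q i)) = (\<Sum>i\<in>{a..<b}. col (q i)) + col (q b)"
      using b by simp
    have sm: "(\<Sum>i\<in>{a..<Suc b}. col (q i)) mod 2 =
      (if col (q b) mod 2 = 1 then 1 - (\<Sum>i\<in>{a..<b}. col (q i)) mod 2 else (\<Sum>i\<in>{a..<b}. col (q i)) mod 2)"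
      unfolding sum by (rule add_mod_2)
    have pc: "pcount a (Suc b) c mod 2 = (if col (q b) = c then 1 - pcount a b c mod 2 else pcount a b c mod 2)" for c
      using add_mod_2[of "pcount a b c" 1] by (simp add: pcount_Suc[OF b(1)])
    have no: "card (oddcols a (Suc b)) = (if pcount a b (col (q b)) mod 2 = 0 then card (oddcols a b) + 1
        else card (oddcols a b) - 1)"
      using oddcols_Suc[OF b(1)] by (simp add: even_iff_mod_2_eq_zero)
    define S where "S = (\<Sum>i\<in>{a..<b}. col (q i)) mod 2"
    have S: "S \<le> 1" unfolding S_def by (rule mod_2_le)
    have pb: "pcount a b c mod 2 \<le> 1" for c by (rule mod_2_le)
    have c': "arr s' ''col'' (q b) = col (q b)" "arr s' ''od'' (col (q b)) = col (q b) mod 2" "reg s' ''n'' = n"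
      "arr s' ''q'' = q" "arr s' ''root'' = root" using c bounds(7) by (simp_all add: static_def)
    have pw: "pcount a b (col (q b)) mod 2 \<le> w" "S \<le> w" "col (q b) mod 2 \<le> w"
      using pb[of "col (q b)"] S bounds by (simp_all add: le_trans[OF mod_less_eq_dividend])
    define P where "P = (\<lambda>c. pcount a b c mod 2)"
    have apc: "arr s' ''pc'' = P" using I by (simp add: P_def fun_eq_iff)
    have P01: "P c = 0 \<or> P c = Suc 0" for c unfolding P_def by (rule mod_2_cases)
    have I': "reg s' ''b'' = b" "reg s' ''no'' = card (oddcols a b)" "reg s' ''sm'' = S"
      using I by (simp_all add: S_def)
    have fit: "bfits w count_cond s' \<and> bval count_cond s'"
      using bounds bn rb by (simp add: count_cond_def I' c' cr)
    have fit2: "fits w count_body s'"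
      using bounds pw by (simp add: count_body_def I' c' apc P_def)
    have res: "reg (result count_body s') ''b'' = Suc b"
       "reg (result count_body s') ''no'' = card (oddcols a (Suc b))"
       "reg (result count_body s') ''sm'' = (\<Sum>i\<in>{a..<Suc b}. col (q i)) mod 2"
       "arr (result count_body s') ''pc'' = (\<lambda>c. pcount a (Suc b) c mod 2)"
      unfolding no sm pc using P01[of "col (q b)"]
      by (auto simp: count_body_def I' c' apc P_def S_def fun_eq_iff)
    show "bfits w count_cond s' \<and> bval count_cond s' \<and> fits w count_body s' \<and>
       ?I (Suc b) (result count_body s')"
      using fit fit2 by (simp only: res) blast
  next
    fix s' :: store
    assume f: "frame count_body s0 s'" and I: "?I B s'"
    have c: "static s'" by (rule static_frame[OF c0 f]) (simp_all add: count_body_def)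
    have cr: "reg s' ''cr'' = root (q a)" using f s0 by (simp add: frame_def count_body_def)
    have "q B \<le> w" "root (q B) \<le> w" "root (q a) \<le> w" "B \<le> w" "n \<le> w"
      using w' q_less[of B] root_less[OF q_less[of B]] root_less[OF q_less[of a]] B by simp_all
    then show "bfits w count_cond s' \<and> \<not> bval count_cond s' \<and> ?I B s'"
      using I cr c B(3)[of B] by (auto simp: count_cond_def static_def)
  qed (use B in auto)
qed simp

text \<open>The condition of \<open>settled\<close> in terms of queue positions;
  \<open>settled_good_swap\<close> transports it along \<open>q\<close>.\<close>

definition good_swap :: "nat \<Rightarrow> nat \<Rightarrow> nat \<Rightarrow> nat \<Rightarrow> bool" where
  "good_swap a B x y \<longleftrightarrow> x < k \<and> y < k \<and>
     (even (\<Sum>i\<in>{a..<B}. swap x y (col (q i))) \<or>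
      (\<forall>c<k. odd (pcount a B c)) \<and> odd (\<Sum>i\<in>{a..<B}. col (q i)))"

lemma first_even_le:
  assumes "\<And>c. c < x \<Longrightarrow> odd (pcount a B c)"
  shows "x \<le> B - a"
proof -
  have "{..<x} \<subseteq> (\<lambda>i. col (q i)) ` {a..<B}"
  proof
    fix c assume "c \<in> {..<x}"
    then have "{i\<in>{a..<B}. col (q i) = c} \<noteq> {}"
      using assms[of c] unfolding pcount_def by (metis card.empty even_zero lessThan_iff)
    then show "c \<in> (\<lambda>i. col (q i)) ` {a..<B}" by auto
  qed
  then have "card {..<x} \<le> card ((\<lambda>i. col (q i)) ` {a..<B})" by (intro card_mono) auto
  also have "\<dots> \<le> card {a..<B}" by (rule card_image_le) simp
  finally show ?thesis by simp
qed

lemma find_prog: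
  assumes s: "static s" "reg s ''a'' = a" "reg s ''b'' = B" "arr s ''pc'' = (\<lambda>c. pcount a B c mod 2)"
    and B: "a < B" "B \<le> n"
    and no: "card (oddcols a B) < k" and sm: "odd (\<Sum>i\<in>{a..<B}. col (q i))"
  shows "run w find_prog s ((B - a) * (cost first_even_body + bcost first_even_cond + cost partner_body + bcost scan_cond + 2)
     + bcost first_even_cond + bcost scan_cond + 40)
    (\<lambda>s'. good_swap a B (reg s' ''x'') (reg s' ''y''))"
proof -
  let ?Q = "\<lambda>s'. good_swap a B (reg s' ''x'') (reg s' ''y'')"
  have "\<exists>c<k. even (pcount a B c)"
  proof (rule ccontr)
    assume "\<not> ?thesis"
    then have "oddcols a B = {..<k}" by (auto simp: oddcols_def)
    then show False using no by simp
  qed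
  then obtain c0 where c0: "c0 < k" "even (pcount a B c0)" by blast
  define x where "x = (LEAST c. even (pcount a B c))"
  have "x \<le> c0" unfolding x_def using c0(2) by (rule Least_le)
  then have x1: "x < k" using c0(1) by simp
  have x2: "even (pcount a B x)" unfolding x_def using c0(2) by (rule LeastI)
  have x3: "odd (pcount a B c)" if "c < x" for c
    using not_less_Least[of c "\<lambda>c. even (pcount a B c)"] that unfolding x_def by blast
  note x = x1 x2 x3
  have xB: "x \<le> B - a" by (rule first_even_le) (rule x(3))
  obtain i0 where i0: "i0 \<in> {a..<B}" "odd (pcount a B (col (q i0)))" "col (q i0) mod 2 \<noteq> x mod 2"
  proof (rule swap_partner[of "{a..<B}" "\<lambda>i. col (q i)" k x])
    show "even (card {i \<in> {a..<B}. col (q i) = x})" using x2 by (simp add: pcount_def)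
    show "odd (card {i \<in> {a..<B}. col (q i) = c})" if "c < x" for c using x3[OF that] by (simp add: pcount_def)
  qed (use sm x1 col in \<open>simp_all add: pcount_def\<close>)
  \<comment> \<open>\<open>G\<close> singles out the admissible partners of \<open>x\<close>. The
    scan keeps the last one met; its initial value \<open>y = x\<close> only serves to have a color
    below \<open>k\<close>, and \<open>i0\<close> guarantees that it is replaced.\<close>
  define G where "G = (\<lambda>c. odd (pcount a B c) \<and> c mod 2 \<noteq> x mod 2)"
  have kw: "k \<le> w" "n \<le> w" "1 \<le> w" "Suc n \<le> w" using w' kn by simp_all
  have pb: "pcount a B c mod 2 \<le> w" "c mod 2 \<le> w" for c
    using kw(3) mod_less_divisor[of 2 "pcount a B c"] mod_less_divisor[of 2 c] by linarith+
  let ?c1 = "x * (cost first_even_body + bcost first_even_cond + 1) + bcost first_even_cond + 1"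
  let ?c2 = "(B - a) * (cost partner_body + bcost scan_cond + 1) + bcost scan_cond + 1"
  let ?I = "\<lambda>p s'. reg s' ''p'' = p \<and> reg s' ''y'' < k \<and>
        ((\<exists>i\<in>{a..<p}. G (col (q i))) \<longrightarrow> G (reg s' ''y''))"
  have 3: "run w (While scan_cond partner_body) s3 ?c2 ?Q"
    if s3: "static s3" "reg s3 ''x'' = x" "reg s3 ''y'' = x" "reg s3 ''p'' = a" "reg s3 ''b'' = B"
      "arr s3 ''pc'' = (\<lambda>c. pcount a B c mod 2)" for s3
  proof (rule run_iterate[where a = a and B = B and J = ?I])
    show "loop_free partner_body" by (simp add: partner_body_def)
    fix p and s' :: store
    assume f: "frame partner_body s3 s'" and p: "a \<le> p" "p < B"
      and I: "?I p s'"
    have c: "static s'" by (rule static_frame[OF s3(1) f]) (simp_all add: partner_body_def)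
    have f': "reg s' ''x'' = x" "reg s' ''b'' = B" "arr s' ''pc'' = (\<lambda>c. pcount a B c mod 2)"
      using f s3 by (simp_all add: frame_def partner_body_def)
    define z where "z = col (q p)"
    have z: "z < k" using col by (simp add: z_def)
    have c': "arr s' ''q'' = q" "arr s' ''col'' (q p) = z" "arr s' ''od'' z = z mod 2" "arr s' ''od'' x = x mod 2"
      using c z x(1) by (simp_all add: static_def z_def)
    have bd: "p \<le> w" "Suc p \<le> w" "B \<le> w" "z \<le> w" "x \<le> w" using p B kw z x(1) by linarith+
    have ex: "(\<exists>i\<in>{a..<Suc p}. G (col (q i))) \<longleftrightarrow> (\<exists>i\<in>{a..<p}. G (col (q i))) \<or> G z"
      using p by (auto simp: less_Suc_eq z_def)
    have Gz: "G z \<longleftrightarrow> pcount a B z mod 2 = 1 \<and> z mod 2 \<noteq> x mod 2" by (simp add: G_def odd_iff_mod_2_eq_one)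
    show "bfits w scan_cond s' \<and> bval scan_cond s' \<and> fits w partner_body s' \<and>
       ?I (Suc p) (result partner_body s')"
      unfolding ex using Gz I f' c' bd p z pb kw by (simp add: scan_cond_def partner_body_def)
  next
    fix s' :: store
    assume f: "frame partner_body s3 s'"
      and I: "?I B s'"
    have f': "reg s' ''x'' = x" "reg s' ''b'' = B" using f s3 by (simp_all add: frame_def partner_body_def)
    have G: "G (reg s' ''y'')" using I i0 by (auto simp: G_def)
    have "even (\<Sum>i\<in>{a..<B}. swap x (reg s' ''y'') (col (q i)))"
      by (rule even_sum_swap) (use sm x(2) G in \<open>simp_all add: G_def pcount_def\<close>)
    then have "good_swap a B x (reg s' ''y'')" using x(1) I by (simp add: good_swap_def)
    then show "bfits w scan_cond s' \<and> \<not> bval scan_cond s' \<and> good_swap a B (reg s' ''x'') (reg s' ''y'')"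
      using I f' B kw by (simp add: scan_cond_def)
  qed (use s3 x B in auto)
  have 2: "run w ((''p'' ::= Reg ''a'' ;; ''y'' ::= Reg ''x'') ;; While scan_cond partner_body) s2 (?c2 + 7)
      ?Q"
    if s2: "static s2" "reg s2 ''x'' = x" "reg s2 ''b'' = B" "reg s2 ''a'' = a"
      "arr s2 ''pc'' = (\<lambda>c. pcount a B c mod 2)" for s2
  proof (rule run_Seq[where P = "\<lambda>s'. s' = result (''p'' ::= Reg ''a'' ;; ''y'' ::= Reg ''x'') s2" and Tp = 5])
    show "run w (''p'' ::= Reg ''a'' ;; ''y'' ::= Reg ''x'') s2 5 (\<lambda>s'. s' = result (''p'' ::= Reg ''a'' ;; ''y'' ::= Reg ''x'') s2)"
      by (rule run_loop_free) (use s2 x(1) B kw in simp_all)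
    fix s3 assume f3: "frame (''p'' ::= Reg ''a'' ;; ''y'' ::= Reg ''x'') s2 s3" and s3: "s3 = result (''p'' ::= Reg ''a'' ;; ''y'' ::= Reg ''x'') s2"
    show "run w (While scan_cond partner_body) s3 ?c2 ?Q"
      by (rule 3[OF static_frame[OF s2(1) f3]]) (simp_all add: s3 s2)
  qed simp
  have 1: "run w (While first_even_cond first_even_body) s1 ?c1 (\<lambda>s'. reg s' ''x'' = x)"
    if s1: "reg s1 ''x'' = 0" "arr s1 ''pc'' = (\<lambda>c. pcount a B c mod 2)" for s1
  proof (rule run_iterate[where a = 0 and B = x and J = "\<lambda>i s'. reg s' ''x'' = i"])
    show "loop_free first_even_body" by (simp add: first_even_body_def)
    fix i and s' :: store
    assume f: "frame first_even_body s1 s'" and i: "i < x" and I: "reg s' ''x'' = i"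
    have f': "arr s' ''pc'' = (\<lambda>c. pcount a B c mod 2)" using f s1 by (simp add: frame_def first_even_body_def)
    have "pcount a B i mod 2 = 1" using x(3)[OF i] by (simp add: odd_iff_mod_2_eq_one)
    then show "bfits w first_even_cond s' \<and> bval first_even_cond s' \<and> fits w first_even_body s' \<and>
          reg (result first_even_body s') ''x'' = Suc i"
      using f' I i x(1) kw by (simp add: first_even_cond_def first_even_body_def)
  next
    fix s' :: store
    assume f: "frame first_even_body s1 s'" and I: "reg s' ''x'' = x"
    have f': "arr s' ''pc'' = (\<lambda>c. pcount a B c mod 2)" using f s1 by (simp add: frame_def first_even_body_def)
    show "bfits w first_even_cond s' \<and> \<not> bval first_even_cond s' \<and> reg s' ''x'' = x"
      using f' I x(1,2) kw by (simp add: first_even_cond_def)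
  qed (use s1 in auto)
  have mono: "x * (cost first_even_body + bcost first_even_cond + 1) \<le>
     (B - a) * (cost first_even_body + bcost first_even_cond + 1)" using xB by (intro mult_right_mono) auto
  show ?thesis unfolding find_prog_def
  proof (rule run_Seq[where P = "\<lambda>s'. s' = result (''x'' ::= Const 0) s" and Tp = 2 and Tq = "?c1 + (?c2 + 7) + 1"])
    show "run w (''x'' ::= Const 0) s 2 (\<lambda>s'. s' = result (''x'' ::= Const 0) s)" by (rule run_loop_free) simp_all
    fix s1 assume f1: "frame (''x'' ::= Const 0) s s1" and s1: "s1 = result (''x'' ::= Const 0) s"
    have st1: "static s1" by (rule static_frame[OF s(1) f1]) simp_all
    show "run w (While first_even_cond first_even_body ;; (''p'' ::= Reg ''a'' ;; ''y'' ::= Reg ''x'') ;; While scan_cond partner_body)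
       s1 (?c1 + (?c2 + 7) + 1) ?Q"
    proof (rule run_Seq[OF 1])
      fix s2 assume f2: "frame (While first_even_cond first_even_body) s1 s2" and x2: "reg s2 ''x'' = x"
      have st2: "static s2" by (rule static_frame[OF st1 f2]) (simp_all add: first_even_body_def)
      show "run w ((''p'' ::= Reg ''a'' ;; ''y'' ::= Reg ''x'') ;; While scan_cond partner_body) s2 (?c2 + 7)
          ?Q"
        by (rule 2[OF st2 x2]) (use f2 s in \<open>simp_all add: frame_def first_even_body_def s1\<close>)
    qed (simp_all add: s1 s)
  next
    show "2 + (?c1 + (?c2 + 7) + 1) + 1 \<le> (B - a) * (cost first_even_body + bcost first_even_cond + cost partner_body +
        bcost scan_cond + 2) + bcost first_even_cond + bcost scan_cond + 40"
      using mono by (simp add: algebra_simps)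
  qed
qed

lemma choose_prog:
  assumes s: "static s" "reg s ''a'' = a" "reg s ''b'' = B" "arr s ''pc'' = (\<lambda>c. pcount a B c mod 2)"
      "reg s ''no'' = card (oddcols a B)" "reg s ''sm'' = (\<Sum>i\<in>{a..<B}. col (q i)) mod 2"
    and B: "a < B" "B \<le> n"
  shows "run w choose_prog s ((B - a) * (cost first_even_body + bcost first_even_cond + cost partner_body + bcost scan_cond + 2)
     + bcost first_even_cond + bcost scan_cond + 60)
    (\<lambda>s'. good_swap a B (reg s' ''x'') (reg s' ''y''))"
  unfolding choose_prog_def
proof (rule run_If)
  have w1: "k \<le> w" "1 \<le> w" "card (oddcols a B) \<le> w" using w' kn card_oddcols[of a B] by simp_all
  moreover have "(\<Sum>i\<in>{a..<B}. col (q i)) mod 2 < 2" by simp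
  ultimately show "bfits w (Conj (Eq (Reg ''sm'') (Const 1)) (Less (Reg ''no'') (Reg ''k''))) s"
    using s unfolding static_def by (simp del: mod_less_divisor)
  show "run w find_prog s ((B - a) * (cost first_even_body + bcost first_even_cond + cost partner_body + bcost scan_cond + 2)
     + bcost first_even_cond + bcost scan_cond + 40) (\<lambda>s'. good_swap a B (reg s' ''x'') (reg s' ''y''))"
    if "bval (Conj (Eq (Reg ''sm'') (Const 1)) (Less (Reg ''no'') (Reg ''k''))) s"
    using that s B by (intro find_prog) (simp_all add: static_def odd_iff_mod_2_eq_one)
  show "run w (''x'' ::= Const 0 ;; ''y'' ::= Const 0) s ((B - a) * (cost first_even_body + bcost first_even_cond + cost partner_body + bcost scan_cond + 2)
     + bcost first_even_cond + bcost scan_cond + 40) (\<lambda>s'. good_swap a B (reg s' ''x'') (reg s' ''y''))"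
    if "\<not> bval (Conj (Eq (Reg ''sm'') (Const 1)) (Less (Reg ''no'') (Reg ''k''))) s"
  proof (rule run_loop_free)
    have "\<not> ((\<Sum>i\<in>{a..<B}. col (q i)) mod 2 = 1 \<and> card (oddcols a B) < k)" using that s by (simp add: static_def)
    then have "even (\<Sum>i\<in>{a..<B}. col (q i)) \<or> odd (\<Sum>i\<in>{a..<B}. col (q i)) \<and> card (oddcols a B) = k"
      using card_oddcols[of a B] by (cases "even (\<Sum>i\<in>{a..<B}. col (q i))") (auto simp: odd_iff_mod_2_eq_one)
    moreover have "\<forall>c<k. odd (pcount a B c)" if "card (oddcols a B) = k"
    proof -
      have "oddcols a B = {..<k}" using that by (intro card_subset_eq) (auto simp: oddcols_def)
      then show ?thesis by (auto simp: oddcols_def)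
    qed
    \<comment> \<open>Without a need or a possibility to swap, the program takes
      \<open>x = y = 0\<close>, the identity.\<close>
    moreover have "swap 0 0 c = c" for c by (simp add: swap_def)
    ultimately have "good_swap a B 0 0" unfolding good_swap_def using k2 by auto
    then show "good_swap a B (reg (result (''x'' ::= Const 0;; ''y'' ::= Const 0) s) ''x'') (reg (result (''x'' ::= Const 0;; ''y'' ::= Const 0) s) ''y'')"
      by simp
  qed simp_all
qed simp

lemma recolor_prog:
  assumes s: "static s" "reg s ''a'' = a" "reg s ''b'' = B" "arr s ''pc'' = (\<lambda>c. pcount a B c mod 2)"
      "reg s ''x'' = x" "reg s ''y'' = y" "x < k" "y < k"
    and B: "a < B" "B \<le> n"
  shows "run w recolor_prog s ((B - a) * (cost recolor_body + bcost scan_cond + 1) + bcost scan_cond + 10)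
    (\<lambda>s'. arr s' ''pc'' = (\<lambda>_. 0) \<and>
       (\<forall>i<n. arr s' ''t'' (q i) = (if a \<le> i \<and> i < B then swap x y (col (q i)) else arr s ''t'' (q i))))"
  unfolding recolor_prog_def
proof (rule run_Seq[where P = "\<lambda>s'. s' = result (''p'' ::= Reg ''a'') s" and Tp = 2 and
      Tq = "(B - a) * (cost recolor_body + bcost scan_cond + 1) + bcost scan_cond + 1"])
  have kw: "k \<le> w" "n \<le> w" "1 \<le> w" "Suc n \<le> w" using w' kn by simp_all
  show "run w (''p'' ::= Reg ''a'') s 2 (\<lambda>s'. s' = result (''p'' ::= Reg ''a'') s)"
    by (rule run_loop_free) (use s B kw in simp_all)
  fix s1 assume f1: "frame (''p'' ::= Reg ''a'') s s1" and s1: "s1 = result (''p'' ::= Reg ''a'') s"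
  have st1: "static s1" by (rule static_frame[OF s(1) f1]) simp_all
  let ?I = "\<lambda>p s'. reg s' ''p'' = p \<and>
      arr s' ''pc'' = (\<lambda>c. if \<exists>i\<in>{a..<p}. col (q i) = c then 0 else pcount a B c mod 2) \<and>
      (\<forall>i<n. arr s' ''t'' (q i) = (if a \<le> i \<and> i < p then swap x y (col (q i)) else arr s ''t'' (q i)))"
  show "run w (While scan_cond recolor_body) s1 ((B - a) * (cost recolor_body + bcost scan_cond + 1) + bcost scan_cond + 1)
    (\<lambda>s'. arr s' ''pc'' = (\<lambda>_. 0) \<and>
       (\<forall>i<n. arr s' ''t'' (q i) = (if a \<le> i \<and> i < B then swap x y (col (q i)) else arr s ''t'' (q i))))"
  proof (rule run_iterate[where a = a and B = B and J = ?I])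
    show "loop_free recolor_body" by (simp add: recolor_body_def)
    fix p and s' :: store
    assume f: "frame recolor_body s1 s'" and p: "a \<le> p" "p < B"
      and I: "?I p s'"
    have c: "static s'" by (rule static_frame[OF st1 f]) (simp_all add: recolor_body_def)
    have f': "reg s' ''x'' = x" "reg s' ''y'' = y" "reg s' ''b'' = B"
      using f s by (simp_all add: frame_def recolor_body_def s1)
    define z where "z = col (q p)"
    have z: "z < k" using col by (simp add: z_def)
    have c': "arr s' ''q'' = q" "arr s' ''col'' (q p) = z"
      using c by (simp_all add: static_def z_def)
    have bd: "p \<le> w" "Suc p \<le> w" "B \<le> w" "z \<le> w" "x \<le> w" "y \<le> w" using p B kw z s(7,8) by linarith+
    have fit: "bfits w scan_cond s' \<and> bval scan_cond s' \<and> fits w recolor_body s'"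
      using I f' c' bd p kw by (simp add: scan_cond_def recolor_body_def)
    have rp: "reg (result recolor_body s') ''p'' = Suc p" using I by (simp add: recolor_body_def)
    have "arr (result recolor_body s') ''pc'' = (arr s' ''pc'')(z := 0)" using I c' by (simp add: recolor_body_def)
    also have "\<dots> = (\<lambda>c. if \<exists>i\<in>{a..<Suc p}. col (q i) = c then 0 else pcount a B c mod 2)"
      using I p by (auto simp: fun_eq_iff z_def less_Suc_eq)
    finally have rpc: "arr (result recolor_body s') ''pc'' = (\<lambda>c. if \<exists>i\<in>{a..<Suc p}. col (q i) = c then 0 else pcount a B c mod 2)" .
    have rt: "arr (result recolor_body s') ''t'' = (arr s' ''t'')(q p := swap x y z)"
      using I c' f' by (simp add: recolor_body_def swap_def)
    have "arr (result recolor_body s') ''t'' (q i) = (if a \<le> i \<and> i < Suc p then swap x y (col (q i)) else arr s ''t'' (q i))"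
      if "i < n" for i
      using I p B that q_eq_iff[of i p] unfolding rt by (auto simp: z_def less_Suc_eq)
    then show "bfits w scan_cond s' \<and> bval scan_cond s' \<and> fits w recolor_body s' \<and>
      ?I (Suc p) (result recolor_body s')"
      using fit rp rpc by blast
  next
    fix s' :: store
    assume f: "frame recolor_body s1 s'" and I: "?I B s'"
    have f': "reg s' ''b'' = B" using f s by (simp add: frame_def recolor_body_def s1)
    \<comment> \<open>Entries of colors that do not occur in the component were never reset, but
      their parity is already 0; so \<open>pc\<close> is clear again after \<open>B - a\<close>
      rounds.\<close>
    have "pcount a B c = 0" if "\<not> (\<exists>i\<in>{a..<B}. col (q i) = c)" for c
      using that by (auto simp: pcount_def)
    then have "arr s' ''pc'' = (\<lambda>_. 0)" using I by (auto simp: fun_eq_iff)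
    then show "bfits w scan_cond s' \<and> \<not> bval scan_cond s' \<and> arr s' ''pc'' = (\<lambda>_. 0) \<and>
      (\<forall>i<n. arr s' ''t'' (q i) = (if a \<le> i \<and> i < B then swap x y (col (q i)) else arr s ''t'' (q i)))"
      using I f' B kw by (simp add: scan_cond_def)
  qed (use s B in \<open>simp_all add: s1\<close>)
qed simp

end

context colored
begin

text \<open>The fixed costs of a component, 200 included, are charged to each of its vertices, which
  is enough since a component is nonempty. The bound in \<open>comp_body\<close> leaves
  \<open>bcost comp_cond + 1\<close> of this budget for the test of the outer loop.\<close>

definition vertex_cost :: nat where
  "vertex_cost = (cost count_body + bcost count_cond + 1) +
     (cost first_even_body + bcost first_even_cond + cost partner_body + bcost scan_cond + 2) +
     (cost recolor_body + bcost scan_cond + 1) +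
     (bcost count_cond + bcost first_even_cond + 2 * bcost scan_cond + bcost comp_cond + 200)"

lemma comp_body:
  assumes s: "static s" "reg s ''a'' = a" "arr s ''pc'' = (\<lambda>_. 0)"
    and B: "a < B" "B \<le> n" "\<And>i. i < n \<Longrightarrow> root (q i) = root (q a) \<longleftrightarrow> a \<le> i \<and> i < B"
  shows "run w comp_body s ((B - a) * vertex_cost - bcost comp_cond - 1)
    (\<lambda>s'. reg s' ''a'' = B \<and> arr s' ''pc'' = (\<lambda>_. 0) \<and>
       (\<exists>x y. good_swap a B x y \<and>
         (\<forall>i<n. arr s' ''t'' (q i) = (if a \<le> i \<and> i < B then swap x y (col (q i)) else arr s ''t'' (q i)))) \<and>
       reg s' ''bd'' = (if \<forall>c<k. odd (pcount a B c) then 1 else reg s ''bd''))"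
proof -
  let ?Q = "\<lambda>s'. reg s' ''a'' = B \<and> arr s' ''pc'' = (\<lambda>_. 0) \<and>
       (\<exists>x y. good_swap a B x y \<and>
         (\<forall>i<n. arr s' ''t'' (q i) = (if a \<le> i \<and> i < B then swap x y (col (q i)) else arr s ''t'' (q i)))) \<and>
       reg s' ''bd'' = (if \<forall>c<k. odd (pcount a B c) then 1 else reg s ''bd'')"
  define c1 where "c1 = (B - a) * (cost count_body + bcost count_cond + 1) + bcost count_cond + 30"
  define c2 where "c2 = (B - a) * (cost first_even_body + bcost first_even_cond + cost partner_body + bcost scan_cond + 2)
     + bcost first_even_cond + bcost scan_cond + 60"
  define c3 where "c3 = (B - a) * (cost recolor_body + bcost scan_cond + 1) + bcost scan_cond + 10"
  have kw: "k \<le> w" "n \<le> w" "1 \<le> w" "Suc n \<le> w" using w' kn by simp_all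
  have full: "(\<forall>c<k. odd (pcount a B c)) \<longleftrightarrow> card (oddcols a B) = k"
  proof
    assume "\<forall>c<k. odd (pcount a B c)"
    then have "oddcols a B = {..<k}" by (auto simp: oddcols_def)
    then show "card (oddcols a B) = k" by simp
  next
    assume "card (oddcols a B) = k"
    then have "oddcols a B = {..<k}" by (intro card_subset_eq) (auto simp: oddcols_def)
    then show "\<forall>c<k. odd (pcount a B c)" by (auto simp: oddcols_def)
  qed
  obtain D where D: "B - a = Suc D" using B by (cases "B - a") auto
  have total: "c1 + (20 + (c2 + (c3 + 10 + 1) + 1) + 1) + 1 \<le> (B - a) * vertex_cost - bcost comp_cond - 1"
    unfolding vertex_cost_def c1_def c2_def c3_def D by (simp add: algebra_simps)
  show ?thesis unfolding comp_body_def
  proof (rule run_Seq)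
    show "run w count_prog s c1 (\<lambda>s'. reg s' ''b'' = B \<and> reg s' ''no'' = card (oddcols a B) \<and>
       reg s' ''sm'' = (\<Sum>i\<in>{a..<B}. col (q i)) mod 2 \<and> (\<forall>c. arr s' ''pc'' c = pcount a B c mod 2))"
      unfolding c1_def by (rule count_prog[OF s B])
    fix s1 assume f1: "frame count_prog s s1" and s1: "reg s1 ''b'' = B \<and> reg s1 ''no'' = card (oddcols a B) \<and>
       reg s1 ''sm'' = (\<Sum>i\<in>{a..<B}. col (q i)) mod 2 \<and> (\<forall>c. arr s1 ''pc'' c = pcount a B c mod 2)"
    have st1: "static s1" by (rule static_frame[OF s(1) f1]) (simp_all add: count_prog_def count_body_def)
    have a1: "reg s1 ''a'' = a" "reg s1 ''bd'' = reg s ''bd''" "arr s1 ''t'' = arr s ''t''"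
      using f1 s by (simp_all add: frame_def count_prog_def count_body_def)
    let ?p = "If (Eq (Reg ''no'') (Reg ''k'')) (''bd'' ::= Const 1) Skip"
    show "run w (?p ;; choose_prog ;; recolor_prog ;; ''a'' ::= Reg ''b'') s1 (20 + (c2 + (c3 + 10 + 1) + 1) + 1)
      ?Q"
    proof (rule run_Seq)
      show "run w ?p s1 20 (\<lambda>s'. s' = result ?p s1)"
        by (rule run_loop_free) (use s1 st1 kw card_oddcols[of a B] in \<open>simp_all add: static_def\<close>)
      fix s2 assume f2: "frame ?p s1 s2" and s2: "s2 = result ?p s1"
      have st2: "static s2" by (rule static_frame[OF st1 f2]) simp_all
      have a2: "reg s2 ''a'' = a" "reg s2 ''b'' = B" "arr s2 ''pc'' = (\<lambda>c. pcount a B c mod 2)"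
          "reg s2 ''no'' = card (oddcols a B)" "reg s2 ''sm'' = (\<Sum>i\<in>{a..<B}. col (q i)) mod 2"
          "arr s2 ''t'' = arr s ''t''"
        using f2 s1 a1 by (simp_all add: frame_def fun_eq_iff)
      have bd2: "reg s2 ''bd'' = (if \<forall>c<k. odd (pcount a B c) then 1 else reg s ''bd'')"
        unfolding full s2 using s1 st1 a1 by (simp add: static_def)
      show "run w (choose_prog ;; recolor_prog ;; ''a'' ::= Reg ''b'') s2 (c2 + (c3 + 10 + 1) + 1)
      ?Q"
      proof (rule run_Seq)
        show "run w choose_prog s2 c2 (\<lambda>s'. good_swap a B (reg s' ''x'') (reg s' ''y''))"
          unfolding c2_def by (rule choose_prog[OF st2 a2(1-5) B(1,2)])
        fix s3 assume f3: "frame choose_prog s2 s3" and s3: "good_swap a B (reg s3 ''x'') (reg s3 ''y'')"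
        note cdefs = choose_prog_def find_prog_def first_even_body_def partner_body_def
        have st3: "static s3" by (rule static_frame[OF st2 f3]) (simp_all add: cdefs)
        have a3: "reg s3 ''a'' = a" "reg s3 ''b'' = B" "arr s3 ''pc'' = (\<lambda>c. pcount a B c mod 2)"
            "reg s3 ''bd'' = reg s2 ''bd''" "arr s3 ''t'' = arr s ''t''"
          using f3 a2 by (simp_all add: frame_def cdefs)
        show "run w (recolor_prog ;; ''a'' ::= Reg ''b'') s3 (c3 + 10 + 1)
          ?Q"
        proof (rule run_Seq)
          show "run w recolor_prog s3 c3 (\<lambda>s'. arr s' ''pc'' = (\<lambda>_. 0) \<and>
             (\<forall>i<n. arr s' ''t'' (q i) = (if a \<le> i \<and> i < B then swap (reg s3 ''x'') (reg s3 ''y'') (col (q i)) else arr s3 ''t'' (q i))))"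
            unfolding c3_def by (rule recolor_prog[OF st3 a3(1-3)]) (use s3 B in \<open>simp_all add: good_swap_def\<close>)
          fix s4 assume f4: "frame recolor_prog s3 s4" and s4: "arr s4 ''pc'' = (\<lambda>_. 0) \<and>
             (\<forall>i<n. arr s4 ''t'' (q i) = (if a \<le> i \<and> i < B then swap (reg s3 ''x'') (reg s3 ''y'') (col (q i)) else arr s3 ''t'' (q i)))"
          have a4: "reg s4 ''b'' = B" "reg s4 ''bd'' = reg s2 ''bd''"
            using f4 a3 by (simp_all add: frame_def recolor_prog_def recolor_body_def)
          have ex: "\<exists>x y. good_swap a B x y \<and>
             (\<forall>i<n. arr s4 ''t'' (q i) = (if a \<le> i \<and> i < B then swap x y (col (q i)) else arr s ''t'' (q i)))"
            using s3 s4 a3(5) by (intro exI[of _ "reg s3 ''x''"] exI[of _ "reg s3 ''y''"]) simp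
          show "run w (''a'' ::= Reg ''b'') s4 10
           ?Q"
            unfolding bd2[symmetric]
            by (rule run_loop_free) (use a4 s4 ex B kw in simp_all)
        qed simp
      qed simp
    qed simp
  qed (rule total)
qed

lemma interval_reindex:
  assumes "B \<le> n" "\<And>i. i < n \<Longrightarrow> root (q i) = \<rho> \<longleftrightarrow> a \<le> i \<and> i < B"
  shows "bij_betw q {a..<B} {v. v < n \<and> root v = \<rho>}"
  unfolding bij_betw_def
proof
  show "inj_on q {a..<B}" using assms(1) by (intro inj_onI) (auto simp: q_eq_iff)
  show "q ` {a..<B} = {v. v < n \<and> root v = \<rho>}"
  proof (intro set_eqI iffI)
    fix v assume "v \<in> {v. v < n \<and> root v = \<rho>}"
    then have v: "v < n" "root v = \<rho>" by simp_all
    obtain i where "i < n" "v = q i" using q_surj[OF v(1)] .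
    then show "v \<in> q ` {a..<B}" using assms(2)[of i] v(2) by auto
  next
    fix v assume "v \<in> q ` {a..<B}"
    then obtain i where "a \<le> i" "i < B" "v = q i" by auto
    then show "v \<in> {v. v < n \<and> root v = \<rho>}" using assms(1) assms(2)[of i] by simp
  qed
qed

lemma full_pcount:
  assumes "B \<le> n" "\<And>i. i < n \<Longrightarrow> root (q i) = \<rho> \<longleftrightarrow> a \<le> i \<and> i < B"
  shows "full \<rho> \<longleftrightarrow> (\<forall>c<k. odd (pcount a B c))"
proof -
  have "pcount a B c = card {v. v < n \<and> root v = \<rho> \<and> col v = c}" for c
  proof -
    note b = interval_reindex[OF assms]
    have "bij_betw q {i\<in>{a..<B}. col (q i) = c} {v\<in>{v. v < n \<and> root v = \<rho>}. col v = c}"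
    proof (rule bij_betw_subset[OF b])
      show "q ` {i\<in>{a..<B}. col (q i) = c} = {v\<in>{v. v < n \<and> root v = \<rho>}. col v = c}"
        by (subst bij_betw_imp_surj_on[OF b, symmetric]) auto
    qed auto
    then show ?thesis unfolding pcount_def by (simp add: bij_betw_same_card conj_assoc)
  qed
  then show ?thesis by (simp add: full_def)
qed

lemma settled_good_swap:
  assumes "B \<le> n" "\<And>i. i < n \<Longrightarrow> root (q i) = \<rho> \<longleftrightarrow> a \<le> i \<and> i < B"
    and "good_swap a B x y" "\<And>i. a \<le> i \<Longrightarrow> i < B \<Longrightarrow> t (q i) = swap x y (col (q i))"
  shows "settled t \<rho>"
proof -
  note b = interval_reindex[OF assms(1,2)]
  have t: "t v = swap x y (col v)" if "v < n" "root v = \<rho>" for v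
  proof -
    obtain i where "i < n" "v = q i" using q_surj \<open>v < n\<close> by blast
    then show ?thesis using that assms(2,4) by auto
  qed
  have "(\<Sum>v | v < n \<and> root v = \<rho>. t v) = (\<Sum>i\<in>{a..<B}. t (q i))"
    using sum.reindex_bij_betw[OF b, of t] by simp
  also have "\<dots> = (\<Sum>i\<in>{a..<B}. swap x y (col (q i)))" using assms(4) by simp
  finally have 1: "(\<Sum>v | v < n \<and> root v = \<rho>. t v) = (\<Sum>i\<in>{a..<B}. swap x y (col (q i)))" .
  have 2: "(\<Sum>v | v < n \<and> root v = \<rho>. col v) = (\<Sum>i\<in>{a..<B}. col (q i))"
    using sum.reindex_bij_betw[OF b, of col] by simp
  show ?thesis unfolding settled_def 1 2 using assms(3) t full_pcount[OF assms(1,2)] by (auto simp: good_swap_def)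
qed

lemma settled_cong:
  assumes "settled t \<rho>" "\<And>v. v < n \<Longrightarrow> root v = \<rho> \<Longrightarrow> t' v = t v"
  shows "settled t' \<rho>"
proof -
  have "(\<Sum>v | v < n \<and> root v = \<rho>. t' v) = (\<Sum>v | v < n \<and> root v = \<rho>. t v)"
    by (intro sum.cong) (use assms(2) in auto)
  then show ?thesis using assms by (auto simp: settled_def)
qed

text \<open>The potential counts the vertices not yet treated, so the total is linear however the
  vertices are spread over components. The invariant that positions before and after
  \<open>a\<close> have different roots says that \<open>a\<close> is a boundary between
  components.\<close>

lemma comp_prog:
  assumes s: "static s" "reg s ''a'' = 0" "arr s ''pc'' = (\<lambda>_. 0)" "reg s ''bd'' = 0"
  shows "run w comp_prog s (n * vertex_cost + bcost comp_cond + 1)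
    (\<lambda>s'. (\<forall>v<n. settled (arr s' ''t'') (root v)) \<and> reg s' ''bd'' \<le> 1 \<and> (reg s' ''bd'' = 1 \<longleftrightarrow> (\<exists>v<n. full (root v))))"
  unfolding comp_prog_def
proof (rule run_While[where \<Phi> = "\<lambda>s. (n - reg s ''a'') * vertex_cost" and
      I = "\<lambda>s. reg s ''a'' \<le> n \<and> arr s ''pc'' = (\<lambda>_. 0) \<and>
        (\<forall>i<reg s ''a''. \<forall>j<n. reg s ''a'' \<le> j \<longrightarrow> root (q i) \<noteq> root (q j)) \<and>
        (\<forall>i<reg s ''a''. settled (arr s ''t'') (root (q i))) \<and> reg s ''bd'' \<le> 1 \<and>
        (reg s ''bd'' = 1 \<longleftrightarrow> (\<exists>i<reg s ''a''. full (root (q i))))"], goal_cases)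
  case 1
  show ?case using s by simp
next
  case (2 s')
  have "reg s' ''n'' = n" using 2 s
    by (simp add: frame_def static_def comp_body_def count_prog_def count_body_def choose_prog_def
        find_prog_def first_even_body_def partner_body_def recolor_prog_def recolor_body_def)
  then show ?case using 2 w' by (simp add: comp_cond_def)
next
  case (3 s')
  have st: "static s'"
    by (rule static_frame[OF s(1) 3(1)])
     (simp_all add: comp_body_def count_prog_def count_body_def choose_prog_def
        find_prog_def first_even_body_def partner_body_def recolor_prog_def recolor_body_def)
  define a where "a = reg s' ''a''"
  have an: "a < n" using 3(3) st by (simp add: comp_cond_def static_def a_def)
  have sep: "\<And>i j. i < a \<Longrightarrow> j < n \<Longrightarrow> a \<le> j \<Longrightarrow> root (q i) \<noteq> root (q j)" using 3(2) by (simp add: a_def)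
  obtain B where B: "a < B" "B \<le> n" "\<And>i. i < n \<Longrightarrow> root (q i) = root (q a) \<longleftrightarrow> a \<le> i \<and> i < B"
    using component_interval[OF an] sep[of _ a] an by blast
  let ?T = "(B - a) * vertex_cost - bcost comp_cond - 1"
  have "bcost comp_cond + 1 \<le> 1 * vertex_cost" by (simp add: vertex_cost_def)
  also have "\<dots> \<le> (B - a) * vertex_cost" using B by (intro mult_right_mono) auto
  finally have T: "?T + bcost comp_cond + 1 = (B - a) * vertex_cost" by simp
  have nB: "(n - B) * vertex_cost + (B - a) * vertex_cost = (n - a) * vertex_cost"
    using B by (simp flip: add_mult_distrib)
  have pc: "arr s' ''pc'' = (\<lambda>_. 0)" using 3(2) by simp
  note ih = 3(2)
  show ?case
  proof (intro exI[of _ ?T], rule run_mono[OF comp_body[OF st a_def[symmetric] pc B]], goal_cases)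
    case (3 s'')
    then obtain x y where xy: "good_swap a B x y" and
      t: "\<And>i. i < n \<Longrightarrow> arr s'' ''t'' (q i) = (if a \<le> i \<and> i < B then swap x y (col (q i)) else arr s' ''t'' (q i))"
      by blast
    have a'': "reg s'' ''a'' = B" "arr s'' ''pc'' = (\<lambda>_. 0)" using 3 by simp_all
    have bd: "reg s'' ''bd'' = (if full (root (q a)) then 1 else reg s' ''bd'')"
      using 3 full_pcount[OF B(2,3)] by simp
    have new: "settled (arr s'' ''t'') (root (q a))"
      by (rule settled_good_swap[OF B(2,3) xy]) (use t B in auto)
    have old: "settled (arr s'' ''t'') (root (q i))" if "i < a" for i
    proof (rule settled_cong)
      show "settled (arr s' ''t'') (root (q i))" using ih that by (simp add: a_def)
      fix v assume v: "v < n" "root v = root (q i)"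
      obtain j where j: "j < n" "v = q j" using q_surj v(1) by blast
      have "root (q i) \<noteq> root (q a)" using sep[of i a] that an by simp
      then have "\<not> (a \<le> j \<and> j < B)" using B(3)[OF j(1)] v j by auto
      then show "arr s'' ''t'' v = arr s' ''t'' v" using t[OF j(1)] j by auto
    qed
    have cases: "i < a \<or> root (q i) = root (q a)" if "i < B" for i using B that by (cases "i < a") auto
    have set: "settled (arr s'' ''t'') (root (q i))" if "i < B" for i using cases[OF that] old new by auto
    have fl: "(\<exists>i<B. full (root (q i))) \<longleftrightarrow> (\<exists>i<a. full (root (q i))) \<or> full (root (q a))"
      using cases B(1) by (metis less_trans)
    have sep': "root (q i) \<noteq> root (q j)" if "i < B" "j < n" "B \<le> j" for i j
      using cases[OF that(1)] sep[of i j] B(3)[of j] B(1) that by auto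
    show ?case using a'' bd set fl sep' B(2) T nB ih by (auto simp: a_def[symmetric])
  qed simp_all
next
  case (4 s')
  have "reg s' ''n'' = n" using 4(1) s
    by (simp add: frame_def static_def comp_body_def count_prog_def count_body_def choose_prog_def
        find_prog_def first_even_body_def partner_body_def recolor_prog_def recolor_body_def)
  then have "reg s' ''a'' = n" using 4 by (simp add: comp_cond_def)
  moreover have "(\<exists>v<n. full (root v)) \<longleftrightarrow> (\<exists>i<n. full (root (q i)))"
    using q_surj q_less by metis
  moreover have "settled (arr s' ''t'') (root v)" if "v < n" and st: "\<forall>i<n. settled (arr s' ''t'') (root (q i))" for v
    using q_surj[OF that(1)] st by metis
  ultimately show ?case using 4(2) by simp
next
  case 5
  show ?case using s by simp
qed

end

section \<open>Target colors and edge labels\<close>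

text \<open>Remainders modulo 4 are found by repeated subtraction; the \<open>k div 4\<close> rounds
  are affordable because \<open>k \<le> n\<close>.\<close>

definition mod4_body :: com where
  "mod4_body = (''x'' ::= Sub (Reg ''x'') (Const 4))"

definition mod4_cond :: bexp where
  "mod4_cond = Less (Const 3) (Reg ''x'')"

definition modulus_prog :: com where
  "modulus_prog =
     ''x'' ::= Reg ''k'' ;;
     While mod4_cond mod4_body ;;
     If (Conj (Eq (Reg ''x'') (Const 2)) (Eq (Reg ''bd'') (Const 1))) (''r'' ::= Add (Reg ''k'') (Const 1)) (''r'' ::= Reg ''k'')"

text \<open>
  The machine cannot halve numbers, so the solutions \<open>x\<close> of \<open>2 x = d\<close> modulo \<open>r\<close> are tabulated.
\<close>

definition half_body :: com where
  "half_body =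
     ''x'' ::= Add (Reg ''i'') (Reg ''i'') ;;
     If (Less (Reg ''x'') (Reg ''r'')) Skip (''x'' ::= Sub (Reg ''x'') (Reg ''r'')) ;;
     Store ''hf'' (Reg ''x'') (Reg ''i'')"

definition half_prog :: com where
  "half_prog = For ''i'' ''r'' half_body"

text \<open>
  \<open>oe\<close> maps a root to an edge \<open>e\<close> inside a level of its component, stored as \<open>e + 1\<close>, and to \<open>0\<close> if there is none.
\<close>

definition odd_edge_body :: com where
  "odd_edge_body =
     ''u'' ::= Arr ''fst'' (Reg ''i'') ;;
     If (Eq (Arr ''dp'' (Reg ''u'')) (Arr ''dp'' (Arr ''snd'' (Reg ''i''))))
       (Store ''oe'' (Arr ''root'' (Reg ''u'')) (Add (Reg ''i'') (Const 1))) Skip"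

definition odd_edge_prog :: com where
  "odd_edge_prog = For ''i'' ''m'' odd_edge_body"

definition even_level_body :: com where
  "even_level_body =
     If (Eq (Arr ''dp'' (Reg ''i'')) (Const 0))
       (''x'' ::= Arr ''root'' (Reg ''i'') ;; Store ''c0'' (Reg ''x'') (Add (Arr ''c0'' (Reg ''x'')) (Const 1))) Skip"

definition even_level_prog :: com where
  "even_level_prog = For ''i'' ''n'' even_level_body"

definition side_body :: com where
  "side_body =
     ''x'' ::= Arr ''root'' (Reg ''i'') ;;
     If (Less (Const 1) (Arr ''c0'' (Reg ''x''))) (''y'' ::= Sub (Const 1) (Arr ''dp'' (Reg ''i''))) (''y'' ::= Arr ''dp'' (Reg ''i'')) ;;
     Store ''sl'' (Reg ''i'') (Reg ''y'') ;;
     Store ''rm'' (Reg ''x'') (Add (Arr ''rm'' (Reg ''x'')) (Reg ''y''))"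

definition side_prog :: com where
  "side_prog = For ''i'' ''n'' side_body"

text \<open>
  Distributes nonzero colors with sum zero modulo \<open>r\<close> over the vertices of the chosen side of a component: \<open>rm\<close> of
  them are still to come and \<open>ac\<close> is the sum so far. All get \<open>1\<close> except the last, which gets \<open>r - ac\<close>, and the
  last but one, which gets \<open>2\<close> if \<open>1\<close> would leave zero for the last.
\<close>

definition balance_body :: com where
  "balance_body =
     ''x'' ::= Arr ''root'' (Reg ''i'') ;;
     If (Conj (Less (Const 2) (Reg ''r'')) (Eq (Arr ''oe'' (Reg ''x'')) (Const 0)))
       (If (Eq (Arr ''sl'' (Reg ''i'')) (Const 0))
          (Store ''t'' (Reg ''i'') (Const 0))
          (If (Eq (Arr ''rm'' (Reg ''x'')) (Const 1))
             (''y'' ::= Sub (Reg ''r'') (Arr ''ac'' (Reg ''x'')))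
             (If (Conj (Eq (Arr ''rm'' (Reg ''x'')) (Const 2)) (Eq (Add (Arr ''ac'' (Reg ''x'')) (Const 1)) (Reg ''r'')))
                (''y'' ::= Const 2) (''y'' ::= Const 1)) ;;
           ''z'' ::= Add (Arr ''ac'' (Reg ''x'')) (Reg ''y'') ;;
           If (Less (Reg ''z'') (Reg ''r'')) Skip (''z'' ::= Sub (Reg ''z'') (Reg ''r'')) ;;
           Store ''ac'' (Reg ''x'') (Reg ''z'') ;;
           Store ''rm'' (Reg ''x'') (Sub (Arr ''rm'' (Reg ''x'')) (Const 1)) ;;
           Store ''t'' (Reg ''i'') (Reg ''y'')))
       Skip"

definition balance_prog :: com where
  "balance_prog = For ''i'' ''n'' balance_body"

text \<open>\<open>df\<close> collects the alternating sum \<open>d\<close> of the targets modulo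
  \<open>r\<close>. On odd levels \<open>r - t\<close> is added, since machine subtraction
  truncates.\<close>

definition defect_body :: com where
  "defect_body =
     ''x'' ::= Arr ''root'' (Reg ''i'') ;;
     If (Eq (Arr ''dp'' (Reg ''i'')) (Const 0)) (''y'' ::= Arr ''t'' (Reg ''i'')) (''y'' ::= Sub (Reg ''r'') (Arr ''t'' (Reg ''i''))) ;;
     ''z'' ::= Add (Arr ''df'' (Reg ''x'')) (Reg ''y'') ;;
     If (Less (Reg ''z'') (Reg ''r'')) Skip (''z'' ::= Sub (Reg ''z'') (Reg ''r'')) ;;
     Store ''df'' (Reg ''x'') (Reg ''z'')"

definition defect_prog :: com where
  "defect_prog = For ''i'' ''n'' defect_body"

text \<open>On an odd level the label enters the alternating sum with sign -1, so half of
  \<open>d\<close> is negated there. The negation \<open>r - y\<close> is used only for positive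
  \<open>y\<close> because \<open>r\<close> itself is not a residue.\<close>

definition odd_label_body :: com where
  "odd_label_body =
     ''u'' ::= Arr ''fst'' (Reg ''i'') ;;
     ''x'' ::= Arr ''root'' (Reg ''u'') ;;
     If (Eq (Arr ''oe'' (Reg ''x'')) (Add (Reg ''i'') (Const 1)))
       (''y'' ::= Arr ''hf'' (Arr ''df'' (Reg ''x'')) ;;
        If (Conj (Eq (Arr ''dp'' (Reg ''u'')) (Const 1)) (Less (Const 0) (Reg ''y'')))
          (''y'' ::= Sub (Reg ''r'') (Reg ''y'')) Skip ;;
        Store ''s'' (Reg ''i'') (Reg ''y''))
       Skip"

definition odd_label_prog :: com where
  "odd_label_prog = For ''i'' ''m'' odd_label_body"

text \<open>At this stage only the chosen edges inside levels can carry nonzero labels;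
  \<open>as\<close> starts the tree pass with their contributions.\<close>

definition incidence_body :: com where
  "incidence_body =
     ''y'' ::= Arr ''s'' (Reg ''i'') ;;
     ''u'' ::= Arr ''fst'' (Reg ''i'') ;;
     ''z'' ::= Add (Arr ''as'' (Reg ''u'')) (Reg ''y'') ;;
     If (Less (Reg ''z'') (Reg ''r'')) Skip (''z'' ::= Sub (Reg ''z'') (Reg ''r'')) ;;
     Store ''as'' (Reg ''u'') (Reg ''z'') ;;
     ''u'' ::= Arr ''snd'' (Reg ''i'') ;;
     ''z'' ::= Add (Arr ''as'' (Reg ''u'')) (Reg ''y'') ;;
     If (Less (Reg ''z'') (Reg ''r'')) Skip (''z'' ::= Sub (Reg ''z'') (Reg ''r'')) ;;
     Store ''as'' (Reg ''u'') (Reg ''z'')"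

definition incidence_prog :: com where
  "incidence_prog = For ''i'' ''m'' incidence_body"

text \<open>Parents precede children in the queue, so running backwards reaches a vertex after all
  tree edges to its children are labelled. The edge to its parent then gets the missing amount
  \<open>t - as\<close> modulo \<open>r\<close>.\<close>

definition tree_body :: com where
  "tree_body =
     ''i'' ::= Sub (Reg ''i'') (Const 1) ;;
     ''v'' ::= Arr ''q'' (Reg ''i'') ;;
     If (Eq (Arr ''root'' (Reg ''v'')) (Reg ''v'')) Skip
       (''u'' ::= Arr ''pr'' (Reg ''v'') ;;
        ''y'' ::= Add (Arr ''t'' (Reg ''v'')) (Sub (Reg ''r'') (Arr ''as'' (Reg ''v''))) ;;
        If (Less (Reg ''y'') (Reg ''r'')) Skip (''y'' ::= Sub (Reg ''y'') (Reg ''r'')) ;;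
        Store ''s'' (Arr ''pe'' (Reg ''v'')) (Reg ''y'') ;;
        ''z'' ::= Add (Arr ''as'' (Reg ''u'')) (Reg ''y'') ;;
        If (Less (Reg ''z'') (Reg ''r'')) Skip (''z'' ::= Sub (Reg ''z'') (Reg ''r'')) ;;
        Store ''as'' (Reg ''u'') (Reg ''z''))"

definition tree_cond :: bexp where
  "tree_cond = Less (Const 0) (Reg ''i'')"

definition tree_prog :: com where
  "tree_prog = ''i'' ::= Reg ''n'' ;; While tree_cond tree_body"

lemma add_mod_step: "x < r \<Longrightarrow> y \<le> r \<Longrightarrow> (if x + y < r then x + y else x + y - r) = (x + y) mod r" for x y r :: nat
  by (auto simp: mod_if)

section \<open>The number of colors and the table of halves\<close>

context input
begin

lemma w'': "4 * n + 2 * m + 10 \<le> w"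
  using n2 w by simp

lemma modulus_prog:
  assumes s: "reg s ''k'' = k" "k \<le> n" "reg s ''bd'' \<le> 1"
  shows "run w modulus_prog s (k * (cost mod4_body + bcost mod4_cond + 1) + 60)
     (\<lambda>s'. reg s' ''r'' = (if k mod 4 = 2 \<and> reg s ''bd'' = 1 then k + 1 else k))"
  unfolding modulus_prog_def
proof (rule run_Seq[where P = "\<lambda>s'. s' = result (''x'' ::= Reg ''k'') s" and Tp = 2])
  show "run w (''x'' ::= Reg ''k'') s 2 (\<lambda>s'. s' = result (''x'' ::= Reg ''k'') s)"
    by (rule run_loop_free) (use s w' in simp_all)
  fix s1 assume s1: "s1 = result (''x'' ::= Reg ''k'') s"
  let ?c = "k div 4 * (cost mod4_body + bcost mod4_cond + 1) + bcost mod4_cond + 1"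
  let ?p = "If (Conj (Eq (Reg ''x'') (Const 2)) (Eq (Reg ''bd'') (Const 1))) (''r'' ::= Add (Reg ''k'') (Const 1)) (''r'' ::= Reg ''k'')"
  show "run w (While mod4_cond mod4_body ;; ?p) s1 (?c + 30 + 1)
     (\<lambda>s'. reg s' ''r'' = (if k mod 4 = 2 \<and> reg s ''bd'' = 1 then k + 1 else k))"
  proof (rule run_Seq[where P = "\<lambda>s'. reg s' ''x'' = k mod 4"])
    show "run w (While mod4_cond mod4_body) s1 ?c (\<lambda>s'. reg s' ''x'' = k mod 4)"
    proof (rule run_iterate[where a = 0 and B = "k div 4" and J = "\<lambda>i s'. reg s' ''x'' = k - 4 * i"])
      fix i and s' :: store
      assume i: "i < k div 4" and x: "reg s' ''x'' = k - 4 * i"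
      have "3 < k - 4 * i" "k - 4 * i \<le> w" using i s(2) w' by simp_all
      then show "bfits w mod4_cond s' \<and> bval mod4_cond s' \<and> fits w mod4_body s' \<and>
          reg (result mod4_body s') ''x'' = k - 4 * Suc i"
        using x w' by (simp add: mod4_cond_def mod4_body_def add.commute)
    next
      fix s' :: store assume "reg s' ''x'' = k - 4 * (k div 4)"
      then have "reg s' ''x'' = k mod 4" by (simp add: minus_mult_div_eq_mod)
      moreover have "k mod 4 \<le> 3" "k mod 4 \<le> w" using s w' by (presburger, simp add: le_trans[OF mod_less_eq_dividend])
      ultimately show "bfits w mod4_cond s' \<and> \<not> bval mod4_cond s' \<and> reg s' ''x'' = k mod 4"
        using s w' by (simp add: mod4_cond_def)
    qed (simp_all add: s1 s mod4_body_def)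
    fix s2 assume f2: "frame (While mod4_cond mod4_body) s1 s2" and x: "reg s2 ''x'' = k mod 4"
    have "reg s2 ''k'' = k" "reg s2 ''bd'' = reg s ''bd''"
      using f2 s by (simp_all add: frame_def mod4_body_def s1)
    moreover have "k mod 4 \<le> w" using s w' by (simp add: le_trans[OF mod_less_eq_dividend])
    ultimately show "run w ?p s2 30 (\<lambda>s'. reg s' ''r'' = (if k mod 4 = 2 \<and> reg s ''bd'' = 1 then k + 1 else k))"
      using x s w' by (intro run_loop_free) simp_all
  qed simp
next
  have "k div 4 * (cost mod4_body + bcost mod4_cond + 1) \<le> k * (cost mod4_body + bcost mod4_cond + 1)"
    by (intro mult_right_mono) auto
  then show "2 + (k div 4 * (cost mod4_body + bcost mod4_cond + 1) + bcost mod4_cond + 1 + 30 + 1) + 1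
      \<le> k * (cost mod4_body + bcost mod4_cond + 1) + 60" by (simp add: mod4_cond_def)
qed

text \<open>For even \<open>r\<close> two numbers have the same double and the later one overwrites
  the entry. Hence the claim is only that an entry at a double holds some half of it.\<close>

lemma half_prog:
  assumes s: "reg s ''r'' = r" "r \<le> n + 1" "0 < r"
  shows "run w half_prog s (r * (cost half_body + 10) + 10)
     (\<lambda>s'. \<forall>j<r. arr s' ''hf'' (2 * j mod r) < r \<and> 2 * arr s' ''hf'' (2 * j mod r) mod r = 2 * j mod r)"
proof -
  let ?I = "\<lambda>i s'. \<forall>j<i. arr s' ''hf'' (2 * j mod r) < r \<and>
      2 * arr s' ''hf'' (2 * j mod r) mod r = 2 * j mod r"
  show ?thesis unfolding half_prog_def
  proof (rule run_For[where N = r and I = ?I])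
    fix i and s' :: store
    assume fr: "frame (For ''i'' ''r'' half_body) s s'" and i: "i < r" and ri: "reg s' ''i'' = i"
      and I: "?I i s'"
    have c: "reg s' ''r'' = r" using fr s by (simp add: frame_def half_body_def)
    have x: "(if i + i < r then i + i else i + i - r) = 2 * i mod r"
      using add_mod_step[of i r i] i by (simp add: mult_2)
    have res: "arr (result half_body s') ''hf'' = (arr s' ''hf'')(2 * i mod r := i)"
      unfolding x[symmetric] by (simp add: half_body_def ri c)
    show "run w half_body s' (cost half_body) (\<lambda>s'. ?I (Suc i) (set_reg ''i'' (Suc i) s'))"
    proof (rule run_loop_free)
      have "i \<le> w" "i + i \<le> w" "i + i - r \<le> w" "r \<le> w" using i s(2) w'' by linarith+
      then show "fits w half_body s'" by (simp add: half_body_def ri c)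
      show "?I (Suc i) (set_reg ''i'' (Suc i) (result half_body s'))"
        using I i by (auto simp: res less_Suc_eq)
    qed (simp_all add: half_body_def)
  qed (use s w' in \<open>simp_all add: half_body_def\<close>)
qed

end

section \<open>Levels, target colors, defects and labels inside levels\<close>

context forested
begin

definition graph_state :: "store \<Rightarrow> bool" where
  "graph_state s \<longleftrightarrow> reg s ''n'' = n \<and> reg s ''m'' = m \<and> arr s ''fst'' = U \<and> arr s ''snd'' = W \<and> arr s ''q'' = q \<and>
     arr s ''root'' = root \<and> arr s ''dp'' = dp \<and> arr s ''pr'' = pr \<and> arr s ''pe'' = pe"

lemma graph_state_frame:
  "graph_state s \<Longrightarrow> frame p s s' \<Longrightarrow> {''n'', ''m''} \<inter> mod_regs p = {} \<Longrightarrow>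
   {''fst'', ''snd'', ''q'', ''root'', ''dp'', ''pr'', ''pe''} \<inter> mod_arrs p = {} \<Longrightarrow> graph_state s'"
  by (simp add: graph_state_def frame_def)

lemma dp_w [simp]: "dp v \<le> w"
  using dp_le[of v] w' by linarith

lemma dp_cases: "dp v = 0 \<or> dp v = Suc 0"
  using dp_le[of v] by linarith

lemma U_w [simp]: "U i \<le> w" "W i \<le> w"
  using U[of i] W[of i] w' by linarith+

text \<open>Any edge with equal parities at its ends serves; the last one in the input is
  kept.\<close>

lemma odd_edge_prog:
  assumes s: "graph_state s" "arr s ''oe'' = (\<lambda>_. 0)"
  shows "run w odd_edge_prog s (m * (cost odd_edge_body + 10) + 10)
    (\<lambda>s'. \<forall>\<rho>. (arr s' ''oe'' \<rho> = 0 \<longrightarrow> (\<forall>e<m. root (U e) = \<rho> \<longrightarrow> dp (U e) \<noteq> dp (W e))) \<and>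
       (\<forall>e. arr s' ''oe'' \<rho> = Suc e \<longrightarrow> e < m \<and> root (U e) = \<rho> \<and> dp (U e) = dp (W e)))"
proof -
  let ?I = "\<lambda>i s'. \<forall>\<rho>. (arr s' ''oe'' \<rho> = 0 \<longrightarrow> (\<forall>e<i. root (U e) = \<rho> \<longrightarrow> dp (U e) \<noteq> dp (W e))) \<and>
       (\<forall>e. arr s' ''oe'' \<rho> = Suc e \<longrightarrow> e < m \<and> root (U e) = \<rho> \<and> dp (U e) = dp (W e))"
  show ?thesis unfolding odd_edge_prog_def
  proof (rule run_For[where N = m and I = ?I])
    fix i and s' :: store
    assume fr: "frame (For ''i'' ''m'' odd_edge_body) s s'" and i: "i < m" and ri: "reg s' ''i'' = i"
      and I: "?I i s'"
    have g: "graph_state s'" by (rule graph_state_frame[OF s(1) fr]) (simp_all add: odd_edge_body_def)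
    show "run w odd_edge_body s' (cost odd_edge_body) (\<lambda>s'. ?I (Suc i) (set_reg ''i'' (Suc i) s'))"
    proof (rule run_loop_free)
      show "fits w odd_edge_body s'" using g i ri w' U[of i]
        by (simp add: odd_edge_body_def graph_state_def)
      have "arr (result odd_edge_body s') ''oe'' = (if dp (U i) = dp (W i) then (arr s' ''oe'')(root (U i) := Suc i)
          else arr s' ''oe'')"
        using g ri by (simp add: odd_edge_body_def graph_state_def)
      then show "?I (Suc i) (set_reg ''i'' (Suc i) (result odd_edge_body s'))"
        using I i by (auto simp: less_Suc_eq)
    qed (simp_all add: odd_edge_body_def)
  qed (use s w' in \<open>simp_all add: odd_edge_body_def graph_state_def\<close>)
qed

definition evens :: "nat \<Rightarrow> nat" where
  "evens \<rho> = card {v. v < n \<and> root v = \<rho> \<and> dp v = 0}"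

text \<open>The class of the bipartition that receives the nonzero targets: the even levels if they
  contain at least two vertices, otherwise the odd ones. A single vertex there could not be nonzero
  with sum zero; \<open>side_count\<close> shows that this choice avoids it.\<close>

definition side :: "nat \<Rightarrow> bool" where
  "side v \<longleftrightarrow> dp v = (if 1 < evens (root v) then 0 else 1)"

lemma card_less_Suc: "card {v. v < Suc i \<and> P v} = card {v. v < i \<and> P v} + (if P i then 1 else 0)"
proof -
  have "{v. v < Suc i \<and> P v} = (if P i then insert i {v. v < i \<and> P v} else {v. v < i \<and> P v})"
    by (auto simp: less_Suc_eq)
  then show ?thesis by simp
qed

lemma card_less_le: "card {v. v < (i::nat) \<and> P v} \<le> i"
  using card_mono[of "{..<i}" "{v. v < i \<and> P v}"] by auto

lemma even_level_prog:
  assumes s: "graph_state s" "arr s ''c0'' = (\<lambda>_. 0)"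
  shows "run w even_level_prog s (n * (cost even_level_body + 10) + 10) (\<lambda>s'. arr s' ''c0'' = evens)"
proof -
  let ?I = "\<lambda>i s'. \<forall>\<rho>. arr s' ''c0'' \<rho> = card {v. v < i \<and> root v = \<rho> \<and> dp v = 0}"
  show ?thesis unfolding even_level_prog_def
  proof (rule run_For[where N = n and I = ?I])
    fix i and s' :: store
    assume fr: "frame (For ''i'' ''n'' even_level_body) s s'" and i: "i < n" and ri: "reg s' ''i'' = i"
      and I: "?I i s'"
    have g: "graph_state s'" by (rule graph_state_frame[OF s(1) fr]) (simp_all add: even_level_body_def)
    show "run w even_level_body s' (cost even_level_body) (\<lambda>s'. ?I (Suc i) (set_reg ''i'' (Suc i) s'))"
    proof (rule run_loop_free)
      have "card {v. v < i \<and> root v = root i \<and> dp v = 0} \<le> i" by (rule card_less_le)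
      then show "fits w even_level_body s'" using g i ri w' I
        by (simp add: even_level_body_def graph_state_def)
      have "arr (result even_level_body s') ''c0'' = (if dp i = 0 then (arr s' ''c0'')(root i := arr s' ''c0'' (root i) + 1)
          else arr s' ''c0'')"
        using g ri by (simp add: even_level_body_def graph_state_def)
      then show "?I (Suc i) (set_reg ''i'' (Suc i) (result even_level_body s'))"
        using I by (auto simp: card_less_Suc)
    qed (simp_all add: even_level_body_def)
  qed (use s w' in \<open>simp_all add: even_level_body_def graph_state_def evens_def fun_eq_iff\<close>)
qed

lemma side_prog:
  assumes s: "graph_state s" "arr s ''c0'' = evens" "arr s ''rm'' = (\<lambda>_. 0)"
  shows "run w side_prog s (n * (cost side_body + 10) + 10)
    (\<lambda>s'. (\<forall>v<n. arr s' ''sl'' v = (if side v then 1 else 0)) \<and>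
       (\<forall>\<rho>. arr s' ''rm'' \<rho> = card {v. v < n \<and> root v = \<rho> \<and> side v}))"
proof -
  let ?I = "\<lambda>i s'. (\<forall>v<i. arr s' ''sl'' v = (if side v then 1 else 0)) \<and>
       (\<forall>\<rho>. arr s' ''rm'' \<rho> = card {v. v < i \<and> root v = \<rho> \<and> side v})"
  show ?thesis unfolding side_prog_def
  proof (rule run_For[where N = n and I = ?I])
    fix i and s' :: store
    assume fr: "frame (For ''i'' ''n'' side_body) s s'" and i: "i < n" and ri: "reg s' ''i'' = i"
      and I: "?I i s'"
    have g: "graph_state s'" by (rule graph_state_frame[OF s(1) fr]) (simp_all add: side_body_def)
    have c0: "arr s' ''c0'' = evens" using fr s by (simp add: frame_def side_body_def)
    have y: "(if 1 < evens (root i) then 1 - dp i else dp i) = (if side i then 1 else 0)"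
      using dp_cases[of i] by (auto simp: side_def)
    have w1: "card {v. v < i \<and> root v = root i \<and> side v} \<le> i" "evens (root i) \<le> n"
      unfolding evens_def by (rule card_less_le)+
    have res: "arr (result side_body s') ''sl'' = (arr s' ''sl'')(i := if side i then 1 else 0)"
      "arr (result side_body s') ''rm'' = (arr s' ''rm'')(root i := arr s' ''rm'' (root i) + (if side i then 1 else 0))"
      unfolding y[symmetric] using g ri c0 by (simp_all add: side_body_def graph_state_def)
    show "run w side_body s' (cost side_body) (\<lambda>s'. ?I (Suc i) (set_reg ''i'' (Suc i) s'))"
    proof (rule run_loop_free)
      show "fits w side_body s'" using g i ri c0 w' w1 I
        by (rule_tac disjE[OF dp_cases[of i]]) (simp_all add: side_body_def graph_state_def)
      show "?I (Suc i) (set_reg ''i'' (Suc i) (result side_body s'))"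
      proof
        show "\<forall>v<Suc i. arr (set_reg ''i'' (Suc i) (result side_body s')) ''sl'' v = (if side v then 1 else 0)"
          using I by (auto simp: res less_Suc_eq)
        show "\<forall>\<rho>. arr (set_reg ''i'' (Suc i) (result side_body s')) ''rm'' \<rho> = card {v. v < Suc i \<and> root v = \<rho> \<and> side v}"
          using I by (auto simp: res card_less_Suc)
      qed
    qed (simp_all add: side_body_def)
  qed (use s w' in \<open>simp_all add: side_body_def graph_state_def\<close>)
qed

lemma card_from_Suc:
  assumes "i < n"
  shows "card {v. i \<le> v \<and> v < n \<and> P v} = (if P i then 1 else 0) + card {v. Suc i \<le> v \<and> v < n \<and> P v}"
proof -
  have "{v. i \<le> v \<and> v < n \<and> P v} = (if P i then insert i {v. Suc i \<le> v \<and> v < n \<and> P v} else {v. Suc i \<le> v \<and> v < n \<and> P v})"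
    using assms by (auto simp: Suc_le_eq nat_less_le)
  moreover have "finite {v. Suc i \<le> v \<and> v < n \<and> P v}" by (rule finite_subset[of _ "{..<n}"]) auto
  ultimately show ?thesis by simp
qed

lemma sum_less_Suc:
  fixes f :: "nat \<Rightarrow> 'b::comm_monoid_add"
  shows "(\<Sum>v | v < Suc i \<and> P v. f v) = (\<Sum>v | v < i \<and> P v. f v) + (if P i then f i else 0)"
proof -
  have "{v. v < Suc i \<and> P v} = (if P i then insert i {v. v < i \<and> P v} else {v. v < i \<and> P v})"
    by (auto simp: less_Suc_eq)
  then show ?thesis by (simp add: add.commute)
qed

lemma balance_prog:
  assumes s: "graph_state s" "reg s ''r'' = r" "2 \<le> r" "r \<le> n + 1" "arr s ''oe'' = oe" "\<And>\<rho>. oe \<rho> \<le> m"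
      "\<And>v. v < n \<Longrightarrow> arr s ''sl'' v = (if side v then 1 else 0)"
      "\<And>\<rho>. arr s ''rm'' \<rho> = card {v. v < n \<and> root v = \<rho> \<and> side v}"
      "arr s ''ac'' = (\<lambda>_. 0)" "arr s ''t'' = t"
    and one: "\<And>\<rho>. oe \<rho> = 0 \<Longrightarrow> card {v. v < n \<and> root v = \<rho> \<and> side v} \<noteq> 1"
  shows "run w balance_prog s (n * (cost balance_body + 10) + 10)
    (\<lambda>s'. (\<forall>v<n. if 2 < r \<and> oe (root v) = 0
         then (if side v then 0 < arr s' ''t'' v \<and> arr s' ''t'' v < r else arr s' ''t'' v = 0)
         else arr s' ''t'' v = t v) \<and>
       (\<forall>\<rho>. 2 < r \<and> oe \<rho> = 0 \<longrightarrow> (\<Sum>v | v < n \<and> root v = \<rho>. arr s' ''t'' v) mod r = 0))"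
proof -
  \<comment> \<open>With one vertex to come the sum must be nonzero, so that \<open>r - ac\<close>
    is a nonzero color; with none to come it must be 0. The hypothesis \<open>one\<close> starts
    this, the sum being 0 at first. Color 2 at the last but one vertex preserves it, as
    \<open>r + 1\<close> has residue 1 for \<open>2 < r\<close>.\<close>
  let ?I = "\<lambda>i s'. (\<forall>v<n. if v < i \<and> 2 < r \<and> oe (root v) = 0
         then (if side v then 0 < arr s' ''t'' v \<and> arr s' ''t'' v < r else arr s' ''t'' v = 0)
         else arr s' ''t'' v = t v) \<and>
       (\<forall>\<rho>. 2 < r \<and> oe \<rho> = 0 \<longrightarrow> arr s' ''rm'' \<rho> = card {v. i \<le> v \<and> v < n \<and> root v = \<rho> \<and> side v} \<and>
          arr s' ''ac'' \<rho> = (\<Sum>v | v < i \<and> root v = \<rho>. arr s' ''t'' v) mod r \<and>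
          (arr s' ''rm'' \<rho> = 0 \<longrightarrow> arr s' ''ac'' \<rho> = 0) \<and> (arr s' ''rm'' \<rho> = 1 \<longrightarrow> arr s' ''ac'' \<rho> \<noteq> 0))"
  show ?thesis unfolding balance_prog_def
  proof (rule run_For[where N = n and I = ?I])
    fix i and s' :: store
    assume fr: "frame (For ''i'' ''n'' balance_body) s s'" and i: "i < n" and ri: "reg s' ''i'' = i"
    assume I: "?I i s'"
    define T where "T = arr s' ''t''"
    define M where "M = arr s' ''rm''"
    define A where "A = arr s' ''ac''"
    note defs = T_def[symmetric] M_def[symmetric] A_def[symmetric]
    define x where "x = root i"
    have g: "graph_state s'" by (rule graph_state_frame[OF s(1) fr]) (simp_all add: balance_body_def)
    have c: "reg s' ''r'' = r" "arr s' ''oe'' = oe" "arr s' ''sl'' = arr s ''sl''"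
      using fr s by (simp_all add: frame_def balance_body_def)
    have sl: "arr s ''sl'' i = (if side i then 1 else 0)" using s(7) i by simp
    have It: "\<And>v. v < n \<Longrightarrow> if v < i \<and> 2 < r \<and> oe (root v) = 0
           then (if side v then 0 < T v \<and> T v < r else T v = 0) else T v = t v"
      and Ib: "\<And>\<rho>. 2 < r \<Longrightarrow> oe \<rho> = 0 \<Longrightarrow> M \<rho> = card {v. i \<le> v \<and> v < n \<and> root v = \<rho> \<and> side v} \<and>
            A \<rho> = (\<Sum>v | v < i \<and> root v = \<rho>. T v) mod r \<and> (M \<rho> = 0 \<longrightarrow> A \<rho> = 0) \<and> (M \<rho> = 1 \<longrightarrow> A \<rho> \<noteq> 0)"
      using I[unfolded defs] by blast+
    have bw: "i \<le> w" "r \<le> w" "oe x \<le> w" "x \<le> w" "2 \<le> w" "n \<le> w"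
      using i s(4) s(6)[of x] w' root_less[OF i] by (simp_all add: x_def)
    define P where "P \<longleftrightarrow> 2 < r \<and> oe x = 0"
    define y where "y = (if M x = 1 then r - A x else if M x = 2 \<and> A x + 1 = r then 2 else 1)"
    have Ax: "A x < r" if P using Ib[of x] that s(3) by (simp add: P_def)
    have sumT: "(\<Sum>v | v < i \<and> root v = \<rho>. (T(i := z)) v) = (\<Sum>v | v < i \<and> root v = \<rho>. T v)" for z \<rho>
      by (intro sum.cong) auto
    let ?s = "result balance_body s'"
    have res: "fits w balance_body s' \<and>
       arr ?s ''t'' = (if P then T(i := if side i then y else 0) else T) \<and>
       arr ?s ''rm'' = (if P \<and> side i then M(x := M x - 1) else M) \<and>
       arr ?s ''ac'' = (if P \<and> side i then A(x := (A x + y) mod r) else A)"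
    proof (cases "P \<and> side i")
      case True
      have yr: "y \<le> r" using True by (auto simp: y_def P_def)
      have zw: "A x + y \<le> w" using Ax True yr s(4) w'' by linarith
      have z: "(if A x + y < r then A x + y else A x + y - r) = (A x + y) mod r"
        using add_mod_step[of "A x" r y] Ax True yr by blast
      have Mw: "M x \<le> w"
      proof -
        have "M x = card {v. i \<le> v \<and> v < n \<and> root v = x \<and> side v}" using Ib[of x] True by (simp add: P_def)
        also have "\<dots> \<le> card {..<n}" by (intro card_mono) auto
        finally show ?thesis using bw by simp
      qed
      have Aw: "A x \<le> w" "Suc (A x) \<le> w" "r - A x \<le> w" "A x + y - r \<le> w" using Ax True bw zw by simp_all
      have PP: "2 < r" "oe x = 0" using True by (simp_all add: P_def)
      consider "M x = 1" "y = r - A x" | "M x = 2" "Suc (A x) = r" "y = 2"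
        | "M x = 2" "Suc (A x) \<noteq> r" "y = 1" | "M x \<noteq> 1" "M x \<noteq> 2" "y = 1"
        by (cases "M x = 1"; cases "M x = 2"; cases "Suc (A x) = r") (simp_all add: y_def)
      then show ?thesis unfolding z[symmetric] using g c sl bw Mw Aw zw True PP ri
        by cases (simp_all add: balance_body_def graph_state_def defs x_def[symmetric] i)
    next
      case False
      then consider "P" "2 < r" "oe x = 0" "\<not> side i" | "\<not> P" "\<not> 2 < r" | "\<not> P" "oe x \<noteq> 0"
        by (cases "2 < r"; cases "oe x = 0") (simp_all add: P_def)
      then show ?thesis using g c sl bw ri
        by cases (simp_all add: balance_body_def graph_state_def defs x_def[symmetric] i)
    qed
    show "run w balance_body s' (cost balance_body) (\<lambda>s'. ?I (Suc i) (set_reg ''i'' (Suc i) s'))"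
    proof (rule run_loop_free)
      show "fits w balance_body s'" using res by blast
      define T' where "T' = (if P then T(i := if side i then y else 0) else T)"
      define M' where "M' = (if P \<and> side i then M(x := M x - 1) else M)"
      define A' where "A' = (if P \<and> side i then A(x := (A x + y) mod r) else A)"
      have res': "arr (set_reg ''i'' (Suc i) ?s) ''t'' = T'" "arr (set_reg ''i'' (Suc i) ?s) ''rm'' = M'"
          "arr (set_reg ''i'' (Suc i) ?s) ''ac'' = A'" using res by (simp_all add: T'_def M'_def A'_def)
      have yb: "0 < y" "y < r" if "P" "M x \<noteq> 0"
        using that Ax Ib[of x] by (auto simp: y_def P_def)
      have Mx: "M x \<noteq> 0" if "P" "side i"
      proof -
        have "M x = card {v. i \<le> v \<and> v < n \<and> root v = x \<and> side v}" using Ib[of x] that by (simp add: P_def)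
        then show ?thesis unfolding card_from_Suc[OF i] using that by (simp add: x_def)
      qed
      have 1: "if v < Suc i \<and> 2 < r \<and> oe (root v) = 0 then (if side v then 0 < T' v \<and> T' v < r else T' v = 0) else T' v = t v"
        if "v < n" for v
      proof (cases "v = i")
        case True
        then show ?thesis using It[OF i] yb Mx by (auto simp: T'_def P_def x_def)
      next
        case False
        then have "T' v = T v" by (simp add: T'_def)
        then show ?thesis using It[OF that] False by (simp add: less_Suc_eq)
      qed
      have 2: "M' \<rho> = card {v. Suc i \<le> v \<and> v < n \<and> root v = \<rho> \<and> side v} \<and>
            A' \<rho> = (\<Sum>v | v < Suc i \<and> root v = \<rho>. T' v) mod r \<and>
            (M' \<rho> = 0 \<longrightarrow> A' \<rho> = 0) \<and> (M' \<rho> = 1 \<longrightarrow> A' \<rho> \<noteq> 0)" if \<rho>: "2 < r" "oe \<rho> = 0" for \<rho>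
      proof (cases "\<rho> = x")
        case False
        have "M' \<rho> = M \<rho>" "A' \<rho> = A \<rho>" using False by (simp_all add: M'_def A'_def)
        moreover have "(\<Sum>v | v < Suc i \<and> root v = \<rho>. T' v) = (\<Sum>v | v < i \<and> root v = \<rho>. T v)"
          using False sumT by (simp add: sum_less_Suc T'_def x_def[symmetric])
        moreover have "card {v. i \<le> v \<and> v < n \<and> root v = \<rho> \<and> side v} = card {v. Suc i \<le> v \<and> v < n \<and> root v = \<rho> \<and> side v}"
          using card_from_Suc[OF i, of "\<lambda>v. root v = \<rho> \<and> side v"] False by (simp add: x_def)
        ultimately show ?thesis using Ib[OF \<rho>] by metis
      next
        case True
        then have P: P using \<rho> by (simp add: P_def)
        note Ix = Ib[OF \<rho>, unfolded True]
        have sum: "(\<Sum>v | v < Suc i \<and> root v = x. T' v) = (\<Sum>v | v < i \<and> root v = x. T v) + (if side i then y else 0)"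
          using P sumT by (simp add: sum_less_Suc T'_def x_def[symmetric])
        have rem: "card {v. i \<le> v \<and> v < n \<and> root v = x \<and> side v} =
          (if side i then 1 else 0) + card {v. Suc i \<le> v \<and> v < n \<and> root v = x \<and> side v}"
          using card_from_Suc[OF i, of "\<lambda>v. root v = x \<and> side v"] by (simp add: x_def)
        show ?thesis
        proof (cases "side i")
          case False
          then have e: "M' x = M x" "A' x = A x" "(\<Sum>v | v < Suc i \<and> root v = x. T' v) = (\<Sum>v | v < i \<and> root v = x. T v)"
            "card {v. Suc i \<le> v \<and> v < n \<and> root v = x \<and> side v} = card {v. i \<le> v \<and> v < n \<and> root v = x \<and> side v}"
            using sum rem by (simp_all add: M'_def A'_def)
          show ?thesis unfolding True e using Ix by blast
        next
          case sd: True
          have M': "M' x = M x - 1" "A' x = (A x + y) mod r" using sd P by (simp_all add: M'_def A'_def)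
          have a1: "M x - 1 = card {v. Suc i \<le> v \<and> v < n \<and> root v = x \<and> side v}" using Ix rem sd by simp
          have a2: "(A x + y) mod r = (\<Sum>v | v < Suc i \<and> root v = x. T' v) mod r"
            unfolding sum using Ix sd by (simp add: mod_add_left_eq)
          have a3: "(A x + y) mod r = 0" if "M x - 1 = 0"
          proof -
            have "M x = 1" using that Mx P sd by simp
            then show ?thesis using Ax[OF P] by (simp add: y_def)
          qed
          have a4: "(A x + y) mod r \<noteq> 0" if "M x - 1 = 1"
          proof -
            have "M x = 2" using that by simp
            show ?thesis
            proof (cases "A x + 1 = r")
              case True
              then have "A x + y = r + 1" using \<open>M x = 2\<close> by (simp add: y_def)
              then show ?thesis using \<rho>(1) by (simp add: mod_if)
            next
              case False
              then have "A x + y = A x + 1" "A x + 1 < r" using \<open>M x = 2\<close> Ax[OF P] by (simp_all add: y_def)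
              then show ?thesis by simp
            qed
          qed
          show ?thesis unfolding True M' using a1 a2 a3 a4 by blast
        qed
      qed
      show "?I (Suc i) (set_reg ''i'' (Suc i) ?s)"
        unfolding res' using 1 2 by blast
    qed (simp_all add: balance_body_def)
  next
    show "?I 0 (set_reg ''i'' 0 s)"
      using s(8,9,10) one by simp
  next
    fix s' :: store
    assume *: "?I n s'"
    have "{v. n \<le> v \<and> v < n \<and> root v = \<rho> \<and> side v} = {}" for \<rho> by auto
    then have "(\<Sum>v | v < n \<and> root v = \<rho>. arr s' ''t'' v) mod r = 0" if "2 < r" "oe \<rho> = 0" for \<rho>
      using * that by (metis card.empty)
    then show "(\<forall>v<n. if 2 < r \<and> oe (root v) = 0
           then (if side v then 0 < arr s' ''t'' v \<and> arr s' ''t'' v < r else arr s' ''t'' v = 0)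
           else arr s' ''t'' v = t v) \<and>
         (\<forall>\<rho>. 2 < r \<and> oe \<rho> = 0 \<longrightarrow> (\<Sum>v | v < n \<and> root v = \<rho>. arr s' ''t'' v) mod r = 0)"
      using * by simp
  qed (use s(1) w' in \<open>simp_all add: balance_body_def graph_state_def\<close>)
qed


definition sg :: "nat \<Rightarrow> int" where
  "sg v = (if dp v = 0 then 1 else - 1)"

lemma defect_prog:
  assumes s: "graph_state s" "reg s ''r'' = r" "0 < r" "r \<le> n + 1" "arr s ''df'' = (\<lambda>_. 0)" "arr s ''t'' = t"
    and t: "\<And>v. v < n \<Longrightarrow> t v < r"
  shows "run w defect_prog s (n * (cost defect_body + 10) + 10)
    (\<lambda>s'. \<forall>\<rho>. arr s' ''df'' \<rho> < r \<and>
      int (arr s' ''df'' \<rho>) = (\<Sum>v | v < n \<and> root v = \<rho>. sg v * int (t v)) mod int r)"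
proof -
  let ?I = "\<lambda>i s'. \<forall>\<rho>. arr s' ''df'' \<rho> < r \<and>
      int (arr s' ''df'' \<rho>) = (\<Sum>v | v < i \<and> root v = \<rho>. sg v * int (t v)) mod int r"
  show ?thesis unfolding defect_prog_def
  proof (rule run_For[where N = n and I = ?I])
    fix i and s' :: store
    assume fr: "frame (For ''i'' ''n'' defect_body) s s'" and i: "i < n" and ri: "reg s' ''i'' = i"
    assume I: "?I i s'"
    have g: "graph_state s'" by (rule graph_state_frame[OF s(1) fr]) (simp_all add: defect_body_def)
    have c: "reg s' ''r'' = r" "arr s' ''t'' = t" using fr s by (simp_all add: frame_def defect_body_def)
    define D where "D = arr s' ''df''"
    define x where "x = root i"
    define y where "y = (if dp i = 0 then t i else r - t i)"
    have D: "D \<rho> < r" "int (D \<rho>) = (\<Sum>v | v < i \<and> root v = \<rho>. sg v * int (t v)) mod int r" for \<rho>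
      using I by (simp_all add: D_def)
    have yr: "y \<le> r" using t[OF i] by (simp add: y_def)
    have z: "(if D x + y < r then D x + y else D x + y - r) = (D x + y) mod r"
      by (rule add_mod_step[OF D(1) yr])
    have bw: "D x \<le> w" "r \<le> w" "D x + y \<le> w" "D x + y - r \<le> w" "i \<le> w" "x \<le> w" "y \<le> w" "t i \<le> w"
      using D(1)[of x] yr s(4) w'' t[OF i] i root_less[OF i] unfolding x_def by linarith+
    let ?s = "result defect_body s'"
    have res: "fits w defect_body s' \<and> arr ?s ''df'' = D(x := (D x + y) mod r)"
    proof (cases "dp i = 0")
      case True
      then have "t i = y" by (simp add: y_def)
      then show ?thesis unfolding z[symmetric] using g c ri bw i True
        by (simp add: defect_body_def graph_state_def x_def[symmetric] D_def[symmetric])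
    next
      case False
      then have "r - t i = y" by (simp add: y_def)
      then show ?thesis unfolding z[symmetric] using g c ri bw i False
        by (simp add: defect_body_def graph_state_def x_def[symmetric] D_def[symmetric])
    qed
    have int: "int ((D x + y) mod r) = ((\<Sum>v | v < i \<and> root v = x. sg v * int (t v)) + sg i * int (t i)) mod int r"
    proof -
      have "int ((D x + y) mod r) = (int (D x) + int y) mod int r" by (simp add: zmod_int)
      also have "\<dots> = ((\<Sum>v | v < i \<and> root v = x. sg v * int (t v)) + int y) mod int r"
        unfolding D(2) by (simp add: mod_add_left_eq)
      also have "\<dots> = ((\<Sum>v | v < i \<and> root v = x. sg v * int (t v)) + sg i * int (t i)) mod int r"
      proof (cases "dp i = 0")
        case False
        have "int y = sg i * int (t i) + int r" using False t[OF i] by (simp add: y_def sg_def of_nat_diff)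
        then have "(\<Sum>v | v < i \<and> root v = x. sg v * int (t v)) + int y =
          ((\<Sum>v | v < i \<and> root v = x. sg v * int (t v)) + sg i * int (t i)) + int r" by simp
        then show ?thesis by (simp only: mod_add_self2)
      qed (simp add: y_def sg_def)
      finally show ?thesis .
    qed
    show "run w defect_body s' (cost defect_body) (\<lambda>s'. ?I (Suc i) (set_reg ''i'' (Suc i) s'))"
    proof (rule run_loop_free)
      show "?I (Suc i) (set_reg ''i'' (Suc i) ?s)"
      proof
        fix \<rho>
        show "arr (set_reg ''i'' (Suc i) ?s) ''df'' \<rho> < r \<and>
        int (arr (set_reg ''i'' (Suc i) ?s) ''df'' \<rho>) = (\<Sum>v | v < Suc i \<and> root v = \<rho>. sg v * int (t v)) mod int r"
        proof (cases "\<rho> = x")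
          case True
          then show ?thesis using res int s(3) unfolding sum_less_Suc by (simp add: x_def)
        next
          case False
          then show ?thesis using res D unfolding sum_less_Suc by (simp add: x_def)
        qed
      qed
      show "fits w defect_body s'" using res by blast
    qed (simp_all add: defect_body_def)
  qed (use s w' in \<open>simp_all add: defect_body_def graph_state_def\<close>)
qed

lemma odd_label_prog:
  assumes s: "graph_state s" "reg s ''r'' = r" "0 < r" "r \<le> n + 1" "arr s ''oe'' = oe" "arr s ''df'' = D"
      "arr s ''hf'' = H" "arr s ''s'' = (\<lambda>_. 0)" "\<And>\<rho>. oe \<rho> \<le> m" "\<And>\<rho>. D \<rho> < r"
    and H: "\<And>e. e < m \<Longrightarrow> oe (root (U e)) = Suc e \<Longrightarrow> H (D (root (U e))) < r \<and>
        2 * H (D (root (U e))) mod r = D (root (U e))"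
  shows "run w odd_label_prog s (m * (cost odd_label_body + 10) + 10)
    (\<lambda>s'. \<forall>e<m. arr s' ''s'' e < r \<and> (if oe (root (U e)) = Suc e
       then (2 * sg (U e) * int (arr s' ''s'' e)) mod int r = int (D (root (U e))) else arr s' ''s'' e = 0))"
proof -
  let ?I = "\<lambda>i s'. \<forall>e<m. arr s' ''s'' e < r \<and> (if e < i \<and> oe (root (U e)) = Suc e
       then (2 * sg (U e) * int (arr s' ''s'' e)) mod int r = int (D (root (U e))) else arr s' ''s'' e = 0)"
  show ?thesis unfolding odd_label_prog_def
  proof (rule run_For[where N = m and I = ?I])
    fix i and s' :: store
    assume fr: "frame (For ''i'' ''m'' odd_label_body) s s'" and i: "i < m" and ri: "reg s' ''i'' = i"
    assume I: "?I i s'"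
    have g: "graph_state s'" by (rule graph_state_frame[OF s(1) fr]) (simp_all add: odd_label_body_def)
    have c: "reg s' ''r'' = r" "arr s' ''oe'' = oe" "arr s' ''df'' = D" "arr s' ''hf'' = H"
      using fr s by (simp_all add: frame_def odd_label_body_def)
    define u where "u = U i"
    define x where "x = root u"
    define S where "S = arr s' ''s''"
    define y where "y = (if dp u = 1 \<and> 0 < H (D x) then r - H (D x) else H (D x))"
    have u: "u < n" using U by (simp add: u_def)
    have bw: "i \<le> w" "Suc i \<le> w" "u \<le> w" "x \<le> w" "oe x \<le> w" "D x \<le> w" "r \<le> w"
      using i w' u root_less[OF u] s(4,9,10) x_def order.trans[OF s(9)[of x], of w] less_imp_le[OF s(10)[of x]]
      by simp_all
    have Hb: "H (D x) \<le> w" "r - H (D x) \<le> w" "H (D x) < r" "2 * H (D x) mod r = D x" if "oe x = Suc i"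
      using H[OF i] that bw by (auto simp: x_def u_def)
    let ?s = "result odd_label_body s'"
    have res: "fits w odd_label_body s' \<and> arr ?s ''s'' = (if oe x = Suc i then S(i := y) else S)"
    proof (cases "oe x = Suc i")
      case True
      show ?thesis using g c ri bw Hb(1,2)[OF True] True u
        by (simp add: odd_label_body_def graph_state_def u_def[symmetric] x_def[symmetric] S_def[symmetric] y_def)
    next
      case False
      then show ?thesis using g c ri bw u
        by (simp add: odd_label_body_def graph_state_def u_def[symmetric] x_def[symmetric] S_def[symmetric])
    qed
    have y: "y < r \<and> (2 * sg u * int y) mod int r = int (D x)" if "oe x = Suc i"
    proof (cases "dp u = 1 \<and> 0 < H (D x)")
      case True
      then have "sg u = - 1" "int y = int r - int (H (D x))" "y < r"
        using Hb(3)[OF that] s(3) by (simp_all add: sg_def y_def of_nat_diff)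
      then have "2 * sg u * int y = 2 * int (H (D x)) - 2 * int r" by simp
      also have "\<dots> mod int r = (2 * int (H (D x)) + (- 2) * int r) mod int r" by simp
      also have "\<dots> = (2 * int (H (D x))) mod int r" by (rule mod_mult_self1)
      also have "\<dots> = int (2 * H (D x) mod r)" by (simp add: zmod_int)
      finally show ?thesis using Hb(4)[OF that] \<open>y < r\<close> by simp
    next
      case False
      then have "y = H (D x)" by (auto simp: y_def)
      have "2 * sg u * int y = 2 * int (H (D x))"
        using False dp_cases[of u] by (auto simp: sg_def y_def)
      also have "\<dots> mod int r = int (2 * H (D x) mod r)" by (simp add: zmod_int)
      finally show ?thesis using Hb(3,4)[OF that] \<open>y = H (D x)\<close> by simp
    qed
    show "run w odd_label_body s' (cost odd_label_body) (\<lambda>s'. ?I (Suc i) (set_reg ''i'' (Suc i) s'))"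
    proof (rule run_loop_free)
      show "?I (Suc i) (set_reg ''i'' (Suc i) ?s)"
      proof (intro allI impI)
        fix e assume e: "e < m"
        note Ie = I[rule_format, OF e, folded S_def]
        have a: "arr (set_reg ''i'' (Suc i) ?s) ''s'' = (if oe x = Suc i then S(i := y) else S)" using res by simp
        show "arr (set_reg ''i'' (Suc i) ?s) ''s'' e < r \<and>
         (if e < Suc i \<and> oe (root (U e)) = Suc e
         then (2 * sg (U e) * int (arr (set_reg ''i'' (Suc i) ?s) ''s'' e)) mod int r = int (D (root (U e)))
         else arr (set_reg ''i'' (Suc i) ?s) ''s'' e = 0)"
        proof (cases "e = i")
          case True
          then show ?thesis unfolding a using y Ie s(3) by (auto simp: u_def x_def)
        next
          case False
          then show ?thesis unfolding a using Ie by (simp add: less_Suc_eq)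
        qed
      qed
      show "fits w odd_label_body s'" using res by blast
    qed (simp_all add: odd_label_body_def)
  qed (use s w' in \<open>simp_all add: odd_label_body_def graph_state_def\<close>)
qed

lemma incidence_prog:
  assumes s: "graph_state s" "reg s ''r'' = r" "0 < r" "r \<le> n + 1" "arr s ''s'' = S" "arr s ''as'' = (\<lambda>_. 0)"
    and S: "\<And>e. e < m \<Longrightarrow> S e < r"
  shows "run w incidence_prog s (m * (cost incidence_body + 10) + 10)
    (\<lambda>s'. \<forall>v. arr s' ''as'' v = (\<Sum>e | e < m \<and> (U e = v \<or> W e = v). S e) mod r)"
proof -
  let ?I = "\<lambda>i s'. \<forall>v. arr s' ''as'' v = (\<Sum>e | e < i \<and> (U e = v \<or> W e = v). S e) mod r"
  show ?thesis unfolding incidence_prog_def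
  proof (rule run_For[where N = m and I = ?I])
    fix i and s' :: store
    assume fr: "frame (For ''i'' ''m'' incidence_body) s s'" and i: "i < m" and ri: "reg s' ''i'' = i"
    assume I: "?I i s'"
    have g: "graph_state s'" by (rule graph_state_frame[OF s(1) fr]) (simp_all add: incidence_body_def)
    have c: "reg s' ''r'' = r" "arr s' ''s'' = S" using fr s by (simp_all add: frame_def incidence_body_def)
    define A where "A = arr s' ''as''"
    have A: "A v < r" for v using I s(3) by (simp add: A_def)
    have uv: "U i \<noteq> W i" using UW[OF i] .
    have z: "(if A v + S i < r then A v + S i else A v + S i - r) = (A v + S i) mod r" for v
      using add_mod_step[OF A] S[OF i] by simp
    have bw: "A v + S i \<le> w" "A v + S i - r \<le> w" "A v \<le> w" for v
      using A[of v] S[OF i] s(4) w'' i by linarith+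
    have bw': "r \<le> w" "S i \<le> w" "i \<le> w" using S[OF i] s(4) w'' i by linarith+
    let ?s = "result incidence_body s'"
    have res: "fits w incidence_body s' \<and>
        arr ?s ''as'' = A(U i := (A (U i) + S i) mod r, W i := (A (W i) + S i) mod r)"
      unfolding z[symmetric] using g c ri bw[of "U i"] bw[of "W i"] bw' uv
      by (simp add: incidence_body_def graph_state_def A_def[symmetric])
    show "run w incidence_body s' (cost incidence_body) (\<lambda>s'. ?I (Suc i) (set_reg ''i'' (Suc i) s'))"
    proof (rule run_loop_free)
      show "?I (Suc i) (set_reg ''i'' (Suc i) ?s)"
      proof
        fix v
        have "arr (set_reg ''i'' (Suc i) ?s) ''as'' v = (A v + (if U i = v \<or> W i = v then S i else 0)) mod r"
          using res A[of v] uv by auto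
        also have "\<dots> = (\<Sum>e | e < Suc i \<and> (U e = v \<or> W e = v). S e) mod r"
          unfolding sum_less_Suc using I by (simp add: A_def mod_add_left_eq)
        finally show "arr (set_reg ''i'' (Suc i) ?s) ''as'' v = (\<Sum>e | e < Suc i \<and> (U e = v \<or> W e = v). S e) mod r" .
      qed
      show "fits w incidence_body s'" using res by blast
    qed (simp_all add: incidence_body_def)
  qed (use s w' in \<open>simp_all add: incidence_body_def graph_state_def\<close>)
qed

section \<open>Labelling the tree edges from the leaves up\<close>

definition inc :: "nat \<Rightarrow> nat set" where
  "inc v = {e. e < m \<and> (U e = v \<or> W e = v)}"

lemma finite_inc [simp]: "finite (inc v)"
  by (simp add: inc_def)

text \<open>Positions from \<open>p\<close> on are finished, and roots are exempt from the claim on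
  sums. The edge from an unfinished vertex to its parent still has label 0, so writing
  \<open>x\<close> there adds \<open>x\<close> at both ends. \<open>A\<close> is tied to the sums
  only at unfinished vertices, since the program no longer updates it at a finished one.\<close>

definition tree_inv where
  "tree_inv r t S0 p A S \<longleftrightarrow>
     (\<forall>j<p. A (q j) = (\<Sum>e\<in>inc (q j). S e) mod r) \<and>
     (\<forall>j. p \<le> j \<longrightarrow> j < n \<longrightarrow> root (q j) \<noteq> q j \<longrightarrow> (\<Sum>e\<in>inc (q j). S e) mod r = t (q j)) \<and>
     (\<forall>j<p. root (q j) \<noteq> q j \<longrightarrow> S (pe (q j)) = 0) \<and>
     (\<forall>e<m. S e < r \<and> (dp (U e) = dp (W e) \<longrightarrow> S e = (S0 e :: nat)))"

text \<open>The edge from \<open>q p\<close> to its parent meets no other vertex, and the parent has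
  an earlier position, so the sums at finished vertices stay as they are.\<close>

lemma tree_step:
  assumes I: "tree_inv r t S0 (Suc p) A S" and p: "p < n" "root (q p) \<noteq> q p" and t: "t (q p) < r"
  defines "x \<equiv> (t (q p) + (r - A (q p))) mod r"
  shows "tree_inv r t S0 p (A(pr (q p) := (A (pr (q p)) + x) mod r)) (S(pe (q p) := x))"
proof -
  define v where "v = q p"
  define u where "u = pr v"
  define e where "e = pe v"
  obtain j where j: "j < p" "u = q j" using parent(1)[OF p] by (auto simp: u_def v_def)
  have e: "e < m" "{U e, W e} = {v, u}" using parent(4,5)[OF p] by (simp_all add: e_def u_def v_def)
  have dp: "dp v = 1 - dp u" using parent(3)[OF p] by (simp add: u_def v_def)
  have vu: "v \<noteq> u" using j p by (simp add: v_def q_eq_iff)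
  have Se: "S e = 0" using I p by (simp add: tree_inv_def e_def v_def)
  have r: "0 < r" using t by simp
  have inc_e: "e \<in> inc z \<longleftrightarrow> z = v \<or> z = u" for z using e by (auto simp: inc_def doubleton_eq_iff)
  have sum: "(\<Sum>f\<in>inc z. (S(e := x)) f) = (\<Sum>f\<in>inc z. S f) + (if z = v \<or> z = u then x else 0)" for z
  proof (cases "z = v \<or> z = u")
    case True
    then have z: "e \<in> inc z" using inc_e by simp
    have "(\<Sum>f\<in>inc z. (S(e := x)) f) = x + (\<Sum>f\<in>inc z - {e}. (S(e := x)) f)"
      using z by (subst sum.remove[of _ e]) simp_all
    also have "(\<Sum>f\<in>inc z - {e}. (S(e := x)) f) = (\<Sum>f\<in>inc z - {e}. S f)" by (intro sum.cong) auto
    also have "\<dots> = (\<Sum>f\<in>inc z. S f)" using z Se by (subst sum.remove[of "inc z" e]) simp_all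
    finally show ?thesis using True by simp
  next
    case False
    then show ?thesis using inc_e[of z] by (auto intro!: sum.cong)
  qed
  have "(\<Sum>f\<in>inc v. (S(e := x)) f) mod r = t v"
  proof -
    have Av: "A v = (\<Sum>f\<in>inc v. S f) mod r" using I by (simp add: tree_inv_def v_def)
    then have "A v < r" using r by simp
    then have Ar: "A v + (t v + (r - A v)) = t v + r" by simp
    have "(\<Sum>f\<in>inc v. (S(e := x)) f) mod r = ((\<Sum>f\<in>inc v. S f) + x) mod r" unfolding sum by simp
    also have "\<dots> = (A v + (t v + (r - A v))) mod r"
      unfolding x_def v_def[symmetric] by (subst Av) (simp add: mod_add_left_eq mod_add_right_eq)
    also have "\<dots> = t v" unfolding Ar using t by (simp add: v_def)
    finally show ?thesis .
  qed
  then have B: "(\<Sum>f\<in>inc (q i). (S(e := x)) f) mod r = t (q i)" if "p \<le> i" "i < n" "root (q i) \<noteq> q i" for i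
  proof (cases "i = p")
    case False
    then have "q i \<noteq> v" "q i \<noteq> u" using that p j by (simp_all add: v_def q_eq_iff)
    moreover have "(\<Sum>f\<in>inc (q i). S f) mod r = t (q i)" using I that False by (simp add: tree_inv_def)
    ultimately show ?thesis unfolding sum by simp
  qed (simp add: v_def)
  moreover have "(A(u := (A u + x) mod r)) (q i) = (\<Sum>f\<in>inc (q i). (S(e := x)) f) mod r" if "i < p" for i
  proof -
    have Ai: "A (q i) = (\<Sum>f\<in>inc (q i). S f) mod r" using I that by (simp add: tree_inv_def)
    have "q i \<noteq> v" using that p by (simp add: v_def q_eq_iff)
    then show ?thesis unfolding sum using Ai by (auto simp: mod_add_left_eq)
  qed
  moreover have "(S(e := x)) (pe (q i)) = 0" if ip: "i < p" and ir: "root (q i) \<noteq> q i" for i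
  proof -
    have i: "i < n" using ip p by simp
    \<comment> \<open>Distinct vertices have distinct edges to their parents: otherwise
      \<open>v\<close> would be \<open>q i\<close> or the parent of \<open>q i\<close>, both at
      positions before \<open>p\<close>.\<close>
    have "pe (q i) \<noteq> e"
    proof
      assume "pe (q i) = e"
      then have eq: "{q i, pr (q i)} = {v, u}" using parent(5)[OF i ir] e by simp
      moreover obtain l where l: "l < i" "pr (q i) = q l" using parent(1)[OF i ir] by blast
      ultimately have "q i = v \<or> q l = v" by (auto simp: doubleton_eq_iff)
      then show False using l ip p by (auto simp: v_def q_eq_iff)
    qed
    then show ?thesis using I ip ir by (simp add: tree_inv_def)
  qed
  moreover have "(S(e := x)) f < r \<and> (dp (U f) = dp (W f) \<longrightarrow> (S(e := x)) f = S0 f)" if "f < m" for f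
  proof (cases "f = e")
    case True
    have "dp (U e) \<noteq> dp (W e)" using e(2) dp dp_cases[of u] by (auto simp: doubleton_eq_iff)
    then show ?thesis using True r by (simp add: x_def)
  next
    case False
    then show ?thesis using I that by (simp add: tree_inv_def)
  qed
  ultimately show ?thesis unfolding tree_inv_def by (simp add: v_def[symmetric] u_def[symmetric] e_def[symmetric])
qed

lemma tree_prog:
  assumes s: "graph_state s" "reg s ''r'' = r" "0 < r" "r \<le> n + 1" "arr s ''s'' = S0" "arr s ''t'' = t"
      "\<And>v. arr s ''as'' v = (\<Sum>e\<in>inc v. S0 e) mod r"
    and S: "\<And>e. e < m \<Longrightarrow> S0 e < r" and S0: "\<And>e. e < m \<Longrightarrow> dp (U e) \<noteq> dp (W e) \<Longrightarrow> S0 e = 0"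
    and t: "\<And>v. v < n \<Longrightarrow> t v < r"
  shows "run w tree_prog s (n * (cost tree_body + bcost tree_cond + 1) + 20)
    (\<lambda>s'. \<exists>A. tree_inv r t S0 0 A (arr s' ''s''))"
  unfolding tree_prog_def
proof (rule run_Seq[where P = "\<lambda>s'. s' = result (''i'' ::= Reg ''n'') s" and Tp = 2])
  show "run w (''i'' ::= Reg ''n'') s 2 (\<lambda>s'. s' = result (''i'' ::= Reg ''n'') s)"
    by (rule run_loop_free) (use s w' in \<open>simp_all add: graph_state_def\<close>)
  fix s1 assume f1: "frame (''i'' ::= Reg ''n'') s s1" and s1: "s1 = result (''i'' ::= Reg ''n'') s"
  have g1: "graph_state s1" by (rule graph_state_frame[OF s(1) f1]) simp_all
  let ?I = "\<lambda>i s'. reg s' ''i'' = n - i \<and>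
        tree_inv r t S0 (n - i) (arr s' ''as'') (arr s' ''s'')"
  show "run w (While tree_cond tree_body) s1 (n * (cost tree_body + bcost tree_cond + 1) + bcost tree_cond + 1)
    (\<lambda>s'. \<exists>A. tree_inv r t S0 0 A (arr s' ''s''))"
  proof (rule run_iterate[where a = 0 and B = n and J = ?I])
    show "loop_free tree_body" by (simp add: tree_body_def)
    \<comment> \<open>Tree edges join different parities, so \<open>S0\<close> vanishes on them, as
      the invariant demands at the start.\<close>
    have "pe (q j) < m" "dp (U (pe (q j))) \<noteq> dp (W (pe (q j)))" if "j < n" "root (q j) \<noteq> q j" for j
      using parent[OF that] dp_cases[of "pr (q j)"] by (auto simp: doubleton_eq_iff)
    then have "tree_inv r t S0 n (arr s ''as'') S0" using s S S0 by (simp add: tree_inv_def)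
    then show "?I 0 s1"
      using s by (simp add: s1 graph_state_def)
  next
    fix i and s' :: store
    assume f: "frame tree_body s1 s'" and i: "0 \<le> i" "i < n"
      and I: "?I i s'"
    have g: "graph_state s'" by (rule graph_state_frame[OF g1 f]) (simp_all add: tree_body_def)
    have c: "reg s' ''r'' = r" "arr s' ''t'' = t" using f s by (simp_all add: frame_def tree_body_def s1)
    define p where "p = n - Suc i"
    have p: "n - i = Suc p" "p < n" using i by (simp_all add: p_def)
    define A where "A = arr s' ''as''"
    define S where "S = arr s' ''s''"
    have ri: "reg s' ''i'' = Suc p" and T: "tree_inv r t S0 (Suc p) A S" using I p by (simp_all add: A_def S_def)
    define v where "v = q p"
    let ?s = "result tree_body s'"
    have pw: "p \<le> w" "Suc p \<le> w" "r \<le> w" using p w' s(4) by simp_all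
    have v: "v < n" "v \<le> w" "root v \<le> w" by (simp_all add: v_def)
    have "fits w tree_body s' \<and> reg ?s ''i'' = p \<and> tree_inv r t S0 p (arr ?s ''as'') (arr ?s ''s'')"
    proof (cases "root v = v")
      case True
      have "Suc p \<le> j" if "p \<le> j" "root (q j) \<noteq> q j" for j
        using that True by (cases "j = p") (auto simp: v_def)
      then have "tree_inv r t S0 p A S" using T unfolding tree_inv_def by (blast intro: less_SucI)
      then show ?thesis using g c ri pw v True
        by (simp add: tree_body_def graph_state_def v_def[symmetric] A_def[symmetric] S_def[symmetric])
    next
      case False
      define u where "u = pr v"
      define y where "y = (t v + (r - A v)) mod r"
      note rt = False[unfolded v_def]
      obtain j where j: "j < p" "u = q j" using parent(1)[OF p(2) rt] by (auto simp: u_def v_def)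
      have Av: "A v < r" "A u < r" using T s(3) j by (simp_all add: tree_inv_def v_def)
      have u: "u \<le> w" by (simp add: j)
      have pe: "pe v < m" using parent(4)[OF p(2) rt] by (simp add: v_def)
      have tv: "t v < r" using t v by simp
      have y': "(if t v + (r - A v) < r then t v + (r - A v) else t v + (r - A v) - r) = y"
        unfolding y_def by (rule add_mod_step) (use tv in auto)
      have yr: "y < r" using s(3) by (simp add: y_def)
      have z: "(if A u + y < r then A u + y else A u + y - r) = (A u + y) mod r"
        by (rule add_mod_step) (use Av yr in auto)
      have bw: "t v + (r - A v) \<le> w" "t v + (r - A v) - r \<le> w" "r - A v \<le> w" "A v \<le> w" "A u \<le> w" "A u + y \<le> w"
          "A u + y - r \<le> w" "y \<le> w" "t v \<le> w" "pe v \<le> w"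
        using Av yr tv s(4) w'' pe by linarith+
      have "A(u := (A u + y) mod r) = arr ?s ''as'' \<and> S(pe v := y) = arr ?s ''s'' \<and> fits w tree_body s' \<and> reg ?s ''i'' = p"
      proof (cases "t v + (r - A v) < r")
        case True
        then have "t v + (r - A v) = y" using y' by simp
        then show ?thesis unfolding z[symmetric] using g c ri pw v u bw False True
          by (simp add: tree_body_def graph_state_def v_def[symmetric] A_def[symmetric] S_def[symmetric] u_def[symmetric])
      next
        case nl: False
        then have "t v + (r - A v) - r = y" using y' by simp
        then show ?thesis unfolding z[symmetric] using g c ri pw v u bw False nl
          by (simp add: tree_body_def graph_state_def v_def[symmetric] A_def[symmetric] S_def[symmetric] u_def[symmetric])
      qed
      moreover have "tree_inv r t S0 p (A(u := (A u + y) mod r)) (S(pe v := y))"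
        using tree_step[OF T p(2) rt] tv by (simp add: v_def u_def y_def)
      ultimately show ?thesis by simp
    qed
    moreover have "bfits w tree_cond s' \<and> bval tree_cond s'" using ri pw by (simp add: tree_cond_def)
    ultimately show "bfits w tree_cond s' \<and> bval tree_cond s' \<and> fits w tree_body s' \<and>
        ?I (Suc i) ?s"
      by (simp add: p_def)
  next
    fix s' :: store
    assume "?I n s'"
    then show "bfits w tree_cond s' \<and> \<not> bval tree_cond s' \<and> (\<exists>A. tree_inv r t S0 0 A (arr s' ''s''))"
      by (auto simp: tree_cond_def)
  qed simp_all
qed (simp add: tree_cond_def)

end

section \<open>Correctness of the labelling\<close>

lemma halving_odd:
  fixes d r :: nat
  assumes "odd r" "d < r"
  shows "\<exists>j<r. 2 * j mod r = d"
proof (cases "even d")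
  case True
  then obtain j where "d = 2 * j" by blast
  then show ?thesis using assms by (intro exI[of _ j]) auto
next
  case False
  then obtain j where j: "d + r = 2 * j" using assms(1) by (metis evenE odd_even_add)
  then have "j < r" using assms(2) by simp
  then show ?thesis using j assms(2) by (metis mod_add_self2 mod_less)
qed

text \<open>\<open>no_pair\<close> is niceness in terms of roots: a component with exactly two
  vertices is a copy of the complete graph on two vertices.\<close>

locale nice_colored = colored +
  assumes proper: "\<And>e. e < m \<Longrightarrow> col (U e) \<noteq> col (W e)"
    and no_pair: "\<And>\<rho>. card {v. v < n \<and> root v = \<rho>} \<noteq> 2"
begin

abbreviation fiber :: "nat \<Rightarrow> nat set" where
  "fiber \<rho> \<equiv> {v. v < n \<and> root v = \<rho>}"

lemma settled_less:
  assumes "settled t (root v)" "v < n" shows "t v < k"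
  using assms swap_less col unfolding settled_def by metis

lemma settled_proper:
  assumes "\<And>v. v < n \<Longrightarrow> settled t (root v)" "e < m"
  shows "t (U e) \<noteq> t (W e)"
proof -
  obtain x y where "\<forall>v<n. root v = root (U e) \<longrightarrow> t v = swap x y (col v)"
    using assms(1)[OF U] unfolding settled_def by blast
  then have "t (U e) = swap x y (col (U e))" "t (W e) = swap x y (col (W e))"
    using U W root_edge[OF assms(2)] by simp_all
  then show ?thesis using proper[OF assms(2)] by (simp add: swap_eq_iff)
qed

text \<open>An odd sum would come from a full component with odd color sum, and by
  \<open>sum_all_odd\<close> this forces \<open>k mod 4 = 2\<close> for even
  \<open>k\<close>.\<close>

lemma settled_even:
  assumes "settled t \<rho>" "even k" "\<not> (k mod 4 = 2 \<and> full \<rho>)"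
  shows "even (\<Sum>v\<in>fiber \<rho>. t v)"
proof (rule ccontr)
  assume "\<not> ?thesis"
  then have f: "full \<rho>" "odd (\<Sum>v\<in>fiber \<rho>. col v)" using assms(1) by (auto simp: settled_def)
  have "odd (card {v \<in> fiber \<rho>. col v = c})" if "c < k" for c
    using f(1) that by (simp add: full_def conj_assoc)
  then have "k mod 4 = 2" using sum_all_odd[of "fiber \<rho>" col k] f(2) assms(2) col by auto
  then show False using f(1) assms(3) by simp
qed

text \<open>If the root is the only vertex on an even level, the chosen side is the rest of the
  component; it is not a single vertex since the component does not have two.\<close>

lemma side_count: "card {v. v < n \<and> root v = \<rho> \<and> side v} \<noteq> 1"
proof (cases "\<exists>v<n. root v = \<rho>")
  case False
  then have "{v. v < n \<and> root v = \<rho> \<and> side v} = {}" by auto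
  then show ?thesis by (simp only: card.empty)
next
  case True
  then have \<rho>: "\<rho> < n" "root \<rho> = \<rho>" "dp \<rho> = 0" using dp_root by auto
  have ev: "{v. v < n \<and> root v = \<rho> \<and> dp v = 0} \<noteq> {}" "finite {v. v < n \<and> root v = \<rho> \<and> dp v = 0}"
    using \<rho> by auto
  then have pos: "0 < evens \<rho>" unfolding evens_def by (simp add: card_gt_0_iff)
  show ?thesis
  proof (cases "1 < evens \<rho>")
    case True
    then have "{v. v < n \<and> root v = \<rho> \<and> side v} = {v. v < n \<and> root v = \<rho> \<and> dp v = 0}" by (auto simp: side_def)
    then show ?thesis using True by (simp add: evens_def)
  next
    case False
    then have one: "evens \<rho> = 1" using pos by simp
    have "fiber \<rho> = {v. v < n \<and> root v = \<rho> \<and> dp v = 0} \<union> {v. v < n \<and> root v = \<rho> \<and> side v}"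
    proof (rule set_eqI)
      fix v
      show "v \<in> fiber \<rho> \<longleftrightarrow> v \<in> {v. v < n \<and> root v = \<rho> \<and> dp v = 0} \<union> {v. v < n \<and> root v = \<rho> \<and> side v}"
        using False dp_cases[of v] by (auto simp: side_def)
    qed
    moreover have "{v. v < n \<and> root v = \<rho> \<and> dp v = 0} \<inter> {v. v < n \<and> root v = \<rho> \<and> side v} = {}"
      using False by (auto simp: side_def)
    ultimately have "card (fiber \<rho>) = evens \<rho> + card {v. v < n \<and> root v = \<rho> \<and> side v}"
      unfolding evens_def by (simp add: card_Un_disjoint)
    then show ?thesis using one no_pair[of \<rho>] by simp
  qed
qed

lemma even_sg_sum: "even (\<Sum>v\<in>F. sg v * int (t v)) \<longleftrightarrow> even (\<Sum>v\<in>F. t v)" if "finite F"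
  using that by (induction F) (auto simp: sg_def)

text \<open>Double counting of incidences over a set closed under adjacency. On the right, edges
  joining different parities cancel and edges inside a level count twice.\<close>

lemma sum_incident:
  assumes "finite F" "\<And>e. e < m \<Longrightarrow> U e \<in> F \<longleftrightarrow> W e \<in> F"
  shows "(\<Sum>v\<in>F. sg v * (\<Sum>e\<in>inc v. f e)) = (\<Sum>e | e < m \<and> U e \<in> F. (sg (U e) + sg (W e)) * f e)"
proof -
  have "(\<Sum>v\<in>F. sg v * (\<Sum>e\<in>inc v. f e)) = (\<Sum>v\<in>F. \<Sum>e | e < m. if U e = v \<or> W e = v then sg v * f e else 0)"
  proof (rule sum.cong[OF refl])
    fix v
    have "(\<Sum>e | e \<in> {e. e < m} \<and> (U e = v \<or> W e = v). sg v * f e) =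
        (\<Sum>e | e < m. if U e = v \<or> W e = v then sg v * f e else 0)"
      by (rule sum.inter_filter) simp
    then show "sg v * (\<Sum>e\<in>inc v. f e) = (\<Sum>e | e < m. if U e = v \<or> W e = v then sg v * f e else 0)"
      by (simp add: inc_def sum_distrib_left)
  qed
  also have "\<dots> = (\<Sum>e | e < m. \<Sum>v\<in>F. if U e = v \<or> W e = v then sg v * f e else 0)"
    by (rule sum.swap)
  also have "\<dots> = (\<Sum>e | e < m. if U e \<in> F then (sg (U e) + sg (W e)) * f e else 0)"
  proof (intro sum.cong refl)
    fix e assume "e \<in> {e. e < m}"
    then have e: "e < m" by simp
    have "(\<Sum>v\<in>F. if U e = v \<or> W e = v then sg v * f e else 0) = (\<Sum>v\<in>F \<inter> {U e, W e}. sg v * f e)"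
      using assms(1) by (intro sum.mono_neutral_cong_right) auto
    also have "F \<inter> {U e, W e} = (if U e \<in> F then {U e, W e} else {})" using assms(2)[OF e] by auto
    finally show "(\<Sum>v\<in>F. if U e = v \<or> W e = v then sg v * f e else 0) =
        (if U e \<in> F then (sg (U e) + sg (W e)) * f e else 0)"
      using UW[OF e] by (simp add: distrib_right)
  qed
  also have "\<dots> = (\<Sum>e | e < m \<and> U e \<in> F. (sg (U e) + sg (W e)) * f e)"
    by (simp add: sum.inter_filter[symmetric])
  finally show ?thesis .
qed

section \<open>From the targets to the forced sums at the roots\<close>

context
  fixes r :: nat and t0 oe t D S0 S A :: "nat \<Rightarrow> nat"
  assumes r: "r = (if k mod 4 = 2 \<and> (\<exists>v<n. full (root v)) then k + 1 else k)"
    and t0: "\<And>v. v < n \<Longrightarrow> settled t0 (root v)"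
    and oe_none: "\<And>e. oe (root (U e)) = 0 \<Longrightarrow> e < m \<Longrightarrow> dp (U e) \<noteq> dp (W e)"
    and oe_some: "\<And>\<rho> e. oe \<rho> = Suc e \<Longrightarrow> e < m \<and> root (U e) = \<rho> \<and> dp (U e) = dp (W e)"
    and t: "\<And>v. v < n \<Longrightarrow> if 2 < r \<and> oe (root v) = 0 then (if side v then 0 < t v \<and> t v < r else t v = 0) else t v = t0 v"
    and t_sum: "\<And>\<rho>. 2 < r \<Longrightarrow> oe \<rho> = (0::nat) \<Longrightarrow> (\<Sum>v\<in>fiber \<rho>. t v) mod r = 0"
begin

lemma r2: "2 \<le> r" "k \<le> r" "r \<le> n + 1"
  using r k2 kn by auto

lemma target_less: "v < n \<Longrightarrow> t v < r"
  using t[of v] settled_less[OF t0] r2 by (fastforce split: if_splits)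

text \<open>Where the targets were chosen anew, every edge joins different parities and thus has
  exactly one end on the chosen side, so a nonzero color meets 0. Elsewhere the targets are a
  swapped proper coloring.\<close>

lemma target_proper:
  assumes e: "e < m" shows "t (U e) \<noteq> t (W e)"
proof (cases "2 < r \<and> oe (root (U e)) = 0")
  case True
  have "side (U e) \<noteq> side (W e)"
    using oe_none[of e] e True root_edge[OF e] dp_cases[of "U e"] dp_cases[of "W e"] by (auto simp: side_def)
  then show ?thesis using t[OF U, of e] t[OF W, of e] True root_edge[OF e] by (auto split: if_splits)
next
  case False
  then have "t (U e) = t0 (U e)" "t (W e) = t0 (W e)"
    using t[OF U, of e] t[OF W, of e] root_edge[OF e] by auto
  then show ?thesis using settled_proper[OF t0 e] by simp
qed

lemma target_even:
  assumes "even r" "\<not> (2 < r \<and> oe \<rho> = 0)" "\<exists>v<n. root v = \<rho>"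
  shows "even (\<Sum>v\<in>fiber \<rho>. t v)"
proof -
  \<comment> \<open>An even \<open>r\<close> cannot be \<open>k + 1\<close>, which is odd when
    \<open>k mod 4 = 2\<close>; so the exceptional case is excluded.\<close>
  have k: "even k" "\<not> (k mod 4 = 2 \<and> (\<exists>v<n. full (root v)))"
    using assms(1) r by (auto split: if_splits) presburger+
  have "(\<Sum>v\<in>fiber \<rho>. t v) = (\<Sum>v\<in>fiber \<rho>. t0 v)"
    by (intro sum.cong refl) (use t assms(2) in auto)
  moreover have "even (\<Sum>v\<in>fiber \<rho>. t0 v)" using assms(3) k t0 settled_even by blast
  ultimately show ?thesis by simp
qed

context
  assumes D: "\<And>\<rho>. D \<rho> < r \<and> int (D \<rho>) = (\<Sum>v\<in>fiber \<rho>. sg v * int (t v)) mod int r"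
begin

lemma defect_even:
  assumes "even r" "\<not> (2 < r \<and> oe \<rho> = 0)"
  shows "even (D \<rho>)"
proof (cases "\<exists>v<n. root v = \<rho>")
  case True
  have "even (\<Sum>v\<in>fiber \<rho>. sg v * int (t v))"
    using target_even[OF assms True] even_sg_sum[of "fiber \<rho>" t] by simp
  then have "even ((\<Sum>v\<in>fiber \<rho>. sg v * int (t v)) mod int r)" using assms(1) by (simp add: dvd_mod)
  then have "even (int (D \<rho>))" using D[of \<rho>] by metis
  then show ?thesis by simp
next
  case False
  then have "fiber \<rho> = {}" by blast
  then have "int (D \<rho>) = 0" using D[of \<rho>] by (simp only: sum.empty) simp
  then show ?thesis by simp
qed

text \<open>For \<open>r = 2\<close> the defect is even and below 2. For \<open>2 < r\<close> the
  nonzero targets lie on one side and share a sign, so the alternating sum is plus or minus the sum,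
  which vanishes modulo \<open>r\<close>.\<close>

lemma defect_zero:
  assumes "oe \<rho> = 0" shows "D \<rho> = 0"
proof (cases "2 < r")
  case False
  then have "r = 2" using r2 by simp
  then show ?thesis using defect_even[of \<rho>] D[of \<rho>] by (auto elim!: evenE)
next
  case True
  define c :: int where "c = (if 1 < evens \<rho> then 1 else - 1)"
  have "(\<Sum>v\<in>fiber \<rho>. sg v * int (t v)) = (\<Sum>v\<in>fiber \<rho>. c * int (t v))"
  proof (intro sum.cong refl)
    fix v assume v: "v \<in> fiber \<rho>"
    show "sg v * int (t v) = c * int (t v)"
    proof (cases "side v")
      case True
      then have "sg v = c" using v by (auto simp: side_def sg_def c_def split: if_splits)
      then show ?thesis by simp
    next
      case False
      then have "t v = 0" using t[of v] v \<open>2 < r\<close> assms by simp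
      then show ?thesis by simp
    qed
  qed
  also have "\<dots> = c * int (\<Sum>v\<in>fiber \<rho>. t v)" by (simp add: sum_distrib_left)
  finally have "int r dvd (\<Sum>v\<in>fiber \<rho>. sg v * int (t v))"
    using t_sum[OF True assms] by (simp add: mod_eq_0_iff_dvd del: of_nat_sum)
  then have "(\<Sum>v\<in>fiber \<rho>. sg v * int (t v)) mod int r = 0" by simp
  then show ?thesis using D[of \<rho>] by (metis of_nat_eq_0_iff)
qed

lemma defect_halving:
  assumes "oe \<rho> = Suc e"
  shows "\<exists>j<r. 2 * j mod r = D \<rho>"
proof (cases "even r")
  case True
  then have "even (D \<rho>)" using defect_even assms by simp
  then obtain j where "D \<rho> = 2 * j" by blast
  then show ?thesis using D[of \<rho>] by (intro exI[of _ j]) auto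
next
  case False
  then show ?thesis using halving_odd D by blast
qed

text \<open>Only the root is left. The alternating sum of the actual sums over the component is
  computed by \<open>sum_incident\<close> and agrees with that of the targets; the terms of all
  other vertices agree already, and subtracting them isolates the root.\<close>

lemma labelling_target:
  assumes S0: "\<And>e. e < m \<Longrightarrow> if oe (root (U e)) = Suc e
       then (2 * sg (U e) * int (S0 e)) mod int r = int (D (root (U e))) else S0 e = 0"
    and S: "tree_inv r t S0 0 A S"
    and v: "v < n"
  shows "(\<Sum>e\<in>inc v. S e) mod r = t v"
proof (cases "root v = v")
  case False
  obtain i where "i < n" "v = q i" using q_surj[OF v] .
  then show ?thesis using S False by (simp add: tree_inv_def)
next
  case True
  define F where "F = fiber v"
  have fin: "finite F" and vF: "v \<in> F" using True v by (simp_all add: F_def)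
  have cl: "U e \<in> F \<longleftrightarrow> W e \<in> F" if "e < m" for e using U W root_edge[OF that] by (simp add: F_def)
  \<comment> \<open>The root has level 0, hence sign 1, so its own congruence is obtained without a
    factor.\<close>
  have sgv: "sg v = 1" using dp_root[OF v True] by (simp add: sg_def)
  have tree: "int (\<Sum>e\<in>inc u. S e) mod int r = int (t u)" if "u \<in> F - {v}" for u
  proof -
    have u: "u < n" "root u \<noteq> u" using that by (auto simp: F_def)
    obtain i where "i < n" "u = q i" using q_surj[OF u(1)] .
    then have "(\<Sum>e\<in>inc u. S e) mod r = t u" using S u by (simp add: tree_inv_def)
    then show ?thesis by (metis zmod_int)
  qed
  have Sdp: "S e = S0 e" if "e < m" "dp (U e) = dp (W e)" for e using S that by (simp add: tree_inv_def)
  have "(\<Sum>u\<in>F. sg u * int (\<Sum>e\<in>inc u. S e)) = (\<Sum>e | e < m \<and> U e \<in> F. (sg (U e) + sg (W e)) * int (S e))"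
    using sum_incident[OF fin cl, where f = "\<lambda>e. int (S e)"] by simp
  also have "\<dots> mod int r = int (D v) mod int r"
  proof (cases "oe v")
    case 0
    have "(sg (U e) + sg (W e)) * int (S e) = 0" if "e < m" "U e \<in> F" for e
    proof -
      have "dp (U e) \<noteq> dp (W e)" using oe_none[of e] that 0 by (simp add: F_def)
      then show ?thesis using dp_cases[of "U e"] dp_cases[of "W e"] by (auto simp: sg_def)
    qed
    then have "(\<Sum>e | e < m \<and> U e \<in> F. (sg (U e) + sg (W e)) * int (S e)) = 0" by (intro sum.neutral) auto
    then show ?thesis using defect_zero[OF 0] by simp
  next
    case (Suc e0)
    have e0: "e0 < m" "U e0 \<in> F" "root (U e0) = v" "dp (U e0) = dp (W e0)"
      using oe_some[OF Suc] U by (simp_all add: F_def)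
    have "(sg (U e) + sg (W e)) * int (S e) = 0" if "e < m" "U e \<in> F" "e \<noteq> e0" for e
    proof (cases "dp (U e) = dp (W e)")
      case True
      then show ?thesis using S0[OF that(1)] Sdp[OF that(1)] that Suc by (simp add: F_def)
    next
      case False
      then show ?thesis using dp_cases[of "U e"] dp_cases[of "W e"] by (auto simp: sg_def)
    qed
    then have "(\<Sum>e | e < m \<and> U e \<in> F. (sg (U e) + sg (W e)) * int (S e)) =
        (\<Sum>e\<in>{e0}. (sg (U e) + sg (W e)) * int (S e))"
      using e0 by (intro sum.mono_neutral_right) auto
    also have "\<dots> = 2 * sg (U e0) * int (S0 e0)" using e0 Sdp[OF e0(1)] by (simp add: sg_def)
    finally have "(\<Sum>e | e < m \<and> U e \<in> F. (sg (U e) + sg (W e)) * int (S e)) = 2 * sg (U e0) * int (S0 e0)" .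
    then show ?thesis using S0[OF e0(1)] Suc e0 D[of v] by simp
  qed
  also have "\<dots> = (\<Sum>u\<in>F. sg u * int (t u)) mod int r" using D[of v] by (simp add: F_def)
  finally have eq: "(\<Sum>u\<in>F. sg u * int (\<Sum>e\<in>inc u. S e)) mod int r = (\<Sum>u\<in>F. sg u * int (t u)) mod int r" .
  have "sg u * int (\<Sum>e\<in>inc u. S e) mod int r = sg u * int (t u) mod int r" if u: "u \<in> F - {v}" for u
  proof -
    have "sg u * int (\<Sum>e\<in>inc u. S e) mod int r = sg u * (int (\<Sum>e\<in>inc u. S e) mod int r) mod int r"
      by (simp only: mod_mult_right_eq)
    also have "\<dots> = sg u * int (t u) mod int r" by (simp only: tree[OF u])
    finally show ?thesis .
  qed
  then have "(\<Sum>u\<in>F - {v}. sg u * int (\<Sum>e\<in>inc u. S e) mod int r) = (\<Sum>u\<in>F - {v}. sg u * int (t u) mod int r)"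
    by (intro sum.cong refl)
  then have "(\<Sum>u\<in>F - {v}. sg u * int (\<Sum>e\<in>inc u. S e) mod int r) mod int r =
      (\<Sum>u\<in>F - {v}. sg u * int (t u) mod int r) mod int r"
    by (simp only:)
  then have "(\<Sum>u\<in>F - {v}. sg u * int (\<Sum>e\<in>inc u. S e)) mod int r = (\<Sum>u\<in>F - {v}. sg u * int (t u)) mod int r"
    unfolding mod_sum_eq .
  moreover have "(\<Sum>u\<in>F. sg u * f u) = f v + (\<Sum>u\<in>F - {v}. sg u * f u)" for f
    using sum.remove[OF fin vF, of "\<lambda>u. sg u * f u"] sgv by simp
  ultimately have "int (\<Sum>e\<in>inc v. S e) mod int r = int (t v) mod int r"
    using eq mod_diff_cong[of "int (\<Sum>e\<in>inc v. S e) + (\<Sum>u\<in>F - {v}. sg u * int (\<Sum>e\<in>inc u. S e))" "int r"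
        "int (t v) + (\<Sum>u\<in>F - {v}. sg u * int (t u))"
        "(\<Sum>u\<in>F - {v}. sg u * int (\<Sum>e\<in>inc u. S e))" "(\<Sum>u\<in>F - {v}. sg u * int (t u))"] by simp
  then have "int ((\<Sum>e\<in>inc v. S e) mod r) = int (t v)" using target_less[OF v] by (simp add: zmod_int del: of_nat_sum)
  then show ?thesis by simp
qed

end

end

end

lemma mods_progs [simp]:
  "mod_regs adj_prog = {''u'', ''v'', ''h'', ''i''}" "mod_arrs adj_prog = {''nx'', ''ds'', ''ei'', ''hd''}"
  "mod_regs odd_prog = {''i''}" "mod_arrs odd_prog = {''od''}"
  "mod_regs bfs_prog = {''h'', ''p'', ''v'', ''qt'', ''u'', ''qh'', ''cr'', ''rt''}"
  "mod_arrs bfs_prog = {''di'', ''root'', ''dp'', ''pr'', ''pe'', ''q''}"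
  "mod_regs comp_prog = {''cr'', ''b'', ''no'', ''sm'', ''z'', ''bd'', ''x'', ''y'', ''p'', ''v'', ''a''}"
  "mod_arrs comp_prog = {''pc'', ''t''}"
  "mod_regs modulus_prog = {''x'', ''r''}" "mod_arrs modulus_prog = {}"
  "mod_regs half_prog = {''i'', ''x''}" "mod_arrs half_prog = {''hf''}"
  "mod_regs odd_edge_prog = {''i'', ''u''}" "mod_arrs odd_edge_prog = {''oe''}"
  "mod_regs even_level_prog = {''i'', ''x''}" "mod_arrs even_level_prog = {''c0''}"
  "mod_regs side_prog = {''i'', ''x'', ''y''}" "mod_arrs side_prog = {''sl'', ''rm''}"
  "mod_regs balance_prog = {''i'', ''x'', ''y'', ''z''}" "mod_arrs balance_prog = {''t'', ''ac'', ''rm''}"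
  "mod_regs defect_prog = {''i'', ''x'', ''y'', ''z''}" "mod_arrs defect_prog = {''df''}"
  "mod_regs odd_label_prog = {''i'', ''u'', ''x'', ''y''}" "mod_arrs odd_label_prog = {''s''}"
  "mod_regs incidence_prog = {''i'', ''y'', ''u'', ''z''}" "mod_arrs incidence_prog = {''as''}"
  "mod_regs tree_prog = {''i'', ''v'', ''u'', ''y'', ''z''}" "mod_arrs tree_prog = {''s'', ''as''}"
  unfolding adj_prog_def adj_body_def odd_prog_def odd_body_def bfs_prog_def bfs_body_def comp_prog_def comp_body_def
    count_prog_def count_body_def choose_prog_def find_prog_def first_even_body_def partner_body_def recolor_prog_def
    recolor_body_def modulus_prog_def mod4_body_def half_prog_def half_body_def odd_edge_prog_def odd_edge_body_def
    even_level_prog_def even_level_body_def side_prog_def side_body_def balance_prog_def balance_body_def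
    defect_prog_def defect_body_def odd_label_prog_def odd_label_body_def incidence_prog_def incidence_body_def
    tree_prog_def tree_body_def
  by (simp_all only: mods_For mod_regs.simps mod_arrs.simps Un_insert_left Un_empty_left Un_empty_right insert_commute
      Un_absorb insert_absorb2)

definition algorithm :: com where
  "algorithm =
     adj_prog ;; odd_prog ;; bfs_prog ;; comp_prog ;; modulus_prog ;; half_prog ;; odd_edge_prog ;; even_level_prog ;;
     side_prog ;; balance_prog ;; defect_prog ;; odd_label_prog ;; incidence_prog ;; tree_prog"

section \<open>Connected components as the fibers of the root map\<close>

context input
begin

definition edges :: "nat set set" where
  "edges = (\<lambda>i. {U i, W i}) ` {..<m}"

lemma edge_iff: "{u, v} \<in> edges \<longleftrightarrow> (\<exists>i<m. U i = u \<and> W i = v \<or> U i = v \<and> W i = u)"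
  by (auto simp: edges_def doubleton_eq_iff image_iff)

end

context forested
begin

lemma reachable_root:
  assumes "(u, v) \<in> (adjacency edges)\<^sup>*" "u < n"
  shows "v < n \<and> root v = root u"
  using assms
proof (induction rule: rtrancl_induct)
  case (step v x)
  then show ?case using root_edge U W by (auto simp: adjacency_def edge_iff)
qed simp

lemma sym_adjacency: "sym ((adjacency edges)\<^sup>*)"
  by (intro sym_rtrancl symI) (simp add: adjacency_def insert_commute)

lemma root_reachable: "i < n \<Longrightarrow> (q i, root (q i)) \<in> (adjacency edges)\<^sup>*"
proof (induction i rule: less_induct)
  case (less i)
  show ?case
  proof (cases "root (q i) = q i")
    case False
    then obtain j where j: "j < i" "pr (q i) = q j" using parent(1)[OF less.prems] by blast
    have "{U (pe (q i)), W (pe (q i))} \<in> edges" using parent(4)[OF less.prems False] by (simp add: edges_def)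
    then have "(q i, q j) \<in> adjacency edges" using parent(5)[OF less.prems False] j by (simp add: adjacency_def)
    moreover have "(q j, root (q j)) \<in> (adjacency edges)\<^sup>*" using less.IH[OF j(1)] j less.prems by simp
    ultimately show ?thesis using parent(2)[OF less.prems False] j by (simp add: converse_rtrancl_into_rtrancl)
  qed simp
qed

lemma component_fiber:
  assumes "v < n" shows "(adjacency edges)\<^sup>* `` {v} = {u. u < n \<and> root u = root v}"
proof (intro set_eqI iffI)
  fix u assume "u \<in> (adjacency edges)\<^sup>* `` {v}"
  then show "u \<in> {u. u < n \<and> root u = root v}" using reachable_root assms by blast
next
  fix u assume "u \<in> {u. u < n \<and> root u = root v}"
  then have u: "u < n" "root u = root v" by simp_all
  have "(x, root x) \<in> (adjacency edges)\<^sup>*" if "x < n" for x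
    using root_reachable q_surj[OF that] by metis
  then have "(v, root v) \<in> (adjacency edges)\<^sup>*" "(root v, u) \<in> (adjacency edges)\<^sup>*"
    using assms u sym_adjacency by (metis symD)+
  then show "u \<in> (adjacency edges)\<^sup>* `` {v}" by (auto intro: rtrancl_trans)
qed

lemma components_fibers: "components {0..<n} edges = (\<lambda>v. {u. u < n \<and> root u = root v}) ` {..<n}"
proof -
  have "components {0..<n} edges = (\<lambda>v. (adjacency edges)\<^sup>* `` {v}) ` {..<n}" by (auto simp: components_def)
  also have "\<dots> = (\<lambda>v. {u. u < n \<and> root u = root v}) ` {..<n}"
    by (rule image_cong) (simp_all add: component_fiber)
  finally show ?thesis .
qed

text \<open>In a fiber with two vertices the parent of the non-root lies in the fiber and differs
  from it, so it is the root and the two are adjacent. As there are no loops, the induced graph is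
  complete on two vertices.\<close>

lemma nice_fiber:
  assumes "nice {0..<n} edges"
  shows "card {v. v < n \<and> root v = \<rho>} \<noteq> 2"
proof
  let ?F = "{v. v < n \<and> root v = \<rho>}"
  assume c: "card ?F = 2"
  then have "?F \<noteq> {}" by (metis card.empty zero_neq_numeral)
  then have \<rho>: "\<rho> < n" "root \<rho> = \<rho>" by auto
  then have "card (?F - {\<rho>}) = 1" using c by (simp add: card_Diff_singleton)
  then obtain b where b: "?F - {\<rho>} = {b}" by (rule card_1_singletonE)
  then have F: "?F = {\<rho>, b}" "b < n" "root b = \<rho>" "b \<noteq> \<rho>" using \<rho> by auto
  obtain i where i: "i < n" "b = q i" using q_surj[OF F(2)] .
  have nr: "root (q i) \<noteq> q i" using i F by simp
  obtain j where j: "j < i" "pr b = q j" using parent(1)[OF i(1) nr] i by blast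
  have "root (pr b) = \<rho>" using parent(2)[OF i(1) nr] i F(3) by simp
  moreover have "pr b < n" using j by simp
  ultimately have "pr b \<in> ?F" by blast
  moreover have "pr b \<noteq> b" using j i by (simp add: q_eq_iff)
  ultimately have "pr b = \<rho>" using F by auto
  then have e: "{b, \<rho>} \<in> edges" using parent(4,5)[OF i(1) nr] i by (auto simp: edges_def)
  have ns: "{u} \<notin> edges" for u   proof
    assume "{u} \<in> edges"
    then obtain i where "i < m" "{u} = {U i, W i}" by (auto simp: edges_def)
    then show False using UW[of i] by (auto simp: singleton_insert_inj_eq)
  qed
  define f where "f = (\<lambda>x. if x = \<rho> then 0 else 1 :: nat)"
  have "graph_isomorphic ?F (induced_edges edges ?F) {0, 1::nat} (complete_edges {0, 1})"
    unfolding graph_isomorphic_def F(1)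
  proof (intro exI[of _ f] conjI ballI)
    show "bij_betw f {\<rho>, b} {0, 1}" using F(4) by (auto simp: bij_betw_def f_def)
    fix u v assume "u \<in> {\<rho>, b}" "v \<in> {\<rho>, b}"
    then show "{u, v} \<in> induced_edges edges {\<rho>, b} \<longleftrightarrow> {f u, f v} \<in> complete_edges {0, 1}"
      using e ns F(4) by (auto simp: induced_edges_def complete_edges_def f_def insert_commute doubleton_eq_iff)
  qed
  moreover have "?F \<in> components {0..<n} edges"
    unfolding components_fibers using \<rho> by (intro image_eqI[of _ _ \<rho>]) auto
  ultimately show False using assms by (auto simp: nice_def)
qed

end

context colored
begin

lemma full_components:
  assumes "\<And>v. v < n \<Longrightarrow> c v = col v"
  shows "(\<exists>C\<in>components {0..<n} edges. \<forall>i\<in>{0..<k}. odd (card {v \<in> C. c v = i})) \<longleftrightarrow> (\<exists>v<n. full (root v))"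
proof -
  have "full (root v) \<longleftrightarrow> (\<forall>i\<in>{0..<k}. odd (card {x \<in> {u. u < n \<and> root u = root v}. c x = i}))" for v
  proof -
    have "{x \<in> {u. u < n \<and> root u = root v}. c x = i} = {u. u < n \<and> root u = root v \<and> col u = i}" for i
      using assms by auto
    then show ?thesis by (auto simp: full_def)
  qed
  then show ?thesis unfolding components_fibers by (simp add: Bex_def)
qed

end

context forested
begin

lemma labelling_improper_twin:
  assumes inj: "inj_on (\<lambda>i. {U i, W i}) {..<m}"
    and S: "\<And>e. e < m \<Longrightarrow> S e < r" and t: "\<And>v. v < n \<Longrightarrow> (\<Sum>e\<in>inc v. S e) mod r = t v"
    and proper: "\<And>e. e < m \<Longrightarrow> t (U e) \<noteq> t (W e)" and r: "0 < r"
  obtains lab where "\<And>i. i < m \<Longrightarrow> lab {U i, W i} = S i" "improper_twin_edge_coloring r {0..<n} edges lab"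
proof -
  \<comment> \<open>Every edge is listed once, so its index can be recovered from the edge.\<close>
  define lab where "lab = (\<lambda>e. S (inv_into {..<m} (\<lambda>i. {U i, W i}) e))"
  have lab: "lab {U i, W i} = S i" if "i < m" for i
    using inv_into_f_f[OF inj, of i] that by (simp add: lab_def)
  have ind: "induced_color r edges lab v = t v" if "v < n" for v
  proof -
    have "{e. e \<in> edges \<and> v \<in> e} = (\<lambda>i. {U i, W i}) ` inc v" by (auto simp: edges_def inc_def)
    moreover have "inj_on (\<lambda>i. {U i, W i}) (inc v)" by (rule inj_on_subset[OF inj]) (auto simp: inc_def)
    ultimately have "(\<Sum>e | e \<in> edges \<and> v \<in> e. lab e) = (\<Sum>i\<in>inc v. lab {U i, W i})"
      by (simp add: sum.reindex)
    also have "\<dots> = (\<Sum>i\<in>inc v. S i)" by (intro sum.cong refl lab) (simp add: inc_def)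
    finally show ?thesis using t[OF that] by (simp add: induced_color_def)
  qed
  have "lab \<in> edges \<rightarrow> {0..<r}" using lab S by (auto simp: edges_def)
  moreover have "induced_color r edges lab \<in> {0..<n} \<rightarrow> {0..<r}" using r by (simp add: induced_color_def)
  moreover have "induced_color r edges lab u \<noteq> induced_color r edges lab v" if uv: "{u, v} \<in> edges" for u v
  proof -
    obtain i where i: "i < m" "U i = u \<and> W i = v \<or> U i = v \<and> W i = u" using uv edge_iff by blast
    then show ?thesis using proper[OF i(1)] ind[OF U, of i] ind[OF W, of i] by auto
  qed
  ultimately have "improper_twin_edge_coloring r {0..<n} edges lab"
    by (simp add: improper_twin_edge_coloring_def proper_vertex_coloring_def)
  then show ?thesis using that lab by blast
qed

end

section \<open>Assembling the passes into one linear-time algorithm\<close>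

lemma linear_bound: "x \<le> c * N \<Longrightarrow> 1 \<le> N \<Longrightarrow> x * a + b \<le> (c * a + b) * N" for x a b c N :: nat
proof -
  assume x: "x \<le> c * N" and N: "1 \<le> N"
  have "x * a \<le> (c * N) * a" using x by (intro mult_right_mono) simp_all
  moreover have "b * 1 \<le> b * N" using N by (intro mult_left_mono) simp_all
  moreover have "(c * a + b) * N = (c * N) * a + b * N" by (simp add: algebra_simps)
  ultimately show ?thesis by linarith
qed

lemma seq_bound: "1 \<le> N \<Longrightarrow> t \<le> a * N \<Longrightarrow> u \<le> b * N \<Longrightarrow> t + u + 1 \<le> (a + b + 1) * N" for t u a b N :: nat
  by (simp add: add_mult_distrib)

text \<open>
  Nested like the sequential compositions in \<open>algorithm\<close>, so that \<open>seq_bound\<close> yields it literally.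
\<close>

definition time_factor :: nat where
  "time_factor =
     (1 * (cost adj_body + 10) + 10 +
     (1 * (cost odd_body + 10) + 10 +
     (2 * (cost bfs_body + bcost bfs_cond + 1) + (bcost bfs_cond + 1) +
     (1 * colored.vertex_cost + (bcost comp_cond + 1) +
     (1 * (cost mod4_body + bcost mod4_cond + 1) + 60 +
     (2 * (cost half_body + 10) + 10 +
     (1 * (cost odd_edge_body + 10) + 10 +
     (1 * (cost even_level_body + 10) + 10 +
     (1 * (cost side_body + 10) + 10 +
     (1 * (cost balance_body + 10) + 10 +
     (1 * (cost defect_body + 10) + 10 +
     (1 * (cost odd_label_body + 10) + 10 +
     (1 * (cost incidence_body + 10) + 10 +
     (1 * (cost tree_body + bcost tree_cond + 1) + 20) + 1) + 1) + 1) + 1) + 1) + 1) + 1) + 1) + 1) + 1) + 1) + 1) + 1)"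

lemma algorithm_correct:
  fixes n k :: nat and V :: "nat set" and E :: "nat set set" and es :: "(nat \<times> nat) list" and c :: "nat \<Rightarrow> nat"
  assumes V: "V = {0..<n}" and G: "simple_graph V E" and nice: "nice V E" and es: "edge_list E es"
    and k: "2 \<le> k" "k \<le> n" and c: "proper_vertex_coloring k V E c"
  shows "\<exists>t st. exec (time_factor * (card V + card E)) algorithm (input_store n es k c) t st \<and>
     t \<le> time_factor * (card V + card E) \<and>
     (if k mod 4 = 2 \<and> (\<exists>C\<in>components V E. \<forall>i\<in>{0..<k}. odd (card {v \<in> C. c v = i}))
      then outputs_improper_twin (k + 1) V E es st else outputs_improper_twin k V E es st)"
proof -
  define m where "m = length es"
  define U where "U = (\<lambda>i. if i < length es then fst (es ! i) else 0)"
  define W where "W = (\<lambda>i. if i < length es then snd (es ! i) else 0)"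
  define col where "col = (\<lambda>v. if v < n then c v else 0)"
  \<comment> \<open>The same multiple of \<open>n + m\<close> serves as word bound and as time
    bound; \<open>time_factor\<close> is well above the 20 demanded by \<open>input\<close>.\<close>
  define w where "w = time_factor * (n + m)"
  have edge: "(\<lambda>(u, v). {u, v}) (es ! i) = {U i, W i}" if "i < m" for i
    using that by (simp add: U_def W_def m_def case_prod_beta)
  have map: "map (\<lambda>(u, v). {u, v}) es = map (\<lambda>i. {U i, W i}) [0..<m]"
    by (rule nth_equalityI) (simp_all add: edge m_def[symmetric])
  have dist: "distinct (map (\<lambda>i. {U i, W i}) [0..<m])" and set: "set (map (\<lambda>i. {U i, W i}) [0..<m]) = E"
    using es unfolding edge_list_def map by simp_all
  have inj: "inj_on (\<lambda>i. {U i, W i}) {..<m}" using dist by (simp add: distinct_map lessThan_atLeast0)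
  have E: "E = (\<lambda>i. {U i, W i}) ` {..<m}" using set by (simp add: lessThan_atLeast0)
  have cards: "card V = n" "card E = m" using V E inj by (simp_all add: card_image)
  have mem: "{U i, W i} \<in> E" if "i < m" for i using E that by simp
  have ne: "U i \<noteq> W i" "U i < n" "W i < n" if "i < m" for i
    using G mem[OF that] V by (force simp: simple_graph_def card_insert_if)+
  have n2: "2 \<le> n" using k by simp
  interpret input n m w U W
  proof
    show "20 * (n + m) \<le> w" unfolding w_def by (intro mult_right_mono) (simp_all add: time_factor_def)
    show "U i < n" "W i < n" for i using ne[of i] n2 by (auto simp: U_def W_def m_def)
  qed (use n2 ne in auto)
  have edges: "edges = E" using E by (simp add: edges_def)
  define N where "N = n + m"
  have N: "1 \<le> N" "n \<le> 1 * N" "m \<le> 1 * N" "k \<le> 1 * N" "2 * n + 2 * m \<le> 2 * N" using k by (simp_all add: N_def)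
  define s0 where "s0 = input_store n es k c"
  have s0r: "reg s0 x = (if x = ''k'' then k else if x = ''m'' then m else if x = ''n'' then n else 0)" for x
    by (simp add: s0_def input_store_def m_def)
  have s0a: "arr s0 a = (if a = ''col'' then col else if a = ''snd'' then W else if a = ''fst'' then U else (\<lambda>_. 0))" for a
    by (simp add: s0_def input_store_def col_def U_def W_def)

  obtain t1 s1 where e1: "exec w adj_prog s0 t1 s1" "t1 \<le> m * (cost adj_body + 10) + 10"
    and q1: "adj (2 * m) (arr s1 ''hd'') (arr s1 ''nx'')" "\<And>h. h < 2 * m \<Longrightarrow> arr s1 ''ds'' h = hdst h \<and> arr s1 ''ei'' h = h div 2"
    using adj_prog[of s0] unfolding run_def by (auto simp: s0r s0a)
  note f1 = frame_reg[OF exec_frame[OF e1(1)], simplified] frame_arr[OF exec_frame[OF e1(1)], simplified]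
  obtain t2 s2 where e2: "exec w odd_prog s1 t2 s2" "t2 \<le> k * (cost odd_body + 10) + 10"
    and q2: "\<forall>i\<le>k. arr s2 ''od'' i = i mod 2"
    using odd_prog[of s1 k] k unfolding run_def by (auto simp: s0r s0a f1)
  note f2 = frame_reg[OF exec_frame[OF e2(1)], simplified] frame_arr[OF exec_frame[OF e2(1)], simplified]
  obtain t3 s3 where e3: "exec w bfs_prog s2 t3 s3"
      "t3 \<le> (2 * n + 2 * m) * (cost bfs_body + bcost bfs_cond + 1) + bcost bfs_cond + 1"
    and q3: "forest (arr s3 ''q'') (arr s3 ''root'') (arr s3 ''dp'') (arr s3 ''pr'') (arr s3 ''pe'')"
    using bfs_prog[of s2] q1 unfolding run_def by (auto simp: s0r s0a f1 f2)
  note f3 = frame_reg[OF exec_frame[OF e3(1)], simplified] frame_arr[OF exec_frame[OF e3(1)], simplified]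
  define q where "q = arr s3 ''q''"
  define root where "root = arr s3 ''root''"
  define dp where "dp = arr s3 ''dp''"
  define pr where "pr = arr s3 ''pr''"
  define pe where "pe = arr s3 ''pe''"
  interpret forested n m w U W q root dp pr pe
    by unfold_locales (use q3 in \<open>simp add: q_def root_def dp_def pr_def pe_def\<close>)
  have colk: "col v < k" if "v < n" for v
    using c that V by (auto simp: proper_vertex_coloring_def col_def Pi_iff)
  have colp: "col (U e) \<noteq> col (W e)" if "e < m" for e
    using c mem[OF that] ne[OF that] by (auto simp: proper_vertex_coloring_def col_def)
  interpret nice_colored n m w U W q root dp pr pe k col
    by unfold_locales (use k colk colp nice_fiber nice V edges in auto)
  have full: "(\<exists>C\<in>components V E. \<forall>i\<in>{0..<k}. odd (card {v \<in> C. c v = i})) \<longleftrightarrow> (\<exists>v<n. full (root v))"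
    unfolding V edges[symmetric] by (rule full_components) (simp add: col_def)
  have st3: "static s3" unfolding static_def using q2 by (simp add: s0r s0a f1 f2 f3 q_def root_def)
  have g3: "graph_state s3"
    unfolding graph_state_def by (simp add: s0r s0a f1 f2 f3 q_def root_def dp_def pr_def pe_def)

  obtain t4 s4 where e4: "exec w comp_prog s3 t4 s4" "t4 \<le> n * vertex_cost + bcost comp_cond + 1"
    and q4: "\<forall>v<n. settled (arr s4 ''t'') (root v)" "reg s4 ''bd'' \<le> 1" "reg s4 ''bd'' = 1 \<longleftrightarrow> (\<exists>v<n. full (root v))"
    using comp_prog[of s3] st3 unfolding run_def by (auto simp: s0r s0a f1 f2 f3)
  note f4 = frame_reg[OF exec_frame[OF e4(1)], simplified] frame_arr[OF exec_frame[OF e4(1)], simplified]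
  define t0 where "t0 = arr s4 ''t''"
  define r where "r = (if k mod 4 = 2 \<and> (\<exists>v<n. full (root v)) then k + 1 else k)"
  have r: "2 \<le> r" "r \<le> n + 1" "0 < r" using k by (simp_all add: r_def)
  obtain t5 s5 where e5: "exec w modulus_prog s4 t5 s5" "t5 \<le> k * (cost mod4_body + bcost mod4_cond + 1) + 60"
    and q5: "reg s5 ''r'' = r"
    using modulus_prog[of s4 k] k q4 unfolding run_def r_def by (auto simp: s0r s0a f1 f2 f3 f4)
  note f5 = frame_reg[OF exec_frame[OF e5(1)], simplified] frame_arr[OF exec_frame[OF e5(1)], simplified]
  obtain t6 s6 where e6: "exec w half_prog s5 t6 s6" "t6 \<le> r * (cost half_body + 10) + 10"
    and q6: "\<And>j. j < r \<Longrightarrow> arr s6 ''hf'' (2 * j mod r) < r \<and> 2 * arr s6 ''hf'' (2 * j mod r) mod r = 2 * j mod r"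
    using half_prog[OF q5 r(2,3)] unfolding run_def by auto
  note f6 = frame_reg[OF exec_frame[OF e6(1)], simplified] frame_arr[OF exec_frame[OF e6(1)], simplified]
  have g6: "graph_state s6" using g3 unfolding graph_state_def by (simp add: f4 f5 f6)
  obtain t7 s7 where e7: "exec w odd_edge_prog s6 t7 s7" "t7 \<le> m * (cost odd_edge_body + 10) + 10"
    and q7: "\<forall>\<rho>. (arr s7 ''oe'' \<rho> = 0 \<longrightarrow> (\<forall>e<m. root (U e) = \<rho> \<longrightarrow> dp (U e) \<noteq> dp (W e))) \<and>
       (\<forall>e. arr s7 ''oe'' \<rho> = Suc e \<longrightarrow> e < m \<and> root (U e) = \<rho> \<and> dp (U e) = dp (W e))"
    using odd_edge_prog[OF g6] unfolding run_def by (auto simp: s0r s0a f1 f2 f3 f4 f5 f6)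
  note f7 = frame_reg[OF exec_frame[OF e7(1)], simplified] frame_arr[OF exec_frame[OF e7(1)], simplified]
  define oe where "oe = arr s7 ''oe''"
  have oe0: "dp (U e) \<noteq> dp (W e)" if "oe (root (U e)) = 0" "e < m" for e using q7 that by (auto simp: oe_def)
  have oe1: "e < m \<and> root (U e) = \<rho> \<and> dp (U e) = dp (W e)" if "oe \<rho> = Suc e" for \<rho> e using q7 that by (auto simp: oe_def)
  have oem: "oe \<rho> \<le> m" for \<rho> using oe1[of \<rho>] by (cases "oe \<rho>") auto
  have g7: "graph_state s7" using g6 unfolding graph_state_def by (simp add: f7)
  obtain t8 s8 where e8: "exec w even_level_prog s7 t8 s8" "t8 \<le> n * (cost even_level_body + 10) + 10"
    and q8: "arr s8 ''c0'' = evens"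
    using even_level_prog[OF g7] unfolding run_def by (auto simp: s0r s0a f1 f2 f3 f4 f5 f6 f7)
  note f8 = frame_reg[OF exec_frame[OF e8(1)], simplified] frame_arr[OF exec_frame[OF e8(1)], simplified]
  have g8: "graph_state s8" using g7 unfolding graph_state_def by (simp add: f8)
  obtain t9 s9 where e9: "exec w side_prog s8 t9 s9" "t9 \<le> n * (cost side_body + 10) + 10"
    and q9: "\<And>v. v < n \<Longrightarrow> arr s9 ''sl'' v = (if side v then 1 else 0)"
      "\<And>\<rho>. arr s9 ''rm'' \<rho> = card {v. v < n \<and> root v = \<rho> \<and> side v}"
    using side_prog[OF g8 q8] unfolding run_def by (auto simp: s0r s0a f1 f2 f3 f4 f5 f6 f7 f8)
  note f9 = frame_reg[OF exec_frame[OF e9(1)], simplified] frame_arr[OF exec_frame[OF e9(1)], simplified]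
  have g9: "graph_state s9" using g8 unfolding graph_state_def by (simp add: f9)
  have r9: "reg s9 ''r'' = r" "arr s9 ''oe'' = oe" "arr s9 ''ac'' = (\<lambda>_. 0)" "arr s9 ''t'' = t0"
    using q5 by (simp_all add: s0a f1 f2 f3 f4 f5 f6 f7 f8 f9 oe_def t0_def)
  obtain t10 s10 where e10: "exec w balance_prog s9 t10 s10" "t10 \<le> n * (cost balance_body + 10) + 10"
    and q10: "\<And>v. v < n \<Longrightarrow> if 2 < r \<and> oe (root v) = 0
         then (if side v then 0 < arr s10 ''t'' v \<and> arr s10 ''t'' v < r else arr s10 ''t'' v = 0)
         else arr s10 ''t'' v = t0 v"
       "\<And>\<rho>. 2 < r \<Longrightarrow> oe \<rho> = 0 \<Longrightarrow> (\<Sum>v | v < n \<and> root v = \<rho>. arr s10 ''t'' v) mod r = 0"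
    using balance_prog[OF g9 r9(1) r(1,2) r9(2) oem q9 r9(3,4) side_count] unfolding run_def by blast
  note f10 = frame_reg[OF exec_frame[OF e10(1)], simplified] frame_arr[OF exec_frame[OF e10(1)], simplified]
  define t where "t = arr s10 ''t''"
  note fin = r_def q4(1)[folded t0_def, rule_format] oe0 oe1 q10[folded t_def]
  note tl = target_less[OF fin] and tp = target_proper[OF fin]
  have g10: "graph_state s10" using g9 unfolding graph_state_def by (simp add: f10)
  have r10: "reg s10 ''r'' = r" "arr s10 ''df'' = (\<lambda>_. 0)" using r9 by (simp_all add: s0a f1 f2 f3 f4 f5 f6 f7 f8 f9 f10)
  obtain t11 s11 where e11: "exec w defect_prog s10 t11 s11" "t11 \<le> n * (cost defect_body + 10) + 10"
    and q11: "\<And>\<rho>. arr s11 ''df'' \<rho> < r \<and>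
      int (arr s11 ''df'' \<rho>) = (\<Sum>v | v < n \<and> root v = \<rho>. sg v * int (t v)) mod int r"
    using defect_prog[OF g10 r10(1) r(3,2) r10(2) t_def[symmetric] tl] unfolding run_def by blast
  note f11 = frame_reg[OF exec_frame[OF e11(1)], simplified] frame_arr[OF exec_frame[OF e11(1)], simplified]
  define D where "D = arr s11 ''df''"
  note D = q11[folded D_def]
  define H where "H = arr s11 ''hf''"
  have g11: "graph_state s11" using g10 unfolding graph_state_def by (simp add: f11)
  have r11: "reg s11 ''r'' = r" "arr s11 ''oe'' = oe" "arr s11 ''s'' = (\<lambda>_. 0)"
    using r10 r9 by (simp_all add: s0a f1 f2 f3 f4 f5 f6 f7 f8 f9 f10 f11)
  have H: "H (D (root (U e))) < r \<and> 2 * H (D (root (U e))) mod r = D (root (U e))"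
    if "e < m" and oe: "oe (root (U e)) = Suc e" for e
  proof -
    obtain j where j: "j < r" "2 * j mod r = D (root (U e))" using defect_halving[OF fin D oe] by blast
    have "arr s6 ''hf'' = H" by (simp add: H_def f7 f8 f9 f10 f11)
    then show ?thesis using q6[OF j(1)] j(2) by simp
  qed
  obtain t12 s12 where e12: "exec w odd_label_prog s11 t12 s12" "t12 \<le> m * (cost odd_label_body + 10) + 10"
    and q12: "\<And>e. e < m \<Longrightarrow> arr s12 ''s'' e < r \<and> (if oe (root (U e)) = Suc e
       then (2 * sg (U e) * int (arr s12 ''s'' e)) mod int r = int (D (root (U e))) else arr s12 ''s'' e = 0)"
    using odd_label_prog[OF g11 r11(1) r(3,2) r11(2) D_def[symmetric] H_def[symmetric] r11(3) oem conjunct1[OF D] H]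
    unfolding run_def by blast
  note f12 = frame_reg[OF exec_frame[OF e12(1)], simplified] frame_arr[OF exec_frame[OF e12(1)], simplified]
  define S0 where "S0 = arr s12 ''s''"
  have S0r: "S0 e < r" if "e < m" for e using q12[OF that] by (simp add: S0_def)
  have S0d: "if oe (root (U e)) = Suc e then (2 * sg (U e) * int (S0 e)) mod int r = int (D (root (U e))) else S0 e = 0"
    if "e < m" for e using q12[OF that] by (simp add: S0_def)
  have S0z: "S0 e = 0" if "e < m" "dp (U e) \<noteq> dp (W e)" for e
    using S0d[OF that(1)] oe1[of "root (U e)" e] that by (auto split: if_splits)
  have g12: "graph_state s12" using g11 unfolding graph_state_def by (simp add: f12)
  have r12: "reg s12 ''r'' = r" "arr s12 ''as'' = (\<lambda>_. 0)"
    using r11 by (simp_all add: s0a f1 f2 f3 f4 f5 f6 f7 f8 f9 f10 f11 f12)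
  obtain t13 s13 where e13: "exec w incidence_prog s12 t13 s13" "t13 \<le> m * (cost incidence_body + 10) + 10"
    and q13: "\<And>v. arr s13 ''as'' v = (\<Sum>e | e < m \<and> (U e = v \<or> W e = v). S0 e) mod r"
    using incidence_prog[OF g12 r12(1) r(3,2) S0_def[symmetric] r12(2) S0r] unfolding run_def by blast
  note f13 = frame_reg[OF exec_frame[OF e13(1)], simplified] frame_arr[OF exec_frame[OF e13(1)], simplified]
  have g13: "graph_state s13" using g12 unfolding graph_state_def by (simp add: f13)
  have r13: "reg s13 ''r'' = r" "arr s13 ''s'' = S0" "arr s13 ''t'' = t"
    using r12 by (simp_all add: S0_def t_def f11 f12 f13)
  obtain t14 s14 where e14: "exec w tree_prog s13 t14 s14" "t14 \<le> n * (cost tree_body + bcost tree_cond + 1) + 20"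
    and q14: "\<exists>A. tree_inv r t S0 0 A (arr s14 ''s'')"
    using tree_prog[OF g13 r13(1) r(3,2) r13(2,3) q13[folded inc_def] S0r S0z tl] unfolding run_def by blast
  note f14 = frame_reg[OF exec_frame[OF e14(1)], simplified]
  define S where "S = arr s14 ''s''"
  obtain A where A: "tree_inv r t S0 0 A S" using q14 by (auto simp: S_def)
  have Sr: "S e < r" if "e < m" for e using A that by (simp add: tree_inv_def)
  have final: "(\<Sum>e\<in>inc v. S e) mod r = t v" if "v < n" for v
    by (rule labelling_target[OF fin D S0d A that])
  obtain lab where lab: "\<And>i. i < m \<Longrightarrow> lab {U i, W i} = S i" "improper_twin_edge_coloring r {0..<n} edges lab"
    using labelling_improper_twin[OF inj Sr final tp r(3)] by blast
  have "reg s14 ''r'' = r" using r13 by (simp add: f14)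
  moreover have "lab {fst (es ! i), snd (es ! i)} = arr s14 ''s'' i" if "i < length es" for i
    using lab(1)[of i] that by (simp add: m_def U_def W_def S_def)
  ultimately have out: "outputs_improper_twin r V E es s14"
    unfolding outputs_improper_twin_def using lab(2) V edges by auto

  note seq = exec.Seq[OF e1(1) exec.Seq[OF e2(1) exec.Seq[OF e3(1) exec.Seq[OF e4(1) exec.Seq[OF e5(1) exec.Seq[OF e6(1)
    exec.Seq[OF e7(1) exec.Seq[OF e8(1) exec.Seq[OF e9(1) exec.Seq[OF e10(1) exec.Seq[OF e11(1) exec.Seq[OF e12(1)
    exec.Seq[OF e13(1) e14(1)]]]]]]]]]]]]]
  define T where "T = t1 + (t2 + (t3 + (t4 + (t5 + (t6 + (t7 + (t8 + (t9 + (t10 + (t11 + (t12 + (t13 + t14 + 1) + 1) + 1) + 1) + 1) + 1) + 1) + 1) + 1) + 1) + 1) + 1) + 1"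
  have run: "exec w algorithm s0 T s14" unfolding algorithm_def T_def by (rule seq)
  \<comment> \<open>\<open>r\<close> may be \<open>n + 1\<close>; this is the origin of the factor 2
    for \<open>half_prog\<close> in \<open>time_factor\<close>.\<close>
  have rN: "r \<le> 2 * N" using r(2) n2 by (simp add: N_def)
  note b1 = order.trans[OF e1(2) linear_bound[OF N(3,1)]]
  note b2 = order.trans[OF e2(2) linear_bound[OF N(4,1)]]
  note b5 = order.trans[OF e5(2) linear_bound[OF N(4,1)]]
  note b6 = order.trans[OF e6(2) linear_bound[OF rN N(1)]]
  note b7 = order.trans[OF e7(2) linear_bound[OF N(3,1)]]
  note b8 = order.trans[OF e8(2) linear_bound[OF N(2,1)]]
  note b9 = order.trans[OF e9(2) linear_bound[OF N(2,1)]]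
  note b10 = order.trans[OF e10(2) linear_bound[OF N(2,1)]]
  note b11 = order.trans[OF e11(2) linear_bound[OF N(2,1)]]
  note b12 = order.trans[OF e12(2) linear_bound[OF N(3,1)]]
  note b13 = order.trans[OF e13(2) linear_bound[OF N(3,1)]]
  note b14 = order.trans[OF e14(2) linear_bound[OF N(2,1)]]
  have b3: "t3 \<le> (2 * (cost bfs_body + bcost bfs_cond + 1) + (bcost bfs_cond + 1)) * N"
    using e3(2) linear_bound[OF N(5,1), of "cost bfs_body + bcost bfs_cond + 1" "bcost bfs_cond + 1"] by simp
  have b4: "t4 \<le> (1 * vertex_cost + (bcost comp_cond + 1)) * N"
    using e4(2) linear_bound[OF N(2,1), of vertex_cost "bcost comp_cond + 1"] by simp
  note bound = seq_bound[OF N(1) b1 seq_bound[OF N(1) b2 seq_bound[OF N(1) b3 seq_bound[OF N(1) b4 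
    seq_bound[OF N(1) b5 seq_bound[OF N(1) b6 seq_bound[OF N(1) b7 seq_bound[OF N(1) b8 
    seq_bound[OF N(1) b9 seq_bound[OF N(1) b10 seq_bound[OF N(1) b11 seq_bound[OF N(1) b12 seq_bound[OF N(1) b13 b14]]]]]]]]]]]]]
  have "T \<le> time_factor * N" unfolding T_def time_factor_def by (rule bound)
  moreover have "if k mod 4 = 2 \<and> (\<exists>C\<in>components V E. \<forall>i\<in>{0..<k}. odd (card {v \<in> C. c v = i}))
      then outputs_improper_twin (k + 1) V E es s14 else outputs_improper_twin k V E es s14"
  proof (cases "k mod 4 = 2 \<and> (\<exists>v<n. full (root v))")
    case True
    then have "r = k + 1" unfolding r_def by (rule if_P)
    then show ?thesis unfolding full if_P[OF True] using out by (simp only:)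
  next
    case False
    then have "r = k" unfolding r_def by (rule if_not_P)
    then show ?thesis unfolding full if_not_P[OF False] using out by (simp only:)
  qed
  ultimately show ?thesis
    using run unfolding w_def s0_def cards N_def by blast
qed

theorem theorem4:
  "\<exists>(prog :: com) (K :: nat).
     \<forall>(n :: nat) (V :: nat set) (E :: nat set set) (es :: (nat \<times> nat) list)
      (k :: nat) (c :: nat \<Rightarrow> nat).
       V = {0..<n} \<longrightarrow> simple_graph V E \<longrightarrow> nice V E \<longrightarrow> edge_list E es \<longrightarrow>
       2 \<le> k \<longrightarrow> k \<le> n \<longrightarrow> proper_vertex_coloring k V E c \<longrightarrow>
       (\<exists>t st.
          exec (K * (card V + card E)) prog (input_store n es k c) t st \<and>
          t \<le> K * (card V + card E) \<and>
          (if k mod 4 = 2 \<and>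
              (\<exists>C\<in>components V E. \<forall>i\<in>{0..<k}. odd (card {v \<in> C. c v = i}))
           then outputs_improper_twin (k + 1) V E es st
           else outputs_improper_twin k V E es st))"
  by (rule exI[of _ algorithm], rule exI[of _ time_factor], intro allI impI, rule algorithm_correct)

end
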